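(* Let $n\ge1$. Consider the component-wise AND function: Alice has $X\in\{0,1\}^n$, Bob has $Y\in\{0,1\}^n$, Charlie outputs $Z=X\wedge Y$ (bit-wise). For every distribution $p_{XY}$ with full support on $\{0,1\}^n\times\{0,1\}^n$, any secure protocol $\Pi(p_{XY},\text{AND})$ satisfies \[H(M_{31})\ge n\log 3,\quad H(M_{23})\ge n\log 3,\quad H(M_{12})\ge 1.826\,n,\] and $\rho(p_{XY},\text{AND})\ge 1.826\,n$.
   Context: Setting: Alice (party 1) holds $X$, Bob (party 2) holds $Y$, $(X,Y)\sim p_{XY}$ on finite sets; Charlie (party 3) has no input and outputs $Z$, which should equal $f(X,Y)$ for the deterministic function $f$. In a protocol the parties, each with private randomness, exchange messages over multiple rounds on three pairwise private links, each message a codeword of a prefix-free code determined by previous messages on that link; the protocol terminates with probability 1 and may depend on $p_{XY}$. $M_{12},M_{23},M_{31}$ are the final transcripts on the Alice–Bob, Bob–Charlie, Charlie–Alice links; the view $V_i$ of party $i$ consists of the transcripts on its two links plus its input (Alice, Bob) or output (Charlie). A secure protocol satisfies correctness (Charlie outputs $f(x,y)$ on inputs $x,y$) and privacy (Markov chains $(M_{12},M_{31})-X-(Y,Z)$, $(M_{12},M_{23})-Y-(X,Z)$, $(M_{23},M_{31})-Z-(X,Y)$). $\rho(p_{XY},f)=\inf H(V_1,V_2,V_3|X,Y)$ over all secure protocols for $f$ with input distribution $p_{XY}$. Logs base 2. *)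

theory Defs
  imports "HOL-Analysis.Analysis" "HOL-Probability.Probability" "HOL-Library.Sublist"
begin

datatype party = Alice | Bob | Charlie

datatype link = L12 | L23 | L31

text \<open>Structured history of a link: the list of (non-empty) messages sent on it so far,
  in order.  A message is a bit string.\<close>
type_synonym msg = "bool list"
type_synonym hist = "msg list"
type_synonym state = "hist \<times> hist \<times> hist"   \<comment> \<open>(h12, h23, h31)\<close>

fun link_of :: "party \<Rightarrow> party \<Rightarrow> link" where
  "link_of Alice Bob = L12" | "link_of Bob Alice = L12"
| "link_of Bob Charlie = L23" | "link_of Charlie Bob = L23"
| "link_of Charlie Alice = L31" | "link_of Alice Charlie = L31"
| "link_of _ _ = L12"

fun hist_of :: "link \<Rightarrow> state \<Rightarrow> hist" where
  "hist_of L12 (h12, h23, h31) = h12"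
| "hist_of L23 (h12, h23, h31) = h23"
| "hist_of L31 (h12, h23, h31) = h31"

fun app_msg :: "link \<Rightarrow> msg \<Rightarrow> state \<Rightarrow> state" where
  "app_msg L12 m (h12, h23, h31) = (if m = [] then h12 else h12 @ [m], h23, h31)"
| "app_msg L23 m (h12, h23, h31) = (h12, if m = [] then h23 else h23 @ [m], h31)"
| "app_msg L31 m (h12, h23, h31) = (h12, h23, if m = [] then h31 else h31 @ [m])"

text \<open>A protocol.  In round \<open>t\<close> the party \<open>fst (sched t)\<close> sends one message to
  \<open>snd (sched t)\<close>; the message is a codeword of the prefix-free code
  \<open>code l t h\<close> determined by the previous messages \<open>h\<close> on that link \<open>l\<close>
  (the code \<open>{[]}\<close> means that nothing is sent).  Private randomness is modelled by
  behavioural strategies: the message of the sender is drawn from a distribution that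
  depends on the sender's current view (its input, if any, and the transcripts on its two
  links).  Charlie's output is a function of his final view.\<close>
record ('x, 'y, 'z) protocol =
  sched :: "nat \<Rightarrow> party \<times> party"
  code  :: "link \<Rightarrow> nat \<Rightarrow> hist \<Rightarrow> msg set"
  kA    :: "nat \<Rightarrow> 'x \<Rightarrow> hist \<Rightarrow> hist \<Rightarrow> msg pmf"   \<comment> \<open>input x, h12, h31\<close>
  kB    :: "nat \<Rightarrow> 'y \<Rightarrow> hist \<Rightarrow> hist \<Rightarrow> msg pmf"   \<comment> \<open>input y, h12, h23\<close>
  kC    :: "nat \<Rightarrow> hist \<Rightarrow> hist \<Rightarrow> msg pmf"          \<comment> \<open>h23, h31\<close>
  outC  :: "msg \<Rightarrow> msg \<Rightarrow> 'z"                       \<comment> \<open>from final M23, M31\<close>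

definition prefix_free :: "msg set \<Rightarrow> bool" where
  "prefix_free C \<longleftrightarrow> (\<forall>u\<in>C. \<forall>v\<in>C. prefix u v \<longrightarrow> u = v)"

definition sender_kernel :: "('x, 'y, 'z) protocol \<Rightarrow> nat \<Rightarrow> 'x \<Rightarrow> 'y \<Rightarrow> state \<Rightarrow> msg pmf" where
  "sender_kernel P t x y s =
     (case fst (sched P t) of
        Alice \<Rightarrow> kA P t x (hist_of L12 s) (hist_of L31 s)
      | Bob \<Rightarrow> kB P t y (hist_of L12 s) (hist_of L23 s)
      | Charlie \<Rightarrow> kC P t (hist_of L23 s) (hist_of L31 s))"

definition cur_link :: "('x, 'y, 'z) protocol \<Rightarrow> nat \<Rightarrow> link" where
  "cur_link P t = link_of (fst (sched P t)) (snd (sched P t))"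

definition step :: "('x, 'y, 'z) protocol \<Rightarrow> nat \<Rightarrow> 'x \<Rightarrow> 'y \<Rightarrow> state \<Rightarrow> state pmf" where
  "step P t x y s = map_pmf (\<lambda>m. app_msg (cur_link P t) m s) (sender_kernel P t x y s)"

primrec run :: "('x, 'y, 'z) protocol \<Rightarrow> nat \<Rightarrow> 'x \<Rightarrow> 'y \<Rightarrow> state pmf" where
  "run P 0 x y = return_pmf ([], [], [])"
| "run P (Suc t) x y = bind_pmf (run P t x y) (step P t x y)"

definition wf_protocol :: "('x, 'y, 'z) protocol \<Rightarrow> bool" where
  "wf_protocol P \<longleftrightarrow>
     (\<forall>t. fst (sched P t) \<noteq> snd (sched P t)) \<and>
     (\<forall>l t h. prefix_free (code P l t h)) \<and>
     (\<forall>t x y s. set_pmf (sender_kernel P t x y s) \<subseteq> code P (cur_link P t) t (hist_of (cur_link P t) s))"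

definition terminated :: "('x, 'y, 'z) protocol \<Rightarrow> nat \<Rightarrow> state \<Rightarrow> bool" where
  "terminated P t s \<longleftrightarrow> (\<forall>t'\<ge>t. code P (cur_link P t') t' (hist_of (cur_link P t') s) = {[]})"

definition terminates_as :: "('x, 'y, 'z) protocol \<Rightarrow> 'x \<Rightarrow> 'y \<Rightarrow> bool" where
  "terminates_as P x y \<longleftrightarrow>
     (\<lambda>t. measure_pmf.prob (run P t x y) {s. terminated P t s}) \<longlonglongrightarrow> 1"

definition final_prob :: "('x, 'y, 'z) protocol \<Rightarrow> 'x \<Rightarrow> 'y \<Rightarrow> state \<Rightarrow> real" where
  "final_prob P x y s = (SUP t. measure_pmf.prob (run P t x y) {s'. s' = s \<and> terminated P t s'})"

definition dist :: "('x \<times> 'y \<Rightarrow> real) \<Rightarrow> ('x, 'y, 'z) protocol \<Rightarrow> ('x \<Rightarrow> 'y \<Rightarrow> state \<Rightarrow> 'o) \<Rightarrow> 'o \<Rightarrow> real" where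
  "dist p P g v = infsum (\<lambda>(x, y, s). p (x, y) * final_prob P x y s) {(x, y, s). g x y s = v}"

definition ent :: "('o \<Rightarrow> real) \<Rightarrow> ennreal" where
  "ent q = (\<Sum>\<^sub>\<infinity>v. ennreal (- q v * log 2 (q v)))"

definition H :: "('x \<times> 'y \<Rightarrow> real) \<Rightarrow> ('x, 'y, 'z) protocol \<Rightarrow> ('x \<Rightarrow> 'y \<Rightarrow> state \<Rightarrow> 'o) \<Rightarrow> ennreal" where
  "H p P g = ent (dist p P g)"

definition markov :: "('x \<times> 'y \<Rightarrow> real) \<Rightarrow> ('x, 'y, 'z) protocol \<Rightarrow>
    ('x \<Rightarrow> 'y \<Rightarrow> state \<Rightarrow> 'a) \<Rightarrow> ('x \<Rightarrow> 'y \<Rightarrow> state \<Rightarrow> 'b) \<Rightarrow> ('x \<Rightarrow> 'y \<Rightarrow> state \<Rightarrow> 'c) \<Rightarrow> bool" where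
  "markov p P A B C \<longleftrightarrow>
     (\<forall>a b c. dist p P (\<lambda>x y s. (A x y s, B x y s, C x y s)) (a, b, c) * dist p P B b
            = dist p P (\<lambda>x y s. (A x y s, B x y s)) (a, b) * dist p P (\<lambda>x y s. (B x y s, C x y s)) (b, c))"

definition M12 :: "'x \<Rightarrow> 'y \<Rightarrow> state \<Rightarrow> msg" where "M12 x y s = concat (hist_of L12 s)"
definition M23 :: "'x \<Rightarrow> 'y \<Rightarrow> state \<Rightarrow> msg" where "M23 x y s = concat (hist_of L23 s)"
definition M31 :: "'x \<Rightarrow> 'y \<Rightarrow> state \<Rightarrow> msg" where "M31 x y s = concat (hist_of L31 s)"

definition is_distr :: "('x \<times> 'y \<Rightarrow> real) \<Rightarrow> bool" where
  "is_distr p \<longleftrightarrow> (\<forall>xy. p xy \<ge> 0) \<and> finite {xy. p xy \<noteq> 0} \<and> (\<Sum>xy\<in>{xy. p xy \<noteq> 0}. p xy) = 1"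

text \<open>Secure protocol for \<open>f\<close> under input distribution \<open>p\<close>.  Charlie's output \<open>Z\<close> equals
  \<open>f X Y\<close> by correctness.\<close>
definition secure :: "('x \<times> 'y \<Rightarrow> real) \<Rightarrow> ('x \<Rightarrow> 'y \<Rightarrow> 'z) \<Rightarrow> ('x, 'y, 'z) protocol \<Rightarrow> bool" where
  "secure p f P \<longleftrightarrow>
     wf_protocol P \<and>
     (\<forall>x y. p (x, y) > 0 \<longrightarrow> terminates_as P x y) \<and>
     (\<forall>x y s. p (x, y) > 0 \<and> final_prob P x y s > 0 \<longrightarrow>
              outC P (M23 x y s) (M31 x y s) = f x y) \<and>
     markov p P (\<lambda>x y s. (M12 x y s, M31 x y s)) (\<lambda>x y s. x) (\<lambda>x y s. (y, f x y)) \<and>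
     markov p P (\<lambda>x y s. (M12 x y s, M23 x y s)) (\<lambda>x y s. y) (\<lambda>x y s. (x, f x y)) \<and>
     markov p P (\<lambda>x y s. (M23 x y s, M31 x y s)) (\<lambda>x y s. f x y) (\<lambda>x y s. (x, y))"

text \<open>\<open>H(V1,V2,V3 | X,Y) = H(X,Y,M12,M23,M31,Z) - H(X,Y)\<close> (with \<open>Z = f X Y\<close>).\<close>
definition cond_view_ent :: "('x \<times> 'y \<Rightarrow> real) \<Rightarrow> ('x \<Rightarrow> 'y \<Rightarrow> 'z) \<Rightarrow> ('x, 'y, 'z) protocol \<Rightarrow> ennreal" where
  "cond_view_ent p f P =
     H p P (\<lambda>x y s. (x, y, M12 x y s, M23 x y s, M31 x y s, f x y)) - H p P (\<lambda>x y s. (x, y))"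

definition rho :: "('x \<times> 'y \<Rightarrow> real) \<Rightarrow> ('x \<Rightarrow> 'y \<Rightarrow> 'z) \<Rightarrow> ennreal" where
  "rho p f = (INF P \<in> {P. secure p f P}. cond_view_ent p f P)"

definition bitAND :: "bool list \<Rightarrow> bool list \<Rightarrow> bool list" where
  "bitAND x y = map2 (\<and>) x y"

definition full_support_n :: "nat \<Rightarrow> (bool list \<times> bool list \<Rightarrow> real) \<Rightarrow> bool" where
  "full_support_n n p \<longleftrightarrow> is_distr p \<and>
     (\<forall>x y. p (x, y) > 0 \<longleftrightarrow> (length x = n \<and> length y = n))"

end

theory Submission
  imports Defs
begin

text \<open>
  Write \<open>a, b, c\<close> for the transcripts on the links 12, 23, 31. Their law on inputs \<open>x, y\<close> factors as
  \<open>\<alpha> x a c * \<beta> y a b * \<gamma> b c\<close>. By privacy the marginals \<open>\<lambda>, \<nu>, \<mu>\<close> of the three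
  transcripts do not depend on the inputs, the pair \<open>(a, c)\<close> determines \<open>x\<close>, \<open>(a, b)\<close> determines
  \<open>y\<close> and \<open>(b, c)\<close> determines the output.

  For \<open>H(M31)\<close>, sum \<open>\<mu> c\<close> over the laws of all \<open>3 ^ n\<close> input pairs with \<open>y \<le> x\<close>: by
  determinacy the total is at most 1, so the collision probability of \<open>\<mu>\<close> is at most \<open>3 ^ -n\<close>.
  \<open>H(M23)\<close> is symmetric.

  For \<open>H(M12)\<close>, independent inputs satisfy
  \<open>H(M12) \<ge> H(M12|M23) + H(M12|M31) - H(M12|M23,M31)\<close>, because every message of the protocol can
  only increase the mutual information of three transcripts. Each conditional entropy depends on
  one of the laws of \<open>y\<close>, \<open>x\<close>, \<open>(x, y)\<close> only, which permits switching to other input laws. Letting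
  \<open>Y\<close> be uniform on the positions with \<open>x = 0\<close> (and symmetrically for \<open>X\<close>) gives
  \<open>H(M12) \<ge> H(Z) + P(X = 0) + P(Y = 0)\<close> per bit. The leftover terms
  \<open>H(M12|M23,M31,X=x,Y=y)\<close> split as \<open>U x + V y + S (x \<and> y)\<close> by the factorization, and so their total
  is the expectation of a nonnegative quantity under a fourth input law. For bits of bias \<open>1/3\<close> the
  bound is \<open>2 log 3 - 4/3 > 1.836\<close> per bit. This beats the sum
  \<open>H(Y) + P(Y = 0) + I(X;Z)\<close>, whose maximum \<open>1.82599\<close> falls just short of \<open>1.826\<close>.

  All inequalities between entropies are instances of \<open>- ln t \<ge> 1 - t\<close>, with likelihood ratios
  \<open>t\<close> of expectation at most 1.
\<close>

section \<open>Sums over countable spaces and expectations\<close>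

text \<open>The monotonicity of the mutual information is not an induction over messages: the run is
  unbounded and entropies may be infinite. It is condensed into two bounds on complete transcripts,
  \<open>sum_keep_Bob\<close> and \<open>sum_replace_Bob\<close>. Their source is the chain rule on
  a single link: the law of a transcript is a product of probabilities of messages given the past of
  that link alone, and sorting the factors by sender gives one weight per party and link. Letting
  Bob, or else Alice and Charlie, draw from these one-link laws gives two hybrid protocols. They
  need not be secure or terminate, but their limit weights still have total mass at most 1, which is
  all that the likelihood ratios require. Bob's weights \<open>f1\<close>, \<open>g1\<close> and the
  normalizer \<open>L\<close> cancel in the product of the three ratios, which leaves the transcript
  law, its marginals and the output law. Bits of bias t would give H(t^2) + 2 (1 - t). With t = 1/3
  all probabilities involve only the primes 2 and 3, so a single comparison of powers settles the
  numerics.\<close>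

abbreviation nsum :: "('a \<Rightarrow> ennreal) \<Rightarrow> ennreal" where
  "nsum g \<equiv> nn_integral (count_space UNIV) g"

lemma nsum_prod: "nsum g = nsum (\<lambda>a. nsum (\<lambda>b. g (a, b)))"
  by (simp add: nn_integral_fst_count_space)

lemma nsum_swap: "nsum (\<lambda>a. nsum (\<lambda>b. g a b)) = nsum (\<lambda>b. nsum (\<lambda>a. g a b))"
  using nn_integral_fst_count_space[of "\<lambda>(a, b). g a b"]
    nn_integral_snd_count_space[of "\<lambda>(a, b). g a b"] by simp

lemma nsum_mono: "(\<And>a. g a \<le> h a) \<Longrightarrow> nsum g \<le> nsum h"
  by (rule nn_integral_mono) simp

lemma nsum_cmult: "nsum (\<lambda>a. c * g a) = c * nsum g"
  by (simp add: nn_integral_cmult)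

lemma nsum_multc: "nsum (\<lambda>a. g a * c) = nsum g * c"
  by (simp add: nn_integral_multc)

lemma nsum_pmf: "nsum (\<lambda>a. ennreal (pmf p a)) = 1"
  by (simp add: nn_integral_pmf)

lemma nsum_pmf_snd: "nsum (\<lambda>a. ennreal (pmf p (a, b))) = ennreal (pmf (map_pmf snd p) b)"
proof -
  have "nsum (\<lambda>a. ennreal (pmf p (a, b))) = emeasure (measure_pmf p) (range (\<lambda>a. (a, b)))"
    by (rule nn_integral_pmf') (simp add: inj_on_def)
  also have "range (\<lambda>a. (a, b)) = snd -` {b}" by auto
  finally show ?thesis by (simp add: pmf_map measure_pmf.emeasure_eq_measure)
qed

text \<open>Used for every likelihood ratio below: a bound on the total mass of the numerator
  \<open>g\<close> bounds the expectation of the ratio, whatever the denominator. Mass of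
  \<open>g\<close> outside the support is simply lost.\<close>

lemma nn_integral_density_ratio:
  assumes "\<And>m. 0 \<le> g m"
  shows "(\<integral>\<^sup>+m. ennreal (g m / pmf p m) \<partial>measure_pmf p) =
         nsum (\<lambda>m. ennreal (g m) * indicator (set_pmf p) m)"
  unfolding nn_integral_measure_pmf
  by (rule nn_integral_cong)
     (auto simp: indicator_def set_pmf_iff ennreal_mult'[symmetric])

lemma integrable_expectation_le:
  fixes p :: "'a pmf"
  assumes "(\<integral>\<^sup>+m. ennreal (g m) \<partial>measure_pmf p) \<le> ennreal B" "\<And>m. 0 \<le> g m" "0 \<le> B"
  shows "integrable (measure_pmf p) g" "measure_pmf.expectation p g \<le> B"
proof -
  show 1: "integrable (measure_pmf p) g"
    using assms by (intro integrableI_nonneg) (auto simp: less_top[symmetric] top_unique)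
  have "ennreal (measure_pmf.expectation p g) \<le> ennreal B"
    using nn_integral_eq_integral[OF 1] assms by simp
  then show "measure_pmf.expectation p g \<le> B" using assms by simp
qed

lemma integrable_between:
  fixes p :: "'a pmf" and g lo hi :: "'a \<Rightarrow> real"
  assumes "integrable (measure_pmf p) lo" "integrable (measure_pmf p) hi"
    "\<And>m. m \<in> set_pmf p \<Longrightarrow> lo m \<le> g m" "\<And>m. m \<in> set_pmf p \<Longrightarrow> g m \<le> hi m"
  shows "integrable (measure_pmf p) g"
proof (rule Bochner_Integration.integrable_bound)
  show "integrable (measure_pmf p) (\<lambda>m. \<bar>lo m\<bar> + \<bar>hi m\<bar>)"
    using assms(1,2) by (intro Bochner_Integration.integrable_add integrable_abs)
  show "AE m in measure_pmf p. norm (g m) \<le> norm (\<bar>lo m\<bar> + \<bar>hi m\<bar>)"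
    unfolding AE_measure_pmf_iff using assms(3,4) by fastforce
qed simp

lemma expectation_mono_pmf:
  fixes p :: "'a pmf" and g h :: "'a \<Rightarrow> real"
  assumes "integrable (measure_pmf p) g" "integrable (measure_pmf p) h"
    "\<And>m. m \<in> set_pmf p \<Longrightarrow> g m \<le> h m"
  shows "measure_pmf.expectation p g \<le> measure_pmf.expectation p h"
  using assms by (intro integral_mono_AE) (auto simp: AE_measure_pmf_iff)

lemma ln_ge_one_minus_inverse: "0 < (t::real) \<Longrightarrow> 1 - t \<le> - ln t"
  using ln_le_minus_one[of t] by simp

text \<open>This is how decodability enters the bounds. For a fixed transcript, \<open>P i\<close>
  says that the inputs \<open>i\<close> are compatible with it; injectivity of \<open>h\<close>
  there lets a sum over all inputs collapse to one over the coarser values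
  \<open>h i\<close>.\<close>

lemma sum_if_le_image:
  fixes G :: "'z \<Rightarrow> ennreal"
  assumes "finite I" "finite Z" "\<And>i. i \<in> I \<Longrightarrow> h i \<in> Z" "inj_on h {i\<in>I. P i}"
  shows "(\<Sum>i\<in>I. G (h i) * of_bool (P i)) \<le> (\<Sum>z\<in>Z. G z)"
proof -
  have "(\<Sum>i\<in>I. G (h i) * of_bool (P i)) = (\<Sum>i\<in>{i\<in>I. P i}. G (h i))"
    using assms(1) by (intro sum.mono_neutral_cong_right) auto
  also have "\<dots> = (\<Sum>z\<in>h ` {i\<in>I. P i}. G z)"
    by (simp add: sum.reindex[OF assms(4)])
  also have "\<dots> \<le> (\<Sum>z\<in>Z. G z)"
    using assms by (intro sum_mono2) auto
  finally show ?thesis .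
qed

lemma nsum_cond_prod:
  "nsum (\<lambda>(a, b, c). u a c * v b c) = nsum (\<lambda>c. nsum (\<lambda>a. u a c) * nsum (\<lambda>b. v b c))"
proof -
  have "nsum (\<lambda>(a, b, c). u a c * v b c) = nsum (\<lambda>a. nsum (\<lambda>b. nsum (\<lambda>c. u a c * v b c)))"
    by (subst nsum_prod) (subst nsum_prod, simp)
  also have "\<dots> = nsum (\<lambda>a. nsum (\<lambda>c. nsum (\<lambda>b. u a c * v b c)))"
    by (subst nsum_swap) simp
  also have "\<dots> = nsum (\<lambda>c. nsum (\<lambda>a. nsum (\<lambda>b. u a c * v b c)))"
    by (rule nsum_swap)
  finally show ?thesis by (simp add: nsum_cmult nsum_multc)
qed

text \<open>Only the average over \<open>i\<close> is controlled. Since the weights are positive,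
  each single expectation is still finite, which is what the logarithms need later.\<close>

lemma weighted_expectation_le:
  fixes p :: "'i \<Rightarrow> 'a pmf" and R :: "'i \<Rightarrow> 'a \<Rightarrow> real"
  assumes "finite I" "\<And>i. i \<in> I \<Longrightarrow> 0 < w i" "\<And>i m. i \<in> I \<Longrightarrow> 0 \<le> R i m"
    and le: "(\<Sum>i\<in>I. ennreal (w i) * (\<integral>\<^sup>+m. ennreal (R i m) \<partial>measure_pmf (p i))) \<le> 1"
  shows "\<And>i. i \<in> I \<Longrightarrow> integrable (measure_pmf (p i)) (R i)"
    and "(\<Sum>i\<in>I. w i * measure_pmf.expectation (p i) (R i)) \<le> 1"
proof -
  show int: "integrable (measure_pmf (p i)) (R i)" if i: "i \<in> I" for i
  proof -
    have "ennreal (w i) * (\<integral>\<^sup>+m. ennreal (R i m) \<partial>measure_pmf (p i))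
      \<le> (\<Sum>i\<in>I. ennreal (w i) * (\<integral>\<^sup>+m. ennreal (R i m) \<partial>measure_pmf (p i)))"
      using i assms(1) by (intro member_le_sum) auto
    also note le
    also have "(1::ennreal) < \<infinity>" by simp
    finally have "ennreal (w i) * (\<integral>\<^sup>+m. ennreal (R i m) \<partial>measure_pmf (p i)) < \<infinity>" .
    then have "(\<integral>\<^sup>+m. ennreal (R i m) \<partial>measure_pmf (p i)) < \<infinity>"
      using assms(2)[OF i] by (auto simp: ennreal_mult_less_top)
    then show ?thesis using assms(3)[OF i] by (intro integrableI_nonneg) auto
  qed
  have "ennreal (\<Sum>i\<in>I. w i * measure_pmf.expectation (p i) (R i))
     = (\<Sum>i\<in>I. ennreal (w i * measure_pmf.expectation (p i) (R i)))"
    using assms by (intro sum_ennreal[symmetric] mult_nonneg_nonneg)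
      (auto intro!: integral_nonneg simp: less_imp_le)
  also have "\<dots> = (\<Sum>i\<in>I. ennreal (w i) * (\<integral>\<^sup>+m. ennreal (R i m) \<partial>measure_pmf (p i)))"
    using assms int by (intro sum.cong refl)
      (simp add: ennreal_mult integral_nonneg less_imp_le nn_integral_eq_integral)
  also note le
  finally show "(\<Sum>i\<in>I. w i * measure_pmf.expectation (p i) (R i)) \<le> 1"
    by (simp only: ennreal_le_1)
qed

section \<open>Transcripts of a private protocol\<close>

text \<open>\<open>factor\<close> is the rectangle property of private randomness.
  \<open>correct\<close> avoids an output map: it only says that Charlie's transcripts fix the value
  of \<open>f\<close>. \<open>separated_X\<close> and \<open>separated_Y\<close> exclude
  interchangeable inputs and are what makes a party's view reveal its input.\<close>

locale private_transcripts =
  fixes DX :: "'x set" and DY :: "'y set" and f :: "'x \<Rightarrow> 'y \<Rightarrow> 'z"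
    and W :: "'x \<Rightarrow> 'y \<Rightarrow> ('a \<times> 'b \<times> 'c) pmf"
    and PA :: "'x \<Rightarrow> ('a \<times> 'c) pmf" and PB :: "'y \<Rightarrow> ('a \<times> 'b) pmf"
    and PC :: "'z \<Rightarrow> ('b \<times> 'c) pmf"
    and la :: "'a pmf" and nu :: "'b pmf" and mu :: "'c pmf"
    and \<alpha> :: "'x \<Rightarrow> 'a \<Rightarrow> 'c \<Rightarrow> real" and \<beta> :: "'y \<Rightarrow> 'a \<Rightarrow> 'b \<Rightarrow> real"
    and \<gamma> :: "'b \<Rightarrow> 'c \<Rightarrow> real"
  assumes finite_inputs: "finite DX" "finite DY"
    and nonempty_inputs: "DX \<noteq> {}" "DY \<noteq> {}"
    and view_A: "\<And>x y. x \<in> DX \<Longrightarrow> y \<in> DY \<Longrightarrow> map_pmf (\<lambda>(a, b, c). (a, c)) (W x y) = PA x"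
    and view_B: "\<And>x y. x \<in> DX \<Longrightarrow> y \<in> DY \<Longrightarrow> map_pmf (\<lambda>(a, b, c). (a, b)) (W x y) = PB y"
    and view_C: "\<And>x y. x \<in> DX \<Longrightarrow> y \<in> DY \<Longrightarrow> map_pmf (\<lambda>(a, b, c). (b, c)) (W x y) = PC (f x y)"
    and la_W: "\<And>x y. x \<in> DX \<Longrightarrow> y \<in> DY \<Longrightarrow> map_pmf (\<lambda>(a, b, c). a) (W x y) = la"
    and nu_W: "\<And>x y. x \<in> DX \<Longrightarrow> y \<in> DY \<Longrightarrow> map_pmf (\<lambda>(a, b, c). b) (W x y) = nu"
    and mu_W: "\<And>x y. x \<in> DX \<Longrightarrow> y \<in> DY \<Longrightarrow> map_pmf (\<lambda>(a, b, c). c) (W x y) = mu"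
    and factor: "\<And>x y a b c. x \<in> DX \<Longrightarrow> y \<in> DY \<Longrightarrow> pmf (W x y) (a, b, c) = \<alpha> x a c * \<beta> y a b * \<gamma> b c"
    and factor_nonneg: "\<And>x a c. 0 \<le> \<alpha> x a c" "\<And>y a b. 0 \<le> \<beta> y a b" "\<And>b c. 0 \<le> \<gamma> b c"
    and correct: "\<And>x y x' y' a a' b c. x \<in> DX \<Longrightarrow> y \<in> DY \<Longrightarrow> x' \<in> DX \<Longrightarrow> y' \<in> DY \<Longrightarrow>
      (a, b, c) \<in> set_pmf (W x y) \<Longrightarrow> (a', b, c) \<in> set_pmf (W x' y') \<Longrightarrow> f x y = f x' y'"
    and separated_X: "\<And>x x'. x \<in> DX \<Longrightarrow> x' \<in> DX \<Longrightarrow> x \<noteq> x' \<Longrightarrow> \<exists>y\<in>DY. f x y \<noteq> f x' y"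
    and separated_Y: "\<And>y y'. y \<in> DY \<Longrightarrow> y' \<in> DY \<Longrightarrow> y \<noteq> y' \<Longrightarrow> \<exists>x\<in>DX. f x y \<noteq> f x y'"
begin

text \<open>Exchanging Alice and Bob exchanges the links 23 and 31 and keeps link 12, so each
  statement about Alice yields the one about Bob.\<close>

lemma swapped: "private_transcripts DY DX (\<lambda>y x. f x y)
    (\<lambda>y x. map_pmf (\<lambda>(a, b, c). (a, c, b)) (W x y)) PB PA (\<lambda>z. map_pmf prod.swap (PC z))
    la mu nu \<beta> \<alpha> (\<lambda>c b. \<gamma> b c)"
proof
  fix x x' y y' a a' b c
  assume "y \<in> DY" "x \<in> DX" "y' \<in> DY" "x' \<in> DX"
    "(a, b, c) \<in> set_pmf (map_pmf (\<lambda>(a, b, c). (a, c, b)) (W x y))"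
    "(a', b, c) \<in> set_pmf (map_pmf (\<lambda>(a, b, c). (a, c, b)) (W x' y'))"
  then show "f x y = f x' y'"
    using correct[of x y x' y' a c b a'] by auto
next
  fix x y a b c
  assume "y \<in> DY" "x \<in> DX"
  have "pmf (map_pmf (\<lambda>(a, b, c). (a, c, b)) (W x y)) ((\<lambda>(a, b, c). (a, c, b)) (a, c, b)) = pmf (W x y) (a, c, b)"
    by (rule pmf_map_inj') (auto simp: inj_on_def)
  then show "pmf (map_pmf (\<lambda>(a, b, c). (a, c, b)) (W x y)) (a, b, c) = \<beta> y a c * \<alpha> x a b * \<gamma> c b"
    using factor[OF \<open>x \<in> DX\<close> \<open>y \<in> DY\<close>, of a c b] by (simp add: mult_ac)
qed (use finite_inputs nonempty_inputs factor_nonneg separated_X separated_Y in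
     \<open>simp_all add: pmf.map_comp o_def case_prod_unfold prod.swap_def view_A[symmetric] view_B[symmetric]
       view_C[symmetric] la_W[symmetric] nu_W[symmetric] mu_W[symmetric]\<close>)

lemma set_W_iff: "x \<in> DX \<Longrightarrow> y \<in> DY \<Longrightarrow>
    (a, b, c) \<in> set_pmf (W x y) \<longleftrightarrow> 0 < \<alpha> x a c \<and> 0 < \<beta> y a b \<and> 0 < \<gamma> b c"
  unfolding set_pmf_iff factor using factor_nonneg(1)[of x a c] factor_nonneg(2)[of y a b]
    factor_nonneg(3)[of b c] by auto

lemma set_W_D:
  assumes "x \<in> DX" "y \<in> DY" "(a, b, c) \<in> set_pmf (W x y)"
  shows "(a, c) \<in> set_pmf (PA x)" "(a, b) \<in> set_pmf (PB y)" "(b, c) \<in> set_pmf (PC (f x y))"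
    "a \<in> set_pmf la" "b \<in> set_pmf nu" "c \<in> set_pmf mu"
  using assms(3) unfolding view_A[OF assms(1,2), symmetric] view_B[OF assms(1,2), symmetric]
    view_C[OF assms(1,2), symmetric] la_W[OF assms(1,2), symmetric]
    nu_W[OF assms(1,2), symmetric] mu_W[OF assms(1,2), symmetric] by force+

text \<open>Cut and paste. If \<open>x\<close> and \<open>x'\<close> shared \<open>(a, c)\<close>,
  take \<open>y0\<close> that separates them. Alice's privacy provides some \<open>b0\<close>
  completing \<open>(a, c)\<close> under \<open>x, y0\<close>, and by the factorization the same
  triple is possible under \<open>x', y0\<close>. Charlie would then see the same
  \<open>(b0, c)\<close> for two different outputs.\<close>

lemma x_determined:
  assumes "x \<in> DX" "x' \<in> DX" "y \<in> DY" "y' \<in> DY"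
    "(a, b, c) \<in> set_pmf (W x y)" "(a, b', c) \<in> set_pmf (W x' y')"
  shows "x = x'"
proof (rule ccontr)
  assume "x \<noteq> x'"
  then obtain y0 where y0: "y0 \<in> DY" "f x y0 \<noteq> f x' y0"
    using separated_X assms(1,2) by blast
  have "(a, c) \<in> set_pmf (PA x)" using set_W_D(1) assms(1,3,5) by blast
  then obtain b0 where b0: "(a, b0, c) \<in> set_pmf (W x y0)"
    using view_A[OF assms(1) y0(1), symmetric] by auto
  moreover have "(a, b0, c) \<in> set_pmf (W x' y0)"
    using b0 assms y0 by (simp add: set_W_iff)
  ultimately show False using correct assms(1,2) y0 by blast
qed

lemma y_determined:
  assumes "x \<in> DX" "x' \<in> DX" "y \<in> DY" "y' \<in> DY"
    "(a, b, c) \<in> set_pmf (W x y)" "(a, b, c') \<in> set_pmf (W x' y')"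
  shows "y = y'"
  by (rule private_transcripts.x_determined[OF swapped assms(3,4,1,2), of a c b c'])
     (use assms(5,6) in force)+

lemma pmf_A_marginals:
  assumes "x \<in> DX" shows "map_pmf fst (PA x) = la" "map_pmf snd (PA x) = mu"
proof -
  obtain y where "y \<in> DY" using nonempty_inputs by auto
  then show "map_pmf fst (PA x) = la" "map_pmf snd (PA x) = mu"
    by (simp_all add: view_A[OF assms, symmetric] la_W[OF assms, symmetric]
        mu_W[OF assms, symmetric] pmf.map_comp o_def case_prod_unfold)
qed

lemma pmf_B_marginals:
  assumes "y \<in> DY" shows "map_pmf fst (PB y) = la" "map_pmf snd (PB y) = nu"
proof -
  obtain x where "x \<in> DX" using nonempty_inputs by auto
  then show "map_pmf fst (PB y) = la" "map_pmf snd (PB y) = nu"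
    using assms by (simp_all add: view_B[OF _ assms, symmetric] la_W[OF _ assms, symmetric]
        nu_W[OF _ assms, symmetric] pmf.map_comp o_def case_prod_unfold)
qed

lemma pmf_C_marginals:
  assumes "x \<in> DX" "y \<in> DY"
  shows "map_pmf fst (PC (f x y)) = nu" "map_pmf snd (PC (f x y)) = mu"
  by (simp_all add: view_C[OF assms, symmetric] mu_W[OF assms, symmetric]
        nu_W[OF assms, symmetric] pmf.map_comp o_def case_prod_unfold)

lemma pmf_W_le_C:
  assumes "x \<in> DX" "y \<in> DY" shows "pmf (W x y) (a, b, c) \<le> pmf (PC (f x y)) (b, c)"
proof -
  have "pmf (W x y) (a, b, c) = measure (W x y) {(a, b, c)}" by (simp add: pmf.rep_eq)
  also have "\<dots> \<le> measure (W x y) ((\<lambda>(a, b, c). (b, c)) -` {(b, c)})"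
    by (rule measure_pmf.finite_measure_mono) auto
  finally show ?thesis by (simp add: view_C[OF assms, symmetric] pmf_map)
qed

lemma pmf_W_le_B:
  assumes "x \<in> DX" "y \<in> DY" shows "pmf (W x y) (a, b, c) \<le> pmf (PB y) (a, b)"
proof -
  have "pmf (W x y) (a, b, c) = measure (W x y) {(a, b, c)}" by (simp add: pmf.rep_eq)
  also have "\<dots> \<le> measure (W x y) ((\<lambda>(a, b, c). (a, b)) -` {(a, b)})"
    by (rule measure_pmf.finite_measure_mono) auto
  finally show ?thesis by (simp add: view_B[OF assms, symmetric] pmf_map)
qed

text \<open>Charlie's view determines \<open>f x y\<close>, hence \<open>y\<close> on \<open>S\<close>; Alice's view then determines \<open>x\<close>.
  So at most one input pair of \<open>S\<close> is compatible with a given transcript.\<close>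

lemma collision_bound:
  assumes S: "S \<subseteq> DX \<times> DY"
    and det: "\<And>x y x' y'. (x, y) \<in> S \<Longrightarrow> (x', y') \<in> S \<Longrightarrow> f x y = f x' y' \<Longrightarrow> y = y'"
  shows "(\<integral>\<^sup>+c. ennreal (real (card S) * pmf mu c) \<partial>measure_pmf mu) \<le> 1"
proof -
  have finS: "finite S" using S finite_inputs by (meson finite_SigmaI finite_subset)
  obtain x0 y0 where xy0: "x0 \<in> DX" "y0 \<in> DY" using nonempty_inputs by auto
  \<comment> \<open>The input of Bob decoded from Charlie's view. The default \<open>y0\<close>
    keeps \<open>Y b c\<close> in \<open>DY\<close> on all other views, so that
    \<open>PB (Y b c)\<close> always has second marginal \<open>nu\<close>.\<close>
  define Y where "Y b c = (if \<exists>x y a. (x, y) \<in> S \<and> (a, b, c) \<in> set_pmf (W x y)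
    then (SOME y. \<exists>x a. (x, y) \<in> S \<and> (a, b, c) \<in> set_pmf (W x y)) else y0)" for b c
  have Y: "Y b c = y" if "(x, y) \<in> S" "(a, b, c) \<in> set_pmf (W x y)" for x y a b c
  proof -
    have ex: "\<exists>y x a. (x, y) \<in> S \<and> (a, b, c) \<in> set_pmf (W x y)" using that by blast
    have "\<exists>x a. (x, Y b c) \<in> S \<and> (a, b, c) \<in> set_pmf (W x (Y b c))"
      using someI_ex[OF ex] ex unfolding Y_def by auto
    then obtain x' a' where *: "(x', Y b c) \<in> S" "(a', b, c) \<in> set_pmf (W x' (Y b c))" by blast
    then have "f x' (Y b c) = f x y"
      using that S by (intro correct) auto
    then show ?thesis using det * that by blast
  qed
  have YDY: "Y b c \<in> DY" for b c
  proof (cases "\<exists>x y a. (x, y) \<in> S \<and> (a, b, c) \<in> set_pmf (W x y)")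
    case True
    then show ?thesis using Y S by blast
  next
    case False
    then show ?thesis unfolding Y_def using xy0 by (simp only: if_False)
  qed
  have uniq: "i = j" if "i \<in> S" "j \<in> S" "m \<in> set_pmf (case_prod W i)" "m \<in> set_pmf (case_prod W j)" for i j m
  proof -
    obtain a b c where m: "m = (a, b, c)" by (metis prod_cases3)
    obtain x y x' y' where ij: "i = (x, y)" "j = (x', y')" by (metis surj_pair)
    have "y = y'" using Y[of x y a b c] Y[of x' y' a b c] that m ij by auto
    moreover have "x = x'" using x_determined[of x x' y y' a b c b] that m ij S by auto
    ultimately show ?thesis using ij by simp
  qed
  have le: "ennreal (pmf mu c) * ennreal (pmf (case_prod W i) (a, b, c))
      \<le> ennreal (pmf mu c) * ennreal (pmf (PB (Y b c)) (a, b)) * of_bool ((a, b, c) \<in> set_pmf (case_prod W i))"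
    if i: "i \<in> S" for i a b c
  proof (cases "(a, b, c) \<in> set_pmf (case_prod W i)")
    case True
    obtain x y where xy: "i = (x, y)" by force
    then have "Y b c = y" using Y True i by auto
    then show ?thesis using True xy i S pmf_W_le_B[of x y a b c] 
      by (auto intro!: mult_left_mono)
  qed (simp add: set_pmf_iff)
  have "(\<integral>\<^sup>+c. ennreal (real (card S) * pmf mu c) \<partial>measure_pmf mu)
      = (\<Sum>i\<in>S. (\<integral>\<^sup>+c. ennreal (pmf mu c) \<partial>measure_pmf mu))"
    by (simp add: ennreal_mult nn_integral_cmult ennreal_of_nat_eq_real_of_nat)
  also have "\<dots> = (\<Sum>i\<in>S. (\<integral>\<^sup>+(a, b, c). ennreal (pmf mu c) \<partial>measure_pmf (case_prod W i)))"
  proof (rule sum.cong)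
    fix i assume "i \<in> S"
    then have "map_pmf (\<lambda>(a, b, c). c) (case_prod W i) = mu" using S mu_W by auto
    then have "(\<integral>\<^sup>+c. ennreal (pmf mu c) \<partial>measure_pmf mu)
       = (\<integral>\<^sup>+c. ennreal (pmf mu c) \<partial>measure_pmf (map_pmf (\<lambda>(a, b, c). c) (case_prod W i)))" by simp
    then show "(\<integral>\<^sup>+c. ennreal (pmf mu c) \<partial>measure_pmf mu)
        = (\<integral>\<^sup>+(a, b, c). ennreal (pmf mu c) \<partial>measure_pmf (case_prod W i))"
      by (simp add: case_prod_unfold)
  qed simp
  also have "\<dots> = (\<Sum>i\<in>S. nsum (\<lambda>(a, b, c). ennreal (pmf mu c) * ennreal (pmf (case_prod W i) (a, b, c))))"
    by (simp add: nn_integral_measure_pmf case_prod_unfold mult.commute)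
  also have "\<dots> = nsum (\<lambda>(a, b, c). \<Sum>i\<in>S. ennreal (pmf mu c) * ennreal (pmf (case_prod W i) (a, b, c)))"
    by (subst nn_integral_sum[symmetric]) (auto simp: case_prod_unfold)
  \<comment> \<open>At a fixed transcript at most one pair of \<open>S\<close> contributes, and its
    probability is at most Bob's marginal at the decoded input. Summing over \<open>a\<close> then
    leaves \<open>mu c * nu b\<close>, of total mass 1.\<close>
  also have "\<dots> \<le> nsum (\<lambda>(a, b, c). ennreal (pmf mu c) * ennreal (pmf (PB (Y b c)) (a, b)))"
  proof (rule nsum_mono, clarify)
    fix a b c
    have "(\<Sum>i\<in>S. ennreal (pmf mu c) * ennreal (pmf (case_prod W i) (a, b, c)))
      \<le> (\<Sum>i\<in>S. ennreal (pmf mu c) * ennreal (pmf (PB (Y b c)) (a, b)) * of_bool ((a, b, c) \<in> set_pmf (case_prod W i)))"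
      by (rule sum_mono) (rule le)
    also have "\<dots> \<le> (\<Sum>z\<in>{()}. ennreal (pmf mu c) * ennreal (pmf (PB (Y b c)) (a, b)))"
      by (rule sum_if_le_image[where h = "\<lambda>_. ()"]) (use finS uniq in \<open>auto simp: inj_on_def\<close>)
    finally show "(\<Sum>i\<in>S. ennreal (pmf mu c) * ennreal (pmf (case_prod W i) (a, b, c)))
       \<le> ennreal (pmf mu c) * ennreal (pmf (PB (Y b c)) (a, b))" by simp
  qed
  also have "\<dots> = nsum (\<lambda>(b, c). nsum (\<lambda>a. ennreal (pmf mu c) * ennreal (pmf (PB (Y b c)) (a, b))))"
    by (subst nsum_prod, subst nsum_swap) (simp add: case_prod_unfold)
  also have "\<dots> = nsum (\<lambda>(b, c). ennreal (pmf mu c) * ennreal (pmf nu b))"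
    by (simp add: nsum_cmult nsum_pmf_snd pmf_B_marginals YDY)
  also have "\<dots> = 1"
    by (subst nsum_prod) (simp add: nsum_multc nsum_pmf)
  finally show ?thesis .
qed

text \<open>In nats, \<open>gapA x\<close>, \<open>gapB y\<close> and \<open>gapC x y\<close> are
  the entropies of M12 given M31, given M23 and given both, at fixed inputs. By privacy the first
  depends on \<open>x\<close> alone and the second on \<open>y\<close> alone.\<close>

definition gapA :: "'x \<Rightarrow> real" where
  "gapA x = measure_pmf.expectation (PA x) (\<lambda>(a, c). ln (pmf mu c / pmf (PA x) (a, c)))"

definition gapB :: "'y \<Rightarrow> real" where
  "gapB y = measure_pmf.expectation (PB y) (\<lambda>(a, b). ln (pmf nu b / pmf (PB y) (a, b)))"

definition gapC :: "'x \<Rightarrow> 'y \<Rightarrow> real" where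
  "gapC x y = measure_pmf.expectation (W x y)
     (\<lambda>(a, b, c). ln (pmf (PC (f x y)) (b, c) / pmf (W x y) (a, b, c)))"

lemma expectation_view:
  fixes g :: "'a \<Rightarrow> real" and gA :: "'a \<times> 'c \<Rightarrow> real" and gB :: "'a \<times> 'b \<Rightarrow> real"
    and gC :: "'b \<times> 'c \<Rightarrow> real"
  assumes "x \<in> DX" "y \<in> DY"
  shows "measure_pmf.expectation (W x y) (\<lambda>(a, b, c). gA (a, c)) = measure_pmf.expectation (PA x) gA"
    "measure_pmf.expectation (W x y) (\<lambda>(a, b, c). gB (a, b)) = measure_pmf.expectation (PB y) gB"
    "measure_pmf.expectation (W x y) (\<lambda>(a, b, c). gC (b, c)) = measure_pmf.expectation (PC (f x y)) gC"
    "measure_pmf.expectation (W x y) (\<lambda>(a, b, c). g a) = measure_pmf.expectation la g"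
  unfolding view_A[OF assms, symmetric] view_B[OF assms, symmetric]
    view_C[OF assms, symmetric] la_W[OF assms, symmetric]
  by (simp_all add: case_prod_unfold)

lemma integrable_view:
  fixes g :: "'a \<Rightarrow> real" and gA :: "'a \<times> 'c \<Rightarrow> real" and gB :: "'a \<times> 'b \<Rightarrow> real"
    and gC :: "'b \<times> 'c \<Rightarrow> real"
  assumes "x \<in> DX" "y \<in> DY"
  shows "integrable (W x y) (\<lambda>(a, b, c). gA (a, c)) = integrable (PA x) gA"
    "integrable (W x y) (\<lambda>(a, b, c). gB (a, b)) = integrable (PB y) gB"
    "integrable (W x y) (\<lambda>(a, b, c). gC (b, c)) = integrable (PC (f x y)) gC"
    "integrable (W x y) (\<lambda>(a, b, c). g a) = integrable la g"
  unfolding view_A[OF assms, symmetric] view_B[OF assms, symmetric]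
    view_C[OF assms, symmetric] la_W[OF assms, symmetric]
  by (simp_all add: case_prod_unfold o_def map_pmf_rep_eq integrable_distr_eq)

text \<open>Conditioning cannot raise entropy, in pointwise form: the ratio \<open>R\<close> of the
  product of the marginals to the joint law has mean at most 1, and \<open>ln R \<le> R\<close>
  bounds the integrand by \<open>- ln (pmf la a) + R\<close>. Finite entropy on link 12 thus
  suffices.\<close>

lemma integrable_gapA:
  assumes ent: "integrable la (\<lambda>a. - ln (pmf la a))" and x: "x \<in> DX"
  shows "integrable (PA x) (\<lambda>(a, c). ln (pmf mu c / pmf (PA x) (a, c)))"
proof -
  have entA: "integrable (PA x) (\<lambda>(a, c). - ln (pmf la a))"
    using ent unfolding pmf_A_marginals(1)[OF x, symmetric]
    by (simp add: case_prod_unfold o_def map_pmf_rep_eq integrable_distr_eq)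
  define R where "R = (\<lambda>(a, c). (pmf la a * pmf mu c) / pmf (PA x) (a, c))"
  have "(\<integral>\<^sup>+m. ennreal (R m) \<partial>PA x) = (\<integral>\<^sup>+m. ennreal ((\<lambda>(a, c). pmf la a * pmf mu c) m / pmf (PA x) m) \<partial>PA x)"
    by (simp add: R_def case_prod_unfold)
  also have "\<dots> = nsum (\<lambda>m. ennreal ((\<lambda>(a, c). pmf la a * pmf mu c) m) * indicator (set_pmf (PA x)) m)"
    by (rule nn_integral_density_ratio) (auto simp: case_prod_unfold)
  also have "\<dots> \<le> nsum (\<lambda>(a, c). ennreal (pmf la a) * ennreal (pmf mu c))"
    by (rule nsum_mono) (auto simp: indicator_def ennreal_mult)
  also have "\<dots> = 1" by (subst nsum_prod) (simp add: nsum_cmult nsum_pmf)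
  finally have R: "integrable (PA x) R"
    using integrable_expectation_le(1)[of "PA x" R 1] by (auto simp: R_def case_prod_unfold)
  have le: "pmf (PA x) (a, c) \<le> pmf mu c" for a c
    using pmf_A_marginals(2)[OF x] nn_integral_ge_point[of a UNIV "\<lambda>a. ennreal (pmf (PA x) (a, c))"]
    by (simp add: nsum_pmf_snd)
  show ?thesis
  proof (rule integrable_between)
    show "integrable (PA x) (\<lambda>m. 0::real)" by simp
    show "integrable (PA x) (\<lambda>m. (case m of (a, c) \<Rightarrow> - ln (pmf la a)) + R m)"
      by (rule Bochner_Integration.integrable_add[OF entA R])
  next
    fix m assume m: "m \<in> set_pmf (PA x)"
    obtain a c where ac: "m = (a, c)" by force
    have p: "0 < pmf (PA x) (a, c)" using m ac by (simp add: pmf_positive)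
    then have mu: "0 < pmf mu c" using le[of a c] by linarith
    have "a \<in> set_pmf la" using m ac pmf_A_marginals(1)[OF x] by force
    then have la: "0 < pmf la a" by (simp add: pmf_positive)
    show "0 \<le> (case m of (a, c) \<Rightarrow> ln (pmf mu c / pmf (PA x) (a, c)))"
      using p le[of a c] ac by simp
    have "ln (R m) \<le> R m" using p mu la ac by (intro order.trans[OF ln_le_minus_one]) (simp_all add: R_def)
    then show "(case m of (a, c) \<Rightarrow> ln (pmf mu c / pmf (PA x) (a, c)))
        \<le> (case m of (a, c) \<Rightarrow> - ln (pmf la a)) + R m"
      using p mu la ac by (simp add: R_def ln_mult ln_div)
  qed
qed

lemma integrable_gapB:
  assumes ent: "integrable la (\<lambda>a. - ln (pmf la a))" and y: "y \<in> DY"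
  shows "integrable (PB y) (\<lambda>(a, b). ln (pmf nu b / pmf (PB y) (a, b)))"
  by (rule private_transcripts.integrable_gapA[OF swapped ent y])

lemma integrable_gapC:
  assumes ent: "integrable la (\<lambda>a. - ln (pmf la a))" and xy: "x \<in> DX" "y \<in> DY"
  shows "integrable (W x y) (\<lambda>(a, b, c). ln (pmf (PC (f x y)) (b, c) / pmf (W x y) (a, b, c)))"
    and gapC_nonneg: "0 \<le> gapC x y"
proof -
  define R where "R = (\<lambda>(a, b, c). (pmf la a * pmf (PC (f x y)) (b, c)) / pmf (W x y) (a, b, c))"
  have "(\<integral>\<^sup>+m. ennreal (R m) \<partial>W x y)
      = (\<integral>\<^sup>+m. ennreal ((\<lambda>(a, bc). pmf la a * pmf (PC (f x y)) bc) m / pmf (W x y) m) \<partial>W x y)"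
    by (simp add: R_def case_prod_unfold)
  also have "\<dots> = nsum (\<lambda>m. ennreal ((\<lambda>(a, bc). pmf la a * pmf (PC (f x y)) bc) m) * indicator (set_pmf (W x y)) m)"
    by (rule nn_integral_density_ratio) (auto simp: case_prod_unfold)
  also have "\<dots> \<le> nsum (\<lambda>(a, bc). ennreal (pmf la a) * ennreal (pmf (PC (f x y)) bc))"
    by (rule nsum_mono) (auto simp: indicator_def ennreal_mult)
  also have "\<dots> = 1" by (subst nsum_prod) (simp add: nsum_cmult nsum_pmf)
  finally have R: "integrable (W x y) R"
    using integrable_expectation_le(1)[of "W x y" R 1] by (auto simp: R_def case_prod_unfold)
  have lo: "0 \<le> (case m of (a, b, c) \<Rightarrow> ln (pmf (PC (f x y)) (b, c) / pmf (W x y) (a, b, c)))"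
    if m: "m \<in> set_pmf (W x y)" for m
  proof -
    obtain a b c where ac: "m = (a, b, c)" by (metis prod_cases3)
    have "0 < pmf (W x y) (a, b, c)" using m ac by (simp add: pmf_positive)
    then show ?thesis using ac pmf_W_le_C[OF xy, of a b c] by simp
  qed
  show "integrable (W x y) (\<lambda>(a, b, c). ln (pmf (PC (f x y)) (b, c) / pmf (W x y) (a, b, c)))"
  proof (rule integrable_between)
    show "integrable (W x y) (\<lambda>m. 0::real)" by simp
    show "integrable (W x y) (\<lambda>m. (case m of (a, b, c) \<Rightarrow> - ln (pmf la a)) + R m)"
      by (rule Bochner_Integration.integrable_add[OF iffD2[OF integrable_view(4)[OF xy] ent] R])
  next
    fix m assume m: "m \<in> set_pmf (W x y)"
    obtain a b c where ac: "m = (a, b, c)" by (metis prod_cases3)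
    have p: "0 < pmf (W x y) (a, b, c)" using m ac by (simp add: pmf_positive)
    have pc: "0 < pmf (PC (f x y)) (b, c)" "0 < pmf la a"
      using set_W_D[OF xy] m ac by (simp_all add: pmf_positive)
    have "ln (R m) \<le> R m" using p pc ac by (intro order.trans[OF ln_le_minus_one]) (simp_all add: R_def)
    then show "(case m of (a, b, c) \<Rightarrow> ln (pmf (PC (f x y)) (b, c) / pmf (W x y) (a, b, c)))
        \<le> (case m of (a, b, c) \<Rightarrow> - ln (pmf la a)) + R m"
      using p pc ac by (simp add: R_def ln_mult ln_div)
  qed (fact lo)
  show "0 \<le> gapC x y"
    unfolding gapC_def using lo by (intro integral_nonneg_AE) (auto simp: AE_measure_pmf_iff)
qed

text \<open>By the chain rule I(M12; M23,Y | M31,X), which is the right side, is at least I(M12; Y |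
  M23,M31,X). As \<open>(a, b)\<close> determines \<open>y\<close>, this equals H(Y | M23,M31,X),
  and by Charlie's privacy that is H(Y | X,Z), the left side.\<close>

lemma gapA_ge:
  assumes ent: "integrable la (\<lambda>a. - ln (pmf la a))"
    and J: "set_pmf J \<subseteq> DX \<times> DY" and K: "K = map_pmf (\<lambda>(x, y). (x, f x y)) J"
  shows "measure_pmf.expectation J (\<lambda>(x, y). ln (pmf K (x, f x y) / pmf J (x, y)))
    \<le> measure_pmf.expectation J (\<lambda>(x, y). gapA x - gapC x y)"
proof -
  have fin: "finite (set_pmf J)"
    using J finite_inputs by (meson finite_SigmaI finite_subset)
  then have finK: "finite (set_pmf K)" by (simp add: K)
  \<comment> \<open>Numerator of the ratio: given \<open>c\<close>, the transcripts \<open>a\<close>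
    and \<open>b\<close> are drawn independently from Alice's and Charlie's views. Multiplication by
    \<open>pmf J (x, y)\<close> turns the last factor into the weight
    \<open>pmf K (x, z)\<close>.\<close>
  define q where "q = (\<lambda>(x, y) (a, b, c). pmf (PA x) (a, c) * (1 / pmf mu c) *
      (pmf (PC (f x y)) (b, c) * (pmf K (x, f x y) / pmf J (x, y))))"
  define R where "R = (\<lambda>i m. q i m / pmf (case_prod W i) m)"
  have q_nonneg: "0 \<le> q i m" for i m by (simp add: q_def case_prod_unfold)
  have R_nonneg: "0 \<le> R i m" for i m by (simp add: R_def q_nonneg)
  define G where "G = (\<lambda>(x, z) (a, b, c). ennreal (pmf (PA x) (a, c)) * ennreal (1 / pmf mu c) *
      (ennreal (pmf (PC z) (b, c)) * ennreal (pmf K (x, z))))"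
  have "(\<Sum>i\<in>set_pmf J. ennreal (pmf J i) * (\<integral>\<^sup>+m. ennreal (R i m) \<partial>measure_pmf (case_prod W i)))
     = (\<Sum>i\<in>set_pmf J. ennreal (pmf J i) * nsum (\<lambda>m. ennreal (q i m) * indicator (set_pmf (case_prod W i)) m))"
    unfolding R_def by (simp add: nn_integral_density_ratio q_nonneg)
  also have "\<dots> = (\<Sum>i\<in>set_pmf J. nsum (\<lambda>m. G (fst i, f (fst i) (snd i)) m * of_bool (m \<in> set_pmf (case_prod W i))))"
  proof (rule sum.cong)
    fix i assume i: "i \<in> set_pmf J"
    then have "0 < pmf J i" by (simp add: pmf_positive)
    then have "ennreal (pmf J i) * (ennreal (q i m) * indicator (set_pmf (case_prod W i)) m)
       = G (fst i, f (fst i) (snd i)) m * of_bool (m \<in> set_pmf (case_prod W i))" for m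
      by (cases m; cases i) (auto simp: q_def G_def indicator_def ennreal_mult'[symmetric])
    then show "ennreal (pmf J i) * nsum (\<lambda>m. ennreal (q i m) * indicator (set_pmf (case_prod W i)) m)
       = nsum (\<lambda>m. G (fst i, f (fst i) (snd i)) m * of_bool (m \<in> set_pmf (case_prod W i)))"
      by (simp add: nsum_cmult[symmetric])
  qed simp
  also have "\<dots> = nsum (\<lambda>m. \<Sum>i\<in>set_pmf J. G (fst i, f (fst i) (snd i)) m * of_bool (m \<in> set_pmf (case_prod W i)))"
    by (subst nn_integral_sum[symmetric]) auto
  \<comment> \<open>\<open>y_determined\<close> allows only one \<open>y\<close> per
    \<open>x\<close> and transcript, so the inputs can be merged into the pairs
    \<open>(x, z)\<close>.\<close>
  also have "\<dots> \<le> nsum (\<lambda>m. \<Sum>k\<in>set_pmf K. G k m)"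
  proof (rule nsum_mono)
    fix m
    show "(\<Sum>i\<in>set_pmf J. G (fst i, f (fst i) (snd i)) m * of_bool (m \<in> set_pmf (case_prod W i)))
       \<le> (\<Sum>k\<in>set_pmf K. G k m)"
    proof (rule sum_if_le_image[OF fin finK, where h = "\<lambda>i. (fst i, f (fst i) (snd i))"])
      show "inj_on (\<lambda>i. (fst i, f (fst i) (snd i))) {i \<in> set_pmf J. m \<in> set_pmf (case_prod W i)}"
      proof (rule inj_onI, clarsimp)
        fix x y y' assume "(x, y) \<in> set_pmf J" "m \<in> set_pmf (W x y)"
          "(x, y') \<in> set_pmf J" "m \<in> set_pmf (W x y')"
        then show "y = y'" using J y_determined[of x x y y' "fst m" "fst (snd m)" "snd (snd m)" "snd (snd m)"]
          by auto
      qed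
    qed (auto simp: K case_prod_unfold)
  qed
  also have "\<dots> = (\<Sum>k\<in>set_pmf K. nsum (G k))"
    by (rule nn_integral_sum) auto
  also have "\<dots> \<le> (\<Sum>k\<in>set_pmf K. ennreal (pmf K k))"
  proof (rule sum_mono)
    fix k assume k: "k \<in> set_pmf K"
    obtain x z where xz: "k = (x, z)" by force
    then obtain y where y: "(x, y) \<in> set_pmf J" "z = f x y" using k by (auto simp: K)
    then have xy: "x \<in> DX" "y \<in> DY" using J by auto
    have "nsum (G k) = nsum (\<lambda>c. ennreal (pmf mu c) * ennreal (1 / pmf mu c) * (ennreal (pmf mu c) * ennreal (pmf K k)))"
      using nsum_cond_prod[of "\<lambda>a c. ennreal (pmf (PA x) (a, c)) * ennreal (1 / pmf mu c)"
          "\<lambda>b c. ennreal (pmf (PC z) (b, c)) * ennreal (pmf K k)"]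
      by (simp add: G_def xz nsum_multc nsum_pmf_snd pmf_A_marginals[OF xy(1)]
          pmf_C_marginals[OF xy] y(2))
    also have "\<dots> \<le> nsum (\<lambda>c. ennreal (pmf mu c) * ennreal (pmf K k))"
      by (intro nsum_mono) (auto simp: ennreal_mult[symmetric])
    also have "\<dots> = ennreal (pmf K k)" by (simp add: nsum_multc nsum_pmf)
    finally show "nsum (G k) \<le> ennreal (pmf K k)" .
  qed
  also have "\<dots> = 1"
    using sum_pmf_eq_1[OF finK] by (simp add: sum_ennreal)
  finally have le1: "(\<Sum>i\<in>set_pmf J. ennreal (pmf J i) * (\<integral>\<^sup>+m. ennreal (R i m) \<partial>measure_pmf (case_prod W i))) \<le> 1" .
  have wR: "\<And>i. i \<in> set_pmf J \<Longrightarrow> integrable (case_prod W i) (R i)"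
    "(\<Sum>i\<in>set_pmf J. pmf J i * measure_pmf.expectation (case_prod W i) (R i)) \<le> 1"
    using weighted_expectation_le[where R = R, OF fin pmf_positive R_nonneg le1] by auto
  have pt: "ln (pmf K (x, f x y) / pmf J (x, y)) + (1 - measure_pmf.expectation (W x y) (R (x, y))) \<le> gapA x - gapC x y"
    if i: "(x, y) \<in> set_pmf J" for x y
  proof -
    have xy: "x \<in> DX" "y \<in> DY" using J i by auto
    have Jp: "0 < pmf J (x, y)" using i by (simp add: pmf_positive)
    have "(x, f x y) \<in> set_pmf K" using i by (force simp: K)
    then have Kp: "0 < pmf K (x, f x y)" by (simp add: pmf_positive)
    let ?k = "ln (pmf K (x, f x y) / pmf J (x, y))"
    let ?g = "\<lambda>m. (case m of (a, b, c) \<Rightarrow> ln (pmf mu c / pmf (PA x) (a, c)))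
        - (case m of (a, b, c) \<Rightarrow> ln (pmf (PC (f x y)) (b, c) / pmf (W x y) (a, b, c)))"
    have iA: "integrable (W x y) (\<lambda>(a, b, c). ln (pmf mu c / pmf (PA x) (a, c)))"
      using integrable_gapA[OF ent xy(1)] integrable_view(1)[OF xy, of "\<lambda>(a, c). ln (pmf mu c / pmf (PA x) (a, c))"]
      by simp
    have eA: "measure_pmf.expectation (W x y) (\<lambda>(a, b, c). ln (pmf mu c / pmf (PA x) (a, c))) = gapA x"
      using expectation_view(1)[OF xy, of "\<lambda>(a, c). ln (pmf mu c / pmf (PA x) (a, c))"]
      by (simp add: gapA_def)
    have iR: "integrable (W x y) (R (x, y))" using wR(1)[OF i] by simp
    have "?k + (1 - measure_pmf.expectation (W x y) (R (x, y)))
       = measure_pmf.expectation (W x y) (\<lambda>m. ?k + (1 - R (x, y) m))"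
      using iR by simp
    also have "\<dots> \<le> measure_pmf.expectation (W x y) ?g"
    proof (rule expectation_mono_pmf)
      show "integrable (W x y) (\<lambda>m. ?k + (1 - R (x, y) m))" using iR by simp
      show "integrable (W x y) ?g"
        by (rule Bochner_Integration.integrable_diff[OF iA integrable_gapC(1)[OF ent xy]])
      fix m assume m: "m \<in> set_pmf (W x y)"
      obtain a b c where ac: "m = (a, b, c)" by (metis prod_cases3)
      have p: "0 < pmf (W x y) (a, b, c)" using m ac by (simp add: pmf_positive)
      have pc: "0 < pmf (PC (f x y)) (b, c)" "0 < pmf (PA x) (a, c)" "0 < pmf mu c"
        using set_W_D[OF xy] m ac by (simp_all add: pmf_positive)
      have "0 < R (x, y) m" using p pc Jp Kp ac by (simp add: R_def q_def)
      then have "1 - R (x, y) m \<le> - ln (R (x, y) m)" by (rule ln_ge_one_minus_inverse)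
      moreover have "- ln (R (x, y) m) = ?g m - ?k"
        using p pc Jp Kp ac by (simp add: R_def q_def ln_mult ln_div)
      ultimately show "?k + (1 - R (x, y) m) \<le> ?g m" by linarith
    qed
    also have "\<dots> = gapA x - gapC x y"
      using Bochner_Integration.integral_diff[OF iA integrable_gapC(1)[OF ent xy]]
      by (simp add: eA gapC_def)
    finally show ?thesis .
  qed
  have "measure_pmf.expectation J (\<lambda>(x, y). ln (pmf K (x, f x y) / pmf J (x, y)))
     = (\<Sum>i\<in>set_pmf J. pmf J i * (case i of (x, y) \<Rightarrow> ln (pmf K (x, f x y) / pmf J (x, y))))"
    by (subst integral_measure_pmf_real[OF fin]) (auto simp: mult.commute)
  also have "\<dots> \<le> (\<Sum>i\<in>set_pmf J. pmf J i * (case i of (x, y) \<Rightarrow> ln (pmf K (x, f x y) / pmf J (x, y))))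
      + (1 - (\<Sum>i\<in>set_pmf J. pmf J i * measure_pmf.expectation (case_prod W i) (R i)))"
    using wR(2) by simp
  also have "\<dots> = (\<Sum>i\<in>set_pmf J. pmf J i * ((case i of (x, y) \<Rightarrow> ln (pmf K (x, f x y) / pmf J (x, y)))
       + (1 - measure_pmf.expectation (case_prod W i) (R i))))"
    by (simp add: algebra_simps sum.distrib sum_subtractf sum_pmf_eq_1[OF fin])
  also have "\<dots> \<le> (\<Sum>i\<in>set_pmf J. pmf J i * (case i of (x, y) \<Rightarrow> gapA x - gapC x y))"
    using pt by (intro sum_mono mult_left_mono) auto
  also have "\<dots> = measure_pmf.expectation J (\<lambda>(x, y). gapA x - gapC x y)"
    by (subst integral_measure_pmf_real[OF fin]) (auto simp: mult.commute)
  finally show ?thesis .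
qed

lemma gapB_ge:
  assumes ent: "integrable la (\<lambda>a. - ln (pmf la a))"
    and J: "set_pmf J \<subseteq> DX \<times> DY" and K: "K = map_pmf (\<lambda>(x, y). (y, f x y)) J"
  shows "measure_pmf.expectation J (\<lambda>(x, y). ln (pmf K (y, f x y) / pmf J (x, y)))
    \<le> measure_pmf.expectation J (\<lambda>(x, y). gapB y - gapC x y)"
proof -
  interpret S: private_transcripts DY DX "\<lambda>y x. f x y"
    "\<lambda>y x. map_pmf (\<lambda>(a, b, c). (a, c, b)) (W x y)" PB PA "\<lambda>z. map_pmf prod.swap (PC z)"
    la mu nu \<beta> \<alpha> "\<lambda>c b. \<gamma> b c"
    by (rule swapped)
  have gB: "S.gapA y = gapB y" for y by (simp add: S.gapA_def gapB_def)
  have sw: "pmf (map_pmf prod.swap p) (c, b) = pmf p (b, c)" for p :: "('u \<times> 'v) pmf" and b c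
    using pmf_map_inj'[of prod.swap p "(b, c)"] by simp
  have rot: "pmf (map_pmf (\<lambda>(a, b, c). (a, c, b)) p) (a, c, b) = pmf p (a, b, c)"
    for p :: "('a \<times> 'b \<times> 'c) pmf" and a b c
    using pmf_map_inj'[of "\<lambda>(a, b, c). (a, c, b)" p "(a, b, c)"] by (simp add: inj_on_def)
  have gC: "S.gapC y x = gapC x y" for x y
    unfolding S.gapC_def gapC_def by (simp add: case_prod_unfold sw rot[unfolded case_prod_unfold])
  have "set_pmf (map_pmf prod.swap J) \<subseteq> DY \<times> DX" using J by auto
  from S.gapA_ge[OF ent this refl, unfolded gB gC]
  show ?thesis
    by (simp add: K pmf.map_comp o_def case_prod_unfold sw)
qed

end

text \<open>\<open>f1\<close> and \<open>g1\<close> are meant as Bob's shares of the laws of links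
  12 and 23 when each link is generated from its own past only; \<open>la / f1\<close> and
  \<open>nu / g1\<close> then stand for the shares of Alice and Charlie. \<open>sum_keep_Bob\<close>
  bounds the mass of a hybrid in which only Bob's factor is genuine, \<open>sum_replace_Bob\<close>
  that of one in which only Bob's factor is replaced.\<close>

locale sequential_transcripts = private_transcripts DX DY f W PA PB PC la nu mu \<alpha> \<beta> \<gamma>
  for DX :: "'x set" and DY :: "'y set" and f :: "'x \<Rightarrow> 'y \<Rightarrow> 'z"
    and W :: "'x \<Rightarrow> 'y \<Rightarrow> ('a \<times> 'b \<times> 'c) pmf"
    and PA PB PC la nu mu \<alpha> \<beta> \<gamma> +
  fixes f1 :: "'a \<Rightarrow> real" and g1 :: "'b \<Rightarrow> real"
  assumes f1_nonneg: "\<And>a. 0 \<le> f1 a" and g1_nonneg: "\<And>b. 0 \<le> g1 b"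
    and f1_pos: "\<And>a. a \<in> set_pmf la \<Longrightarrow> 0 < f1 a"
    and g1_pos: "\<And>b. b \<in> set_pmf nu \<Longrightarrow> 0 < g1 b"
    and sum_keep_Bob: "\<And>y. y \<in> DY \<Longrightarrow>
      nsum (\<lambda>(a, b). ennreal (\<beta> y a b * (pmf la a / f1 a) * (pmf nu b / g1 b))) \<le> 1"
    and sum_replace_Bob: "\<And>x. x \<in> DX \<Longrightarrow>
      nsum (\<lambda>(a, b, c). ennreal (\<alpha> x a c * f1 a) * ennreal (\<gamma> b c * g1 b)) \<le> 1"
begin

context
  fixes PX :: "'x pmf" and PY :: "'y pmf" and PZ :: "'z pmf"
  assumes ent: "integrable la (\<lambda>a. - ln (pmf la a))"
    and PX: "set_pmf PX = DX" and PY: "set_pmf PY = DY"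
    and PZ: "PZ = map_pmf (\<lambda>(x, y). f x y) (pair_pmf PX PY)"
begin

text \<open>Mass at \<open>c\<close> due to Alice's factor and Bob's replacement on link 12,
  averaged over \<open>x\<close>. It normalizes \<open>R2\<close>, and \<open>R3\<close> compensates
  for it.\<close>

definition L :: "'c \<Rightarrow> ennreal" where
  "L c = (\<Sum>x\<in>DX. ennreal (pmf PX x) * nsum (\<lambda>a. ennreal (\<alpha> x a c * f1 a)))"

text \<open>Each of the three ratios is a function of one view only. In their product
  \<open>f1\<close>, \<open>g1\<close> and \<open>L\<close> cancel and \<open>\<alpha>\<close>,
  \<open>\<beta>\<close>, \<open>\<gamma>\<close> recombine to \<open>W\<close>, which leaves
  \<open>W * la * nu * mu / (PA * PB * PC * PZ)\<close>.\<close>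

definition R1 :: "'y \<Rightarrow> 'a \<times> 'b \<Rightarrow> real" where
  "R1 y = (\<lambda>(a, b). \<beta> y a b * (pmf la a / f1 a) * (pmf nu b / g1 b) / pmf (PB y) (a, b))"

definition R2 :: "'x \<Rightarrow> 'a \<times> 'c \<Rightarrow> real" where
  "R2 x = (\<lambda>(a, c). \<alpha> x a c * f1 a * (pmf mu c / enn2real (L c)) / pmf (PA x) (a, c))"

definition R3 :: "'z \<Rightarrow> 'b \<times> 'c \<Rightarrow> real" where
  "R3 z = (\<lambda>(b, c). \<gamma> b c * g1 b * (enn2real (L c) / pmf PZ z) / pmf (PC z) (b, c))"

lemma set_PZ: "set_pmf PZ = (\<lambda>(x, y). f x y) ` (DX \<times> DY)"
  by (simp add: PZ PX PY)

lemma sum_L: "nsum (\<lambda>c. L c * nsum (\<lambda>b. ennreal (\<gamma> b c * g1 b))) \<le> 1"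
proof -
  have "nsum (\<lambda>c. L c * nsum (\<lambda>b. ennreal (\<gamma> b c * g1 b)))
      = nsum (\<lambda>c. \<Sum>x\<in>DX. ennreal (pmf PX x) * (nsum (\<lambda>a. ennreal (\<alpha> x a c * f1 a)) * nsum (\<lambda>b. ennreal (\<gamma> b c * g1 b))))"
    by (simp add: L_def sum_distrib_right mult.assoc)
  also have "\<dots> = (\<Sum>x\<in>DX. ennreal (pmf PX x) * nsum (\<lambda>(a, b, c). ennreal (\<alpha> x a c * f1 a) * ennreal (\<gamma> b c * g1 b)))"
    unfolding nsum_cond_prod[of "\<lambda>a c. ennreal (\<alpha> x a c * f1 a)" "\<lambda>b c. ennreal (\<gamma> b c * g1 b)" for x]
    by (subst nn_integral_sum) (auto simp: nsum_cmult)
  also have "\<dots> \<le> (\<Sum>x\<in>DX. ennreal (pmf PX x) * 1)"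
    by (intro sum_mono mult_left_mono sum_replace_Bob) auto
  also have "\<dots> = 1"
    using sum_pmf_eq_1[OF finite_inputs(1), of PX] by (simp add: PX sum_ennreal)
  finally show ?thesis .
qed

text \<open>Finiteness comes from \<open>sum_L\<close>, where \<open>L c\<close> has a positive
  cofactor; positivity comes from any possible triple through \<open>c\<close>.\<close>

lemma L_bounds:
  assumes c: "c \<in> set_pmf mu"
  shows "L c < \<infinity>" "0 < enn2real (L c)" "ennreal (enn2real (L c)) = L c"
proof -
  obtain x y where xy: "x \<in> DX" "y \<in> DY" using nonempty_inputs by auto
  obtain a b where m: "(a, b, c) \<in> set_pmf (W x y)"
    using c unfolding mu_W[OF xy, symmetric] by auto
  have pos: "0 < \<alpha> x a c" "0 < \<gamma> b c" using m xy by (simp_all add: set_W_iff)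
  have pos2: "0 < f1 a" "0 < g1 b" using set_W_D[OF xy m] by (simp_all add: f1_pos g1_pos)
  have "0 < ennreal (\<gamma> b c * g1 b)" using pos pos2 by simp
  also have "\<dots> \<le> nsum (\<lambda>b. ennreal (\<gamma> b c * g1 b))"
    by (rule nn_integral_ge_point) simp
  finally have Rpos: "0 < nsum (\<lambda>b. ennreal (\<gamma> b c * g1 b))" .
  have "L c * nsum (\<lambda>b. ennreal (\<gamma> b c * g1 b)) \<le> nsum (\<lambda>c. L c * nsum (\<lambda>b. ennreal (\<gamma> b c * g1 b)))"
    by (rule nn_integral_ge_point) simp
  also note sum_L
  also have "(1::ennreal) < \<infinity>" by simp
  finally have "L c * nsum (\<lambda>b. ennreal (\<gamma> b c * g1 b)) < \<infinity>" .
  then show fin: "L c < \<infinity>" using Rpos by (auto simp: ennreal_mult_less_top)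
  have "0 < pmf PX x" using xy PX by (simp add: pmf_positive)
  then have "0 < ennreal (pmf PX x) * ennreal (\<alpha> x a c * f1 a)"
    using pos pos2 by (simp add: ennreal_zero_less_mult_iff)
  also have "\<dots> \<le> ennreal (pmf PX x) * nsum (\<lambda>a. ennreal (\<alpha> x a c * f1 a))"
    by (intro mult_left_mono nn_integral_ge_point) auto
  also have "\<dots> \<le> L c" unfolding L_def using xy finite_inputs by (intro member_le_sum) auto
  finally have "0 < L c" .
  then show "0 < enn2real (L c)" using fin by (simp add: enn2real_positive_iff)
  show "ennreal (enn2real (L c)) = L c" using fin by simp
qed

lemma R1_bound:
  assumes y: "y \<in> DY"
  shows "integrable (PB y) (R1 y)" "measure_pmf.expectation (PB y) (R1 y) \<le> 1"
proof -
  have "(\<integral>\<^sup>+m. ennreal (R1 y m) \<partial>PB y)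
     = (\<integral>\<^sup>+m. ennreal ((\<lambda>(a, b). \<beta> y a b * (pmf la a / f1 a) * (pmf nu b / g1 b)) m / pmf (PB y) m) \<partial>PB y)"
    by (simp add: R1_def case_prod_unfold)
  also have "\<dots> = nsum (\<lambda>m. ennreal ((\<lambda>(a, b). \<beta> y a b * (pmf la a / f1 a) * (pmf nu b / g1 b)) m) * indicator (set_pmf (PB y)) m)"
    by (rule nn_integral_density_ratio) (auto simp: case_prod_unfold factor_nonneg f1_nonneg g1_nonneg)
  also have "\<dots> \<le> nsum (\<lambda>(a, b). ennreal (\<beta> y a b * (pmf la a / f1 a) * (pmf nu b / g1 b)))"
    by (rule nsum_mono) (auto simp: indicator_def)
  also note sum_keep_Bob[OF y]
  finally show "integrable (PB y) (R1 y)" "measure_pmf.expectation (PB y) (R1 y) \<le> 1"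
    using integrable_expectation_le[of "PB y" "R1 y" 1]
    by (auto simp: R1_def case_prod_unfold factor_nonneg f1_nonneg g1_nonneg)
qed

text \<open>Since \<open>L\<close> is an average over \<open>PX\<close>, normalizing by
  \<open>L c\<close> leaves mass at most \<open>mu c\<close> only after the same average. Hence no
  bound by 1 for a single \<open>x\<close>.\<close>

lemma R2_bound:
  shows "x \<in> DX \<Longrightarrow> integrable (PA x) (R2 x)"
    "(\<Sum>x\<in>DX. pmf PX x * measure_pmf.expectation (PA x) (R2 x)) \<le> 1"
proof -
  have nonneg: "0 \<le> R2 x m" for x m by (auto simp: R2_def case_prod_unfold factor_nonneg f1_nonneg)
  have "(\<Sum>x\<in>DX. ennreal (pmf PX x) * (\<integral>\<^sup>+m. ennreal (R2 x m) \<partial>PA x))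
     = (\<Sum>x\<in>DX. ennreal (pmf PX x) * nsum (\<lambda>(a, c). ennreal (\<alpha> x a c * f1 a * (pmf mu c / enn2real (L c))) * indicator (set_pmf (PA x)) (a, c)))"
  proof (rule sum.cong)
    fix x
    have "(\<integral>\<^sup>+m. ennreal (R2 x m) \<partial>PA x)
       = (\<integral>\<^sup>+m. ennreal ((\<lambda>(a, c). \<alpha> x a c * f1 a * (pmf mu c / enn2real (L c))) m / pmf (PA x) m) \<partial>PA x)"
      by (simp add: R2_def case_prod_unfold)
    also have "\<dots> = nsum (\<lambda>m. ennreal ((\<lambda>(a, c). \<alpha> x a c * f1 a * (pmf mu c / enn2real (L c))) m) * indicator (set_pmf (PA x)) m)"
      by (rule nn_integral_density_ratio) (auto simp: case_prod_unfold factor_nonneg f1_nonneg)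
    finally show "ennreal (pmf PX x) * (\<integral>\<^sup>+m. ennreal (R2 x m) \<partial>PA x)
      = ennreal (pmf PX x) * nsum (\<lambda>(a, c). ennreal (\<alpha> x a c * f1 a * (pmf mu c / enn2real (L c))) * indicator (set_pmf (PA x)) (a, c))"
      by (simp add: case_prod_unfold)
  qed simp
  also have "\<dots> \<le> (\<Sum>x\<in>DX. ennreal (pmf PX x) * nsum (\<lambda>(a, c). ennreal (\<alpha> x a c * f1 a) * ennreal (pmf mu c / enn2real (L c))))"
    by (intro sum_mono mult_left_mono nsum_mono)
       (auto simp: indicator_def ennreal_mult[symmetric] factor_nonneg f1_nonneg)
  also have "\<dots> = (\<Sum>x\<in>DX. nsum (\<lambda>c. ennreal (pmf PX x) * nsum (\<lambda>a. ennreal (\<alpha> x a c * f1 a)) * ennreal (pmf mu c / enn2real (L c))))"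
  proof (rule sum.cong)
    fix x
    have "nsum (\<lambda>(a, c). ennreal (\<alpha> x a c * f1 a) * ennreal (pmf mu c / enn2real (L c)))
       = nsum (\<lambda>c. nsum (\<lambda>a. ennreal (\<alpha> x a c * f1 a)) * ennreal (pmf mu c / enn2real (L c)))"
      by (subst nsum_prod, subst nsum_swap) (simp add: nsum_multc)
    then show "ennreal (pmf PX x) * nsum (\<lambda>(a, c). ennreal (\<alpha> x a c * f1 a) * ennreal (pmf mu c / enn2real (L c)))
      = nsum (\<lambda>c. ennreal (pmf PX x) * nsum (\<lambda>a. ennreal (\<alpha> x a c * f1 a)) * ennreal (pmf mu c / enn2real (L c)))"
      by (simp only: nsum_cmult mult.assoc)
  qed simp
  also have "\<dots> = nsum (\<lambda>c. L c * ennreal (pmf mu c / enn2real (L c)))"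
    by (subst nn_integral_sum[symmetric]) (auto simp: L_def sum_distrib_right)
  also have "\<dots> \<le> nsum (\<lambda>c. ennreal (pmf mu c))"
  proof (rule nsum_mono)
    fix c
    show "L c * ennreal (pmf mu c / enn2real (L c)) \<le> ennreal (pmf mu c)"
    proof (cases "c \<in> set_pmf mu")
      case True
      have "L c * ennreal (pmf mu c / enn2real (L c)) = ennreal (enn2real (L c)) * ennreal (pmf mu c / enn2real (L c))"
        by (simp only: L_bounds(3)[OF True])
      also have "\<dots> = ennreal (pmf mu c)"
        using L_bounds(2)[OF True] by (simp add: ennreal_mult[symmetric] del: ennreal_enn2real_if)
      finally show ?thesis by simp
    qed (simp add: set_pmf_iff)
  qed
  also have "\<dots> = 1" by (rule nsum_pmf)
  finally have le: "(\<Sum>x\<in>DX. ennreal (pmf PX x) * (\<integral>\<^sup>+m. ennreal (R2 x m) \<partial>PA x)) \<le> 1" .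
  show "x \<in> DX \<Longrightarrow> integrable (PA x) (R2 x)"
    "(\<Sum>x\<in>DX. pmf PX x * measure_pmf.expectation (PA x) (R2 x)) \<le> 1"
    using weighted_expectation_le[where R = R2 and p = PA, OF finite_inputs(1) _ nonneg le] PX
    by (auto simp: pmf_positive)
qed

text \<open>By correctness the supports of \<open>PC z\<close> are disjoint for different
  \<open>z\<close>. After \<open>pmf PZ z\<close> has cancelled, the sum over all outputs is
  therefore at most one sum over \<open>(b, c)\<close>, bounded by \<open>sum_L\<close>.\<close>

lemma R3_bound:
  shows "z \<in> set_pmf PZ \<Longrightarrow> integrable (PC z) (R3 z)"
    "(\<Sum>z\<in>set_pmf PZ. pmf PZ z * measure_pmf.expectation (PC z) (R3 z)) \<le> 1"
proof -
  have fin: "finite (set_pmf PZ)" using finite_inputs by (simp add: set_PZ)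
  have nonneg: "0 \<le> R3 z m" for z m by (auto simp: R3_def case_prod_unfold factor_nonneg g1_nonneg)
  define G where "G = (\<lambda>(b, c). ennreal (\<gamma> b c * g1 b) * ennreal (enn2real (L c)) * of_bool (c \<in> set_pmf mu))"
  have "(\<Sum>z\<in>set_pmf PZ. ennreal (pmf PZ z) * (\<integral>\<^sup>+m. ennreal (R3 z m) \<partial>PC z))
     = (\<Sum>z\<in>set_pmf PZ. nsum (\<lambda>m. G m * of_bool (m \<in> set_pmf (PC z))))"
  proof (rule sum.cong)
    fix z assume z: "z \<in> set_pmf PZ"
    then have zp: "0 < pmf PZ z" by (simp add: pmf_positive)
    obtain x y where xy: "x \<in> DX" "y \<in> DY" "z = f x y" using z by (auto simp: set_PZ)
    have muc: "c \<in> set_pmf mu" if "(b, c) \<in> set_pmf (PC z)" for b c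
      using that unfolding pmf_C_marginals(2)[OF xy(1,2), symmetric] xy(3) by force
    have "(\<integral>\<^sup>+m. ennreal (R3 z m) \<partial>PC z)
       = (\<integral>\<^sup>+m. ennreal ((\<lambda>(b, c). \<gamma> b c * g1 b * (enn2real (L c) / pmf PZ z)) m / pmf (PC z) m) \<partial>PC z)"
      by (simp add: R3_def case_prod_unfold)
    also have "\<dots> = nsum (\<lambda>m. ennreal ((\<lambda>(b, c). \<gamma> b c * g1 b * (enn2real (L c) / pmf PZ z)) m) * indicator (set_pmf (PC z)) m)"
      by (rule nn_integral_density_ratio) (auto simp: case_prod_unfold factor_nonneg g1_nonneg)
    finally show "ennreal (pmf PZ z) * (\<integral>\<^sup>+m. ennreal (R3 z m) \<partial>PC z) = nsum (\<lambda>m. G m * of_bool (m \<in> set_pmf (PC z)))"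
      using zp muc
      by (auto simp: nsum_cmult[symmetric] G_def ennreal_mult'[symmetric] factor_nonneg g1_nonneg
          indicator_def simp del: ennreal_enn2real_if intro!: nn_integral_cong)
  qed simp
  also have "\<dots> = nsum (\<lambda>m. \<Sum>z\<in>set_pmf PZ. G m * of_bool (m \<in> set_pmf (PC z)))"
    by (subst nn_integral_sum[symmetric]) auto
  also have "\<dots> \<le> nsum G"
  proof (rule nsum_mono)
    fix m
    have uniq: "z = z'" if zz: "z \<in> set_pmf PZ" "z' \<in> set_pmf PZ" "m \<in> set_pmf (PC z)" "m \<in> set_pmf (PC z')" for z z'
    proof -
      obtain x y where xy: "x \<in> DX" "y \<in> DY" "z = f x y" using zz(1) by (auto simp: set_PZ)
      obtain x' y' where xy': "x' \<in> DX" "y' \<in> DY" "z' = f x' y'" using zz(2) by (auto simp: set_PZ)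
      obtain b c where m: "m = (b, c)" by force
      have "\<exists>a. (a, b, c) \<in> set_pmf (W x y)"
        using zz(3) unfolding xy(3) m view_C[OF xy(1,2), symmetric] by auto
      moreover have "\<exists>a. (a, b, c) \<in> set_pmf (W x' y')"
        using zz(4) unfolding xy'(3) m view_C[OF xy'(1,2), symmetric] by auto
      ultimately show ?thesis using correct xy xy' by blast
    qed
    have "(\<Sum>z\<in>set_pmf PZ. G m * of_bool (m \<in> set_pmf (PC z))) \<le> (\<Sum>u\<in>{()}. G m)"
      by (rule sum_if_le_image[where h = "\<lambda>_. ()"]) (use fin uniq in \<open>auto simp: inj_on_def\<close>)
    then show "(\<Sum>z\<in>set_pmf PZ. G m * of_bool (m \<in> set_pmf (PC z))) \<le> G m" by simp
  qed
  also have "\<dots> \<le> nsum (\<lambda>(b, c). L c * ennreal (\<gamma> b c * g1 b))"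
  proof (rule nsum_mono, clarify)
    fix b c
    show "G (b, c) \<le> L c * ennreal (\<gamma> b c * g1 b)"
      using L_bounds(3)[of c] by (auto simp: G_def mult.commute simp del: ennreal_enn2real_if)
  qed
  also have "\<dots> = nsum (\<lambda>c. L c * nsum (\<lambda>b. ennreal (\<gamma> b c * g1 b)))"
    by (subst nsum_prod, subst nsum_swap) (simp add: nsum_cmult)
  also note sum_L
  finally have le: "(\<Sum>z\<in>set_pmf PZ. ennreal (pmf PZ z) * (\<integral>\<^sup>+m. ennreal (R3 z m) \<partial>PC z)) \<le> 1" .
  show "z \<in> set_pmf PZ \<Longrightarrow> integrable (PC z) (R3 z)"
    "(\<Sum>z\<in>set_pmf PZ. pmf PZ z * measure_pmf.expectation (PC z) (R3 z)) \<le> 1"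
    using weighted_expectation_le[where R = R3 and p = PC, OF fin pmf_positive nonneg le] by auto
qed

definition h :: real where "h = measure_pmf.expectation la (\<lambda>a. - ln (pmf la a))"
definition t1 :: "'y \<Rightarrow> real" where "t1 y = measure_pmf.expectation (PB y) (\<lambda>m. - ln (R1 y m))"
definition t2 :: "'x \<Rightarrow> real" where "t2 x = measure_pmf.expectation (PA x) (\<lambda>m. - ln (R2 x m))"
definition t3 :: "'z \<Rightarrow> real" where "t3 z = measure_pmf.expectation (PC z) (\<lambda>m. - ln (R3 z m))"

text \<open>This is \<open>- ln\<close> of the product of the three ratios. For independent inputs
  and on average, H(M12|M23) is \<open>gapB\<close> plus H(Y), H(M12|M31) is \<open>gapA\<close>
  plus H(X), and H(M12|M23,M31) is \<open>gapC\<close> plus H(X,Y|Z). The input terms combine to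
  H(Z), which explains \<open>- ln (pmf PZ (f x y))\<close>.\<close>

lemma entropy_decomposition:
  assumes xy: "x \<in> DX" "y \<in> DY"
  shows "h = t1 y + t2 x + t3 (f x y) + gapB y + gapA x - gapC x y - ln (pmf PZ (f x y))"
    and "1 - measure_pmf.expectation (PB y) (R1 y) \<le> t1 y"
    and "1 - measure_pmf.expectation (PA x) (R2 x) \<le> t2 x"
    and "1 - measure_pmf.expectation (PC (f x y)) (R3 (f x y)) \<le> t3 (f x y)"
proof -
  define z where "z = f x y"
  have z: "z \<in> set_pmf PZ" using xy by (auto simp: z_def set_PZ)
  then have zp: "0 < pmf PZ z" by (simp add: pmf_positive)
  let ?l = "\<lambda>(a, b, c). - ln (pmf la a)"
  let ?B = "\<lambda>(a, b, c). ln (pmf nu b / pmf (PB y) (a, b))"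
  let ?A = "\<lambda>(a, b, c). ln (pmf mu c / pmf (PA x) (a, c))"
  let ?C = "\<lambda>(a, b, c). ln (pmf (PC z) (b, c) / pmf (W x y) (a, b, c))"
  let ?r1 = "\<lambda>(a, b, c). R1 y (a, b)"
  let ?r3 = "\<lambda>(a, b, c). R2 x (a, c)"
  let ?r4 = "\<lambda>(a, b, c). R3 z (b, c)"
  have il: "integrable (W x y) ?l"
    by (rule iffD2[OF integrable_view(4)[OF xy] ent])
  have iB: "integrable (W x y) ?B"
    using integrable_gapB[OF ent xy(2)] integrable_view(2)[OF xy, of "\<lambda>(a, b). ln (pmf nu b / pmf (PB y) (a, b))"] by simp
  have iA: "integrable (W x y) ?A"
    using integrable_gapA[OF ent xy(1)] integrable_view(1)[OF xy, of "\<lambda>(a, c). ln (pmf mu c / pmf (PA x) (a, c))"] by simp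
  have iC: "integrable (W x y) ?C" unfolding z_def by (rule integrable_gapC(1)[OF ent xy])
  have i1: "integrable (W x y) ?r1" using R1_bound(1)[OF xy(2)] integrable_view(2)[OF xy, of "R1 y"] by simp
  have i3: "integrable (W x y) ?r3" using R2_bound(1)[OF xy(1)] integrable_view(1)[OF xy, of "R2 x"] by simp
  have i4: "integrable (W x y) ?r4" using R3_bound(1)[OF z] integrable_view(3)[OF xy, of "R3 z"] by (simp add: z_def)
  have pos: "0 < ?r1 m" "0 < ?r3 m" "0 < ?r4 m"
    and eq: "- ln (?r1 m) + - ln (?r3 m) + - ln (?r4 m) = ?l m - ?B m - ?A m + ?C m + ln (pmf PZ z)"
    if m: "m \<in> set_pmf (W x y)" for m
  proof -
    obtain a b c where ac: "m = (a, b, c)" by (metis prod_cases3)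
    have m': "(a, b, c) \<in> set_pmf (W x y)" using m ac by simp
    note D = set_W_D[OF xy m']
    have p: "0 < pmf (PC z) (b, c)" "0 < pmf (PA x) (a, c)" "0 < pmf (PB y) (a, b)"
      "0 < pmf mu c" "0 < pmf nu b" "0 < pmf la a" "0 < f1 a" "0 < g1 b" "0 < enn2real (L c)"
      using D by (simp_all add: pmf_positive f1_pos g1_pos L_bounds z_def del: enn2real_positive_iff)
    have q: "0 < \<alpha> x a c" "0 < \<beta> y a b" "0 < \<gamma> b c" using m' xy by (simp_all add: set_W_iff)
    show "0 < ?r1 m" "0 < ?r3 m" "0 < ?r4 m" using p q zp ac by (simp_all add: R1_def R2_def R3_def del: enn2real_positive_iff)
    show "- ln (?r1 m) + - ln (?r3 m) + - ln (?r4 m) = ?l m - ?B m - ?A m + ?C m + ln (pmf PZ z)"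
      using p q zp by (simp add: ac R1_def R2_def R3_def factor[OF xy] ln_mult ln_div del: enn2real_positive_iff)
  qed
  have lower: "1 - ?r1 m \<le> - ln (?r1 m)" "1 - ?r3 m \<le> - ln (?r3 m)" "1 - ?r4 m \<le> - ln (?r4 m)"
    if m: "m \<in> set_pmf (W x y)" for m
    using pos[OF m] by (simp_all only: ln_ge_one_minus_inverse)
  define S where "S = (\<lambda>m. ?l m - ?B m - ?A m + ?C m + ln (pmf PZ z))"
  have iS: "integrable (W x y) S" unfolding S_def
    using il iB iA iC
    by (intro Bochner_Integration.integrable_add Bochner_Integration.integrable_diff) auto
  \<comment> \<open>No single logarithm is known to be integrable. Each is bounded below by one
    minus its ratio and, as the sum \<open>S\<close> is integrable, above by \<open>S\<close> minus
    the lower bounds of the other two.\<close>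
  have j1: "integrable (W x y) (\<lambda>m. - ln (?r1 m))"
  proof (rule integrable_between)
    show "integrable (W x y) (\<lambda>m. 1 - ?r1 m)" using i1 by (intro Bochner_Integration.integrable_diff) auto
    show "integrable (W x y) (\<lambda>m. S m - (1 - ?r3 m) - (1 - ?r4 m))"
      using iS i3 i4 by (intro Bochner_Integration.integrable_diff) auto
    fix m assume m: "m \<in> set_pmf (W x y)"
    show "1 - ?r1 m \<le> - ln (?r1 m)" by (rule lower(1)[OF m])
    show "- ln (?r1 m) \<le> S m - (1 - ?r3 m) - (1 - ?r4 m)"
      using lower[OF m] eq[OF m] unfolding S_def by linarith
  qed
  have j3: "integrable (W x y) (\<lambda>m. - ln (?r3 m))"
  proof (rule integrable_between)
    show "integrable (W x y) (\<lambda>m. 1 - ?r3 m)" using i3 by (intro Bochner_Integration.integrable_diff) auto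
    show "integrable (W x y) (\<lambda>m. S m - (1 - ?r1 m) - (1 - ?r4 m))"
      using iS i1 i4 by (intro Bochner_Integration.integrable_diff) auto
    fix m assume m: "m \<in> set_pmf (W x y)"
    show "1 - ?r3 m \<le> - ln (?r3 m)" by (rule lower(2)[OF m])
    show "- ln (?r3 m) \<le> S m - (1 - ?r1 m) - (1 - ?r4 m)"
      using lower[OF m] eq[OF m] unfolding S_def by linarith
  qed
  have j4: "integrable (W x y) (\<lambda>m. - ln (?r4 m))"
  proof (rule integrable_between)
    show "integrable (W x y) (\<lambda>m. 1 - ?r4 m)" using i4 by (intro Bochner_Integration.integrable_diff) auto
    show "integrable (W x y) (\<lambda>m. S m - (1 - ?r1 m) - (1 - ?r3 m))"
      using iS i1 i3 by (intro Bochner_Integration.integrable_diff) auto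
    fix m assume m: "m \<in> set_pmf (W x y)"
    show "1 - ?r4 m \<le> - ln (?r4 m)" by (rule lower(3)[OF m])
    show "- ln (?r4 m) \<le> S m - (1 - ?r1 m) - (1 - ?r3 m)"
      using lower[OF m] eq[OF m] unfolding S_def by linarith
  qed
  have e1: "measure_pmf.expectation (W x y) (\<lambda>m. - ln (?r1 m)) = t1 y"
    using expectation_view(2)[OF xy, of "\<lambda>m. - ln (R1 y m)"] by (simp add: t1_def case_prod_unfold)
  have e3: "measure_pmf.expectation (W x y) (\<lambda>m. - ln (?r3 m)) = t2 x"
    using expectation_view(1)[OF xy, of "\<lambda>m. - ln (R2 x m)"] by (simp add: t2_def case_prod_unfold)
  have e4: "measure_pmf.expectation (W x y) (\<lambda>m. - ln (?r4 m)) = t3 z"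
    using expectation_view(3)[OF xy, of "\<lambda>m. - ln (R3 z m)"] by (simp add: t3_def z_def case_prod_unfold)
  have eA: "measure_pmf.expectation (W x y) ?A = gapA x"
    using expectation_view(1)[OF xy, of "\<lambda>(a, c). ln (pmf mu c / pmf (PA x) (a, c))"] by (simp add: gapA_def)
  have eB: "measure_pmf.expectation (W x y) ?B = gapB y"
    using expectation_view(2)[OF xy, of "\<lambda>(a, b). ln (pmf nu b / pmf (PB y) (a, b))"] by (simp add: gapB_def)
  have eC: "measure_pmf.expectation (W x y) ?C = gapC x y" by (simp add: gapC_def z_def)
  have el: "measure_pmf.expectation (W x y) ?l = h"
    using expectation_view(4)[OF xy, of "\<lambda>a. - ln (pmf la a)"] by (simp add: h_def)
  have "t1 y + t2 x + t3 z = measure_pmf.expectation (W x y) (\<lambda>m. - ln (?r1 m) + - ln (?r3 m) + - ln (?r4 m))"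
    using j1 j3 j4 e1 e3 e4 by (simp only: Bochner_Integration.integral_add Bochner_Integration.integrable_add)
  also have "\<dots> = measure_pmf.expectation (W x y) S"
    using eq unfolding S_def by (intro integral_cong_AE) (auto simp: AE_measure_pmf_iff)
  also have "\<dots> = h - gapB y - gapA x + gapC x y + ln (pmf PZ z)"
  proof -
    have "measure_pmf.expectation (W x y) (\<lambda>m. u m - v m - w m + r m + k)
       = measure_pmf.expectation (W x y) u - measure_pmf.expectation (W x y) v
         - measure_pmf.expectation (W x y) w + measure_pmf.expectation (W x y) r + k"
      if "integrable (W x y) u" "integrable (W x y) v" "integrable (W x y) w" "integrable (W x y) r"
      for u v w r :: "'a \<times> 'b \<times> 'c \<Rightarrow> real" and k
      using that by simp
    from this[OF il iB iA iC] show ?thesis unfolding S_def el eA eB eC .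
  qed
  finally show "h = t1 y + t2 x + t3 (f x y) + gapB y + gapA x - gapC x y - ln (pmf PZ (f x y))"
    by (simp add: z_def)
  have "1 - measure_pmf.expectation (W x y) ?r1 \<le> t1 y"
    using expectation_mono_pmf[OF _ j1, of "\<lambda>m. 1 - ?r1 m"] i1 lower(1) e1 by simp
  then show "1 - measure_pmf.expectation (PB y) (R1 y) \<le> t1 y" 
    using expectation_view(2)[OF xy, of "R1 y"] by simp
  have "1 - measure_pmf.expectation (W x y) ?r3 \<le> t2 x"
    using expectation_mono_pmf[OF _ j3, of "\<lambda>m. 1 - ?r3 m"] i3 lower(2) e3 by simp
  then show "1 - measure_pmf.expectation (PA x) (R2 x) \<le> t2 x" 
    using expectation_view(1)[OF xy, of "R2 x"] by simp
  have "1 - measure_pmf.expectation (W x y) ?r4 \<le> t3 z"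
    using expectation_mono_pmf[OF _ j4, of "\<lambda>m. 1 - ?r4 m"] i4 lower(3) e4 by simp
  then show "1 - measure_pmf.expectation (PC (f x y)) (R3 (f x y)) \<le> t3 (f x y)" 
    using expectation_view(3)[OF xy, of "R3 z"] by (simp add: z_def)
qed

end

text \<open>The marginal conditions make the leftover entropies cancel: \<open>gapC\<close> splits
  into functions of \<open>x\<close>, of \<open>y\<close> and of \<open>f x y\<close>, and
  \<open>J1\<close> with \<open>J2\<close> has the same laws of these three quantities as the
  product law with \<open>J3\<close>. About \<open>J3\<close> itself only the sign of
  \<open>gapC\<close> matters.\<close>

lemma entropy_first_link_ge:
  assumes ent: "integrable la (\<lambda>a. - ln (pmf la a))"
    and PX: "set_pmf PX = DX" and PY: "set_pmf PY = DY"
    and PZ: "PZ = map_pmf (\<lambda>(x, y). f x y) (pair_pmf PX PY)"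
    and J1: "set_pmf J1 \<subseteq> DX \<times> DY" and J2: "set_pmf J2 \<subseteq> DX \<times> DY" and J3: "set_pmf J3 \<subseteq> DX \<times> DY"
    and m1: "map_pmf fst J1 = PX" "map_pmf snd J1 = map_pmf snd J3"
    and m2: "map_pmf snd J2 = PY" "map_pmf fst J2 = map_pmf fst J3"
    and z1: "map_pmf (\<lambda>(x, y). f x y) J1 = PZ" and z2: "map_pmf (\<lambda>(x, y). f x y) J2 = PZ"
    and z3: "map_pmf (\<lambda>(x, y). f x y) J3 = PZ"
  shows "measure_pmf.expectation PZ (\<lambda>z. - ln (pmf PZ z))
     + measure_pmf.expectation J1 (\<lambda>(x, y). ln (pmf (map_pmf (\<lambda>(x, y). (x, f x y)) J1) (x, f x y) / pmf J1 (x, y)))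
     + measure_pmf.expectation J2 (\<lambda>(x, y). ln (pmf (map_pmf (\<lambda>(x, y). (y, f x y)) J2) (y, f x y) / pmf J2 (x, y)))
    \<le> measure_pmf.expectation la (\<lambda>a. - ln (pmf la a))"
proof -
  define T1 where "T1 = t1"
  define T2 where "T2 = t2 PX"
  define T3 where "T3 = t3 PX PZ"
  note dec = entropy_decomposition[OF ent PX PY PZ, folded T1_def T2_def T3_def]
  note hd = h_def[OF ent PX PY PZ]
  let ?J0 = "pair_pmf PX PY"
  let ?E = "\<lambda>J. measure_pmf.expectation J"
  have finD: "finite (DX \<times> DY)" using finite_inputs by simp
  have int: "integrable (measure_pmf J) g" if "set_pmf J \<subseteq> DX \<times> DY" for J and g :: "'x \<times> 'y \<Rightarrow> real"
    using finite_subset[OF that finD] by (rule integrable_measure_pmf_finite)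
  have J0: "set_pmf ?J0 \<subseteq> DX \<times> DY" by (simp add: PX PY)
  have J0z: "map_pmf (\<lambda>(x, y). f x y) ?J0 = PZ" by (simp add: PZ)
  \<comment> \<open>Every other term of \<open>entropy_decomposition\<close> depends on one of
    \<open>x\<close>, \<open>y\<close>, \<open>f x y\<close> only, so the expectation of
    \<open>gapC\<close> sees just three marginals of the input law.\<close>
  have split: "?E J (\<lambda>(x, y). gapC x y)
     = ?E (map_pmf fst J) (\<lambda>x. T2 x + gapA x) + ?E (map_pmf snd J) (\<lambda>y. T1 y + gapB y)
       + ?E (map_pmf (\<lambda>(x, y). f x y) J) (\<lambda>z. T3 z - ln (pmf PZ z) - h)"
    if J: "set_pmf J \<subseteq> DX \<times> DY" for J
  proof -
    have "?E J (\<lambda>(x, y). gapC x y)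
      = ?E J (\<lambda>i. (T2 (fst i) + gapA (fst i)) + (T1 (snd i) + gapB (snd i))
          + (T3 (f (fst i) (snd i)) - ln (pmf PZ (f (fst i) (snd i))) - h))"
    proof (rule integral_cong_AE)
      show "AE i in J. (case i of (x, y) \<Rightarrow> gapC x y) = (T2 (fst i) + gapA (fst i)) + (T1 (snd i) + gapB (snd i))
          + (T3 (f (fst i) (snd i)) - ln (pmf PZ (f (fst i) (snd i))) - h)"
        unfolding AE_measure_pmf_iff
      proof
        fix i assume "i \<in> set_pmf J"
        then have "fst i \<in> DX" "snd i \<in> DY" using J by auto
        from dec(1)[OF this] show "(case i of (x, y) \<Rightarrow> gapC x y) = (T2 (fst i) + gapA (fst i)) + (T1 (snd i) + gapB (snd i))
          + (T3 (f (fst i) (snd i)) - ln (pmf PZ (f (fst i) (snd i))) - h)"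
          by (simp add: case_prod_unfold)
      qed
    qed simp_all
    also have "\<dots> = ?E J (\<lambda>i. T2 (fst i) + gapA (fst i)) + ?E J (\<lambda>i. T1 (snd i) + gapB (snd i))
       + ?E J (\<lambda>i. T3 (f (fst i) (snd i)) - ln (pmf PZ (f (fst i) (snd i))) - h)"
      by (simp only: Bochner_Integration.integral_add int[OF J] Bochner_Integration.integrable_add)
    finally show ?thesis by (simp add: case_prod_unfold)
  qed
  have C3: "0 \<le> ?E J3 (\<lambda>(x, y). gapC x y)"
    using J3 gapC_nonneg[OF ent] by (intro integral_nonneg_AE) (auto simp: AE_measure_pmf_iff)
  have swap: "?E J1 (\<lambda>(x, y). gapC x y) + ?E J2 (\<lambda>(x, y). gapC x y)
     = ?E ?J0 (\<lambda>(x, y). gapC x y) + ?E J3 (\<lambda>(x, y). gapC x y)"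
    unfolding split[OF J0] split[OF J1] split[OF J2] split[OF J3] m1 m2 z1 z2 z3 J0z
    by (simp add: map_fst_pair_pmf map_snd_pair_pmf)
  have finX: "finite (set_pmf PX)" "finite (set_pmf PY)" "finite (set_pmf PZ)"
    using finite_inputs by (simp_all add: PX PY PZ)
  note intX = integrable_measure_pmf_finite[OF finX(1)]
    and intY = integrable_measure_pmf_finite[OF finX(2)]
    and intZ = integrable_measure_pmf_finite[OF finX(3)]
  \<comment> \<open>\<open>gapA\<close> depends on \<open>x\<close> alone and \<open>J1\<close> has
    first marginal \<open>PX\<close>, so the bound obtained under \<open>J1\<close> speaks about the
    product law.\<close>
  have A: "?E J1 (\<lambda>(x, y). ln (pmf (map_pmf (\<lambda>(x, y). (x, f x y)) J1) (x, f x y) / pmf J1 (x, y)))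
     \<le> ?E PX gapA - ?E J1 (\<lambda>(x, y). gapC x y)"
    using gapA_ge[OF ent J1 refl] Bochner_Integration.integral_diff[OF int[OF J1] int[OF J1], of "\<lambda>i. gapA (fst i)" "\<lambda>(x, y). gapC x y"]
    by (simp add: case_prod_unfold m1(1)[symmetric])
  have B: "?E J2 (\<lambda>(x, y). ln (pmf (map_pmf (\<lambda>(x, y). (y, f x y)) J2) (y, f x y) / pmf J2 (x, y)))
     \<le> ?E PY gapB - ?E J2 (\<lambda>(x, y). gapC x y)"
    using gapB_ge[OF ent J2 refl] Bochner_Integration.integral_diff[OF int[OF J2] int[OF J2], of "\<lambda>i. gapB (snd i)" "\<lambda>(x, y). gapC x y"]
    by (simp add: case_prod_unfold m2(1)[symmetric])
  have T1: "0 \<le> ?E PY T1"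
  proof (intro integral_nonneg_AE, unfold AE_measure_pmf_iff, intro ballI)
    fix y assume "y \<in> set_pmf PY"
    moreover obtain x where "x \<in> DX" using nonempty_inputs by auto
    ultimately show "0 \<le> T1 y" using dec(2)[of x y] R1_bound(2)[OF ent PX PY PZ, of y] PY by auto
  qed
  have T2: "0 \<le> ?E PX T2"
  proof -
    obtain y where y: "y \<in> DY" using nonempty_inputs by auto
    have "0 \<le> (\<Sum>x\<in>DX. pmf PX x * (1 - ?E (PA x) (R2 PX x)))"
      using R2_bound(2)[OF ent PX PY PZ] sum_pmf_eq_1[OF finite_inputs(1), of PX] PX
      by (simp add: right_diff_distrib sum_subtractf)
    also have "\<dots> \<le> (\<Sum>x\<in>DX. pmf PX x * T2 x)"
      using dec(3)[OF _ y] by (intro sum_mono mult_left_mono) auto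
    also have "\<dots> = ?E PX T2"
      using integral_measure_pmf_real[OF finite_inputs(1), of PX T2] PX by (simp add: mult.commute)
    finally show ?thesis .
  qed
  have T3: "0 \<le> ?E PZ T3"
  proof -
    have "0 \<le> (\<Sum>z\<in>set_pmf PZ. pmf PZ z * (1 - ?E (PC z) (R3 PX PZ z)))"
      using R3_bound(2)[OF ent PX PY PZ] sum_pmf_eq_1[OF finX(3), of PZ]
      by (simp add: right_diff_distrib sum_subtractf)
    also have "\<dots> \<le> (\<Sum>z\<in>set_pmf PZ. pmf PZ z * T3 z)"
    proof (intro sum_mono mult_left_mono)
      fix z assume "z \<in> set_pmf PZ"
      then obtain x y where "x \<in> DX" "y \<in> DY" "z = f x y" by (auto simp: PZ PX PY)
      then show "1 - ?E (PC z) (R3 PX PZ z) \<le> T3 z" using dec(4) by auto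
    qed simp
    also have "\<dots> = ?E PZ T3"
      using integral_measure_pmf_real[OF finX(3), of PZ T3] by (simp add: mult.commute)
    finally show ?thesis .
  qed
  have "?E ?J0 (\<lambda>(x, y). gapC x y) = ?E PX T2 + ?E PX gapA + (?E PY T1 + ?E PY gapB)
      + (?E PZ T3 + ?E PZ (\<lambda>z. - ln (pmf PZ z)) - h)"
    unfolding split[OF J0] J0z by (simp add: map_fst_pair_pmf map_snd_pair_pmf intX intY intZ)
  then show ?thesis using swap A B C3 T1 T2 T3 unfolding hd by linarith
qed

end

section \<open>Independent copies of a law on bit pairs\<close>

lemma replicate_pmf_Suc_pair: "replicate_pmf (Suc n) j = map_pmf (\<lambda>(v, w). v # w) (pair_pmf j (replicate_pmf n j))"
  by (simp add: pair_pmf_def map_pmf_def bind_assoc_pmf bind_return_pmf)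

lemma map_replicate_pmf: "map_pmf (map g) (replicate_pmf n j) = replicate_pmf n (map_pmf g j)"
proof (induction n)
  case (Suc n)
  show ?case
    unfolding replicate_pmf_Suc_pair Suc.IH[symmetric] map_pair[symmetric]
    by (simp add: pmf.map_comp o_def case_prod_unfold)
qed simp

lemma pmf_replicate_pmf: "length w = n \<Longrightarrow> pmf (replicate_pmf n j) w = prod_list (map (pmf j) w)"
proof (induction n arbitrary: w)
  case (Suc n)
  then obtain v w' where w: "w = v # w'" "length w' = n" by (cases w) auto
  have "pmf (replicate_pmf (Suc n) j) ((\<lambda>(v, w). v # w) (v, w')) = pmf (pair_pmf j (replicate_pmf n j)) (v, w')"
    unfolding replicate_pmf_Suc_pair by (rule pmf_map_inj') (auto simp: inj_on_def)
  then show ?case using Suc.IH w by (simp add: pmf_pair)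
qed simp

lemma finite_set_replicate_pmf: "finite (set_pmf j) \<Longrightarrow> finite (set_pmf (replicate_pmf n j))"
  unfolding set_replicate_pmf using finite_lists_length_eq[of "set_pmf j" n] by (simp add: lists_eq_set conj_commute)

lemma expectation_replicate_pmf:
  fixes \<phi> :: "'a \<Rightarrow> real"
  assumes fin: "finite (set_pmf j)"
  shows "measure_pmf.expectation (replicate_pmf n j) (\<lambda>w. \<Sum>v\<leftarrow>w. \<phi> v) = real n * measure_pmf.expectation j \<phi>"
proof (induction n)
  case (Suc n)
  let ?P = "pair_pmf j (replicate_pmf n j)"
  have finP: "finite (set_pmf ?P)" using fin finite_set_replicate_pmf[OF fin] by simp
  have "measure_pmf.expectation (replicate_pmf (Suc n) j) (\<lambda>w. \<Sum>v\<leftarrow>w. \<phi> v)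
     = measure_pmf.expectation ?P (\<lambda>i. \<phi> (fst i) + (\<Sum>v\<leftarrow>snd i. \<phi> v))"
    unfolding replicate_pmf_Suc_pair by (simp add: case_prod_unfold)
  also have "\<dots> = measure_pmf.expectation (map_pmf fst ?P) \<phi> + measure_pmf.expectation (map_pmf snd ?P) (\<lambda>w. \<Sum>v\<leftarrow>w. \<phi> v)"
    using integrable_measure_pmf_finite[OF finP, of "\<lambda>i. \<phi> (fst i)"]
      integrable_measure_pmf_finite[OF finP, of "\<lambda>i. \<Sum>v\<leftarrow>snd i. \<phi> v"] by simp
  finally show ?case using Suc.IH by (simp add: map_fst_pair_pmf map_snd_pair_pmf algebra_simps)
qed simp

lemma expectation_replicate_pmf_ln:
  fixes j :: "'a pmf" and k :: "'b pmf"
  assumes fin: "finite (set_pmf j)" and k: "k = map_pmf g j"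
  shows "measure_pmf.expectation (replicate_pmf n j)
      (\<lambda>w. ln (pmf (replicate_pmf n k) (map g w) / pmf (replicate_pmf n j) w))
    = real n * measure_pmf.expectation j (\<lambda>v. ln (pmf k (g v) / pmf j v))"
proof -
  have "ln (pmf (replicate_pmf n k) (map g w) / pmf (replicate_pmf n j) w) = (\<Sum>v\<leftarrow>w. ln (pmf k (g v) / pmf j v))"
    if "w \<in> set_pmf (replicate_pmf n j)" for w
  proof -
    from that have len: "length w = n" and w: "\<forall>v\<in>set w. v \<in> set_pmf j" by (auto simp: set_replicate_pmf)
    have "ln (prod_list (map (pmf k) (map g w)) / prod_list (map (pmf j) w)) = (\<Sum>v\<leftarrow>w. ln (pmf k (g v) / pmf j v))
      \<and> 0 < prod_list (map (pmf k) (map g w)) \<and> 0 < prod_list (map (pmf j) w)"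
      using w
    proof (induction w)
      case (Cons v w)
      have "0 < pmf j v" "0 < pmf k (g v)" using Cons.prems by (auto simp: k intro!: pmf_positive)
      then show ?case using Cons by (auto simp: ln_mult ln_div)
    qed simp
    then show ?thesis using len by (simp add: pmf_replicate_pmf)
  qed
  then have "measure_pmf.expectation (replicate_pmf n j)
      (\<lambda>w. ln (pmf (replicate_pmf n k) (map g w) / pmf (replicate_pmf n j) w))
    = measure_pmf.expectation (replicate_pmf n j) (\<lambda>w. \<Sum>v\<leftarrow>w. ln (pmf k (g v) / pmf j v))"
    by (intro integral_cong_AE) (auto simp: AE_measure_pmf_iff)
  then show ?thesis using expectation_replicate_pmf[OF fin] by simp
qed

lemma expectation_replicate_pmf_entropy:
  fixes k :: "'b pmf"
  assumes "finite (set_pmf k)"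
  shows "measure_pmf.expectation (replicate_pmf n k) (\<lambda>w. - ln (pmf (replicate_pmf n k) w))
    = real n * measure_pmf.expectation k (\<lambda>v. - ln (pmf k v))"
proof -
  have "- ln (pmf (replicate_pmf n k) w) = (\<Sum>v\<leftarrow>w. - ln (pmf k v))"
    if "w \<in> set_pmf (replicate_pmf n k)" for w
  proof -
    from that have len: "length w = n" and w: "\<forall>v\<in>set w. v \<in> set_pmf k" by (auto simp: set_replicate_pmf)
    have "- ln (prod_list (map (pmf k) w)) = (\<Sum>v\<leftarrow>w. - ln (pmf k v)) \<and> 0 < prod_list (map (pmf k) w)"
      using w
    proof (induction w)
      case (Cons v w)
      have "0 < pmf k v" using Cons.prems by (auto intro!: pmf_positive)
      then show ?case using Cons by (auto simp: ln_mult)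
    qed simp
    then show ?thesis using len by (simp add: pmf_replicate_pmf)
  qed
  then have "measure_pmf.expectation (replicate_pmf n k) (\<lambda>w. - ln (pmf (replicate_pmf n k) w))
    = measure_pmf.expectation (replicate_pmf n k) (\<lambda>w. \<Sum>v\<leftarrow>w. - ln (pmf k v))"
    by (intro integral_cong_AE) (auto simp: AE_measure_pmf_iff)
  then show ?thesis using expectation_replicate_pmf[OF assms] by simp
qed

definition input_pairs :: "nat \<Rightarrow> (bool \<times> bool) pmf \<Rightarrow> (bool list \<times> bool list) pmf" where
  "input_pairs n j = map_pmf (\<lambda>w. (map fst w, map snd w)) (replicate_pmf n j)"

lemma bitAND_map: "bitAND (map fst w) (map snd w) = map (\<lambda>(a, b). a \<and> b) w"
  by (induction w) (auto simp: bitAND_def)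

lemma set_input_pairs: "set_pmf (input_pairs n j) \<subseteq> {x. length x = n} \<times> {y. length y = n}"
  by (auto simp: input_pairs_def set_replicate_pmf)

lemma input_pairs_marginals:
  "map_pmf fst (input_pairs n j) = replicate_pmf n (map_pmf fst j)"
  "map_pmf snd (input_pairs n j) = replicate_pmf n (map_pmf snd j)"
  "map_pmf (\<lambda>(x, y). bitAND x y) (input_pairs n j) = replicate_pmf n (map_pmf (\<lambda>(a, b). a \<and> b) j)"
  "map_pmf (\<lambda>(x, y). (x, bitAND x y)) (input_pairs n j) = input_pairs n (map_pmf (\<lambda>(a, b). (a, a \<and> b)) j)"
  "map_pmf (\<lambda>(x, y). (y, bitAND x y)) (input_pairs n j) = input_pairs n (map_pmf (\<lambda>(a, b). (b, a \<and> b)) j)"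
  by (simp_all add: input_pairs_def pmf.map_comp o_def bitAND_map map_replicate_pmf[symmetric] case_prod_unfold)

lemma pmf_input_pairs: "pmf (input_pairs n j) (map fst w, map snd w) = pmf (replicate_pmf n j) w"
  unfolding input_pairs_def
  by (rule pmf_map_inj'[of "\<lambda>w. (map fst w, map snd w)", simplified])
     (auto simp: inj_on_def intro: pair_list_eqI)

lemma pair_replicate_pmf: "pair_pmf (replicate_pmf n p) (replicate_pmf n q) = input_pairs n (pair_pmf p q)"
proof (induction n)
  case (Suc n)
  have "pair_pmf (replicate_pmf (Suc n) p) (replicate_pmf (Suc n) q)
    = map_pmf (\<lambda>((a, b), (x, y)). (a # x, b # y)) (pair_pmf (pair_pmf p q) (pair_pmf (replicate_pmf n p) (replicate_pmf n q)))"
    unfolding replicate_pmf_Suc_pair pair_pmf_def map_pmf_def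
    by (simp add: bind_assoc_pmf bind_return_pmf)
       (rule bind_pmf_cong[OF refl], rule bind_commute_pmf)
  also have "\<dots> = input_pairs (Suc n) (pair_pmf p q)"
    unfolding Suc.IH input_pairs_def replicate_pmf_Suc_pair
    by (simp add: pair_map_pmf2 pmf.map_comp o_def case_prod_unfold)
  finally show ?case .
qed (simp add: input_pairs_def pair_pmf_def bind_return_pmf map_pmf_def)

lemma expectation_input_pairs_ln:
  "measure_pmf.expectation (input_pairs n j)
     (\<lambda>(x, y). ln (pmf (map_pmf (\<lambda>(x, y). (x, bitAND x y)) (input_pairs n j)) (x, bitAND x y) / pmf (input_pairs n j) (x, y)))
   = real n * measure_pmf.expectation j (\<lambda>(a, b). ln (pmf (map_pmf (\<lambda>(a, b). (a, a \<and> b)) j) (a, a \<and> b) / pmf j (a, b)))"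
  "measure_pmf.expectation (input_pairs n j)
     (\<lambda>(x, y). ln (pmf (map_pmf (\<lambda>(x, y). (y, bitAND x y)) (input_pairs n j)) (y, bitAND x y) / pmf (input_pairs n j) (x, y)))
   = real n * measure_pmf.expectation j (\<lambda>(a, b). ln (pmf (map_pmf (\<lambda>(a, b). (b, a \<and> b)) j) (b, a \<and> b) / pmf j (a, b)))"
proof -
  have 1: "pmf (input_pairs n k) (map fst w, bitAND (map fst w) (map snd w)) = pmf (replicate_pmf n k) (map (\<lambda>(a, b). (a, a \<and> b)) w)" for w k
    using pmf_input_pairs[of n k "map (\<lambda>(a, b). (a, a \<and> b)) w"] by (simp add: bitAND_map o_def case_prod_unfold)
  have 2: "pmf (input_pairs n k) (map snd w, bitAND (map fst w) (map snd w)) = pmf (replicate_pmf n k) (map (\<lambda>(a, b). (b, a \<and> b)) w)" for w k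
    using pmf_input_pairs[of n k "map (\<lambda>(a, b). (b, a \<and> b)) w"] by (simp add: bitAND_map o_def case_prod_unfold)
  have *: "measure_pmf.expectation (input_pairs n j) F = measure_pmf.expectation (replicate_pmf n j) (\<lambda>w. F (map fst w, map snd w))" for F :: "_ \<Rightarrow> real"
    by (simp add: input_pairs_def)
  note e = expectation_replicate_pmf_ln[OF _ refl, of j n]
  show "measure_pmf.expectation (input_pairs n j)
     (\<lambda>(x, y). ln (pmf (map_pmf (\<lambda>(x, y). (x, bitAND x y)) (input_pairs n j)) (x, bitAND x y) / pmf (input_pairs n j) (x, y)))
   = real n * measure_pmf.expectation j (\<lambda>(a, b). ln (pmf (map_pmf (\<lambda>(a, b). (a, a \<and> b)) j) (a, a \<and> b) / pmf j (a, b)))"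
    using e[of "\<lambda>(a, b). (a, a \<and> b)"] unfolding * input_pairs_marginals by (simp add: 1 pmf_input_pairs case_prod_unfold)
  show "measure_pmf.expectation (input_pairs n j)
     (\<lambda>(x, y). ln (pmf (map_pmf (\<lambda>(x, y). (y, bitAND x y)) (input_pairs n j)) (y, bitAND x y) / pmf (input_pairs n j) (x, y)))
   = real n * measure_pmf.expectation j (\<lambda>(a, b). ln (pmf (map_pmf (\<lambda>(a, b). (b, a \<and> b)) j) (b, a \<and> b) / pmf j (a, b)))"
    using e[of "\<lambda>(a, b). (b, a \<and> b)"] unfolding * input_pairs_marginals by (simp add: 2 pmf_input_pairs case_prod_unfold)
qed

text \<open>Two joint laws of a pair of input bits, and a third one that has their missing marginals.
  All three agree with independent bits of bias \<open>1/3\<close> in the law of the conjunction.\<close>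

definition bits1 :: "(bool \<times> bool) pmf" where
  "bits1 = pmf_of_list [((True, True), 1/9), ((True, False), 2/9), ((False, True), 1/3), ((False, False), 1/3)]"

definition bits2 :: "(bool \<times> bool) pmf" where
  "bits2 = pmf_of_list [((True, True), 1/9), ((True, False), 1/3), ((False, True), 2/9), ((False, False), 1/3)]"

definition bits3 :: "(bool \<times> bool) pmf" where
  "bits3 = pmf_of_list [((True, True), 1/9), ((True, False), 1/3), ((False, True), 1/3), ((False, False), 2/9)]"

lemma pmf_bits:
  "pmf bits1 v = (case v of (True, True) \<Rightarrow> 1/9 | (True, False) \<Rightarrow> 2/9 | (False, _) \<Rightarrow> 1/3)"
  "pmf bits2 v = (case v of (True, True) \<Rightarrow> 1/9 | (False, True) \<Rightarrow> 2/9 | (_, False) \<Rightarrow> 1/3)"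
  "pmf bits3 v = (case v of (True, True) \<Rightarrow> 1/9 | (False, False) \<Rightarrow> 2/9 | _ \<Rightarrow> 1/3)"
  unfolding bits1_def bits2_def bits3_def
  by (subst pmf_pmf_of_list; force simp: pmf_of_list_wf_def split: prod.splits bool.splits)+

lemma pmf_map_bits:
  fixes j :: "(bool \<times> bool) pmf"
  shows "pmf (map_pmf fst j) a = pmf j (a, True) + pmf j (a, False)"
    "pmf (map_pmf snd j) b = pmf j (True, b) + pmf j (False, b)"
    "pmf (map_pmf (\<lambda>(a, b). a \<and> b) j) True = pmf j (True, True)"
    "pmf (map_pmf (\<lambda>(a, b). (a, a \<and> b)) j) (True, b) = pmf j (True, b)"
    "pmf (map_pmf (\<lambda>(a, b). (a, a \<and> b)) j) (False, False) = pmf j (False, True) + pmf j (False, False)"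
    "pmf (map_pmf (\<lambda>(a, b). (b, a \<and> b)) j) (True, a) = pmf j (a, True)"
    "pmf (map_pmf (\<lambda>(a, b). (b, a \<and> b)) j) (False, False) = pmf j (True, False) + pmf j (False, False)"
proof -
  have *: "pmf (map_pmf g j) v = (\<Sum>i\<in>S. pmf j i)" if "\<And>i. g i = v \<longleftrightarrow> i \<in> S" for g :: "bool \<times> bool \<Rightarrow> 'z" and v S
  proof -
    have "g -` {v} = S" using that by auto
    then show ?thesis by (simp add: pmf_map measure_measure_pmf_finite)
  qed
  show "pmf (map_pmf fst j) a = pmf j (a, True) + pmf j (a, False)"
    by (subst *[of _ _ "{(a, True), (a, False)}"]) auto
  show "pmf (map_pmf snd j) b = pmf j (True, b) + pmf j (False, b)"
    by (subst *[of _ _ "{(True, b), (False, b)}"]) auto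
  show "pmf (map_pmf (\<lambda>(a, b). a \<and> b) j) True = pmf j (True, True)"
    by (subst *[of _ _ "{(True, True)}"]) auto
  show "pmf (map_pmf (\<lambda>(a, b). (a, a \<and> b)) j) (True, b) = pmf j (True, b)"
    by (subst *[of _ _ "{(True, b)}"]) auto
  show "pmf (map_pmf (\<lambda>(a, b). (a, a \<and> b)) j) (False, False) = pmf j (False, True) + pmf j (False, False)"
    by (subst *[of _ _ "{(False, True), (False, False)}"]) auto
  show "pmf (map_pmf (\<lambda>(a, b). (b, a \<and> b)) j) (True, a) = pmf j (a, True)"
    by (subst *[of _ _ "{(a, True)}"]) auto
  show "pmf (map_pmf (\<lambda>(a, b). (b, a \<and> b)) j) (False, False) = pmf j (True, False) + pmf j (False, False)"
    by (subst *[of _ _ "{(True, False), (False, False)}"]) auto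
qed

lemma bool_pmf_eqI: "pmf p True = pmf q True \<Longrightarrow> p = (q :: bool pmf)"
  by (rule pmf_eqI) (metis (full_types) pmf_False_conv_True)

lemma bits_marginals:
  "map_pmf fst bits1 = bernoulli_pmf (1/3)" "map_pmf snd bits1 = map_pmf snd bits3"
  "map_pmf snd bits2 = bernoulli_pmf (1/3)" "map_pmf fst bits2 = map_pmf fst bits3"
  "map_pmf (\<lambda>(a, b). a \<and> b) bits1 = bernoulli_pmf (1/9)"
  "map_pmf (\<lambda>(a, b). a \<and> b) bits2 = bernoulli_pmf (1/9)"
  "map_pmf (\<lambda>(a, b). a \<and> b) bits3 = bernoulli_pmf (1/9)"
  "map_pmf (\<lambda>(a, b). a \<and> b) (pair_pmf (bernoulli_pmf (1/3)) (bernoulli_pmf (1/3))) = bernoulli_pmf (1/9)"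
  by (rule bool_pmf_eqI; simp add: pmf_map_bits pmf_bits pmf_pair)+

lemma expectation_bits:
  fixes g :: "bool \<times> bool \<Rightarrow> real"
  shows "measure_pmf.expectation j g = pmf j (True, True) * g (True, True) + pmf j (True, False) * g (True, False)
    + pmf j (False, True) * g (False, True) + pmf j (False, False) * g (False, False)"
  by (subst integral_measure_pmf_real[of UNIV])
     (auto simp: UNIV_Times_UNIV[symmetric] UNIV_bool mult.commute simp del: UNIV_Times_UNIV)

text \<open>Per bit, H(Z) is the entropy of bias 1/9, that is 2 log 3 - 8/3, while
  \<open>bits1\<close> and \<open>bits2\<close> each leave one fair bit with probability 2/3. For
  bias t in place of 1/3 the third law would have mass \<open>t * (1 - t)\<close> at two zeros, so
  its nonnegativity is no accident of the numbers.\<close>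

lemma entropy_and_ge:
  assumes "sequential_transcripts {x. length x = n} {y. length y = n} bitAND W PA PB PC la nu mu \<alpha> \<beta> \<gamma> f1 g1"
    and ent: "integrable la (\<lambda>a. - ln (pmf la a))"
  shows "real n * (2 * ln 3 - 4/3 * ln 2) \<le> measure_pmf.expectation la (\<lambda>a. - ln (pmf la a))"
proof -
  interpret sequential_transcripts "{x. length x = n}" "{y. length y = n}" bitAND W PA PB PC la nu mu \<alpha> \<beta> \<gamma> f1 g1
    by fact
  let ?B = "bernoulli_pmf (1/3)" and ?Z = "bernoulli_pmf (1/9)"
  have B: "set_pmf (replicate_pmf n ?B) = {x. length x = n}"
    by (auto simp: set_replicate_pmf set_pmf_bernoulli)
  have e1: "measure_pmf.expectation bits1 (\<lambda>(a, b). ln (pmf (map_pmf (\<lambda>(a, b). (a, a \<and> b)) bits1) (a, a \<and> b) / pmf bits1 (a, b))) = 2/3 * ln 2"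
    by (simp add: expectation_bits pmf_map_bits pmf_bits)
  have e2: "measure_pmf.expectation bits2 (\<lambda>(a, b). ln (pmf (map_pmf (\<lambda>(a, b). (b, a \<and> b)) bits2) (b, a \<and> b) / pmf bits2 (a, b))) = 2/3 * ln 2"
    by (simp add: expectation_bits pmf_map_bits pmf_bits)
  have l9: "ln (9::real) = 2 * ln 3" using ln_realpow[of 3 2] by simp
  have l8: "ln (8::real) = 3 * ln 2" using ln_realpow[of 2 3] by simp
  have e3: "measure_pmf.expectation ?Z (\<lambda>v. - ln (pmf ?Z v)) = 2 * ln 3 - 8/3 * ln 2"
    by (simp add: ln_div l9 l8 algebra_simps)
  have e4: "measure_pmf.expectation (replicate_pmf n ?Z) (\<lambda>z. - ln (pmf (replicate_pmf n ?Z) z)) = real n * (2 * ln 3 - 8/3 * ln 2)"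
    using expectation_replicate_pmf_entropy[of ?Z n] e3 by simp
  have "real n * (2 * ln 3 - 8/3 * ln 2) + real n * (2/3 * ln 2) + real n * (2/3 * ln 2)
    \<le> measure_pmf.expectation la (\<lambda>a. - ln (pmf la a))"
    using entropy_first_link_ge[OF ent B B refl set_input_pairs[of n bits1] set_input_pairs[of n bits2] set_input_pairs[of n bits3]]
    unfolding pair_replicate_pmf input_pairs_marginals(1-3) bits_marginals expectation_input_pairs_ln e1 e2 e4
    by simp
  then show ?thesis by (simp add: algebra_simps)
qed

section \<open>Parsing of transcripts and the law of the final state\<close>

text \<open>A path \<open>\<omega>\<close> holds one message per round, empty ones included, whereas
  a \<open>hist\<close> forgets the empty messages and all round numbers. Product formulas for
  probabilities are therefore indexed by paths.\<close>

primrec seq_hist :: "(nat \<Rightarrow> link) \<Rightarrow> link \<Rightarrow> (nat \<Rightarrow> msg) \<Rightarrow> nat \<Rightarrow> hist" where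
  "seq_hist lk l \<omega> 0 = []"
| "seq_hist lk l \<omega> (Suc t) = (if lk t = l \<and> \<omega> t \<noteq> [] then seq_hist lk l \<omega> t @ [\<omega> t] else seq_hist lk l \<omega> t)"

definition seq_state :: "(nat \<Rightarrow> link) \<Rightarrow> (nat \<Rightarrow> msg) \<Rightarrow> nat \<Rightarrow> state" where
  "seq_state lk \<omega> t = (seq_hist lk L12 \<omega> t, seq_hist lk L23 \<omega> t, seq_hist lk L31 \<omega> t)"

definition coded :: "(nat \<Rightarrow> link) \<Rightarrow> (link \<Rightarrow> nat \<Rightarrow> hist \<Rightarrow> msg set) \<Rightarrow> link \<Rightarrow> (nat \<Rightarrow> msg) \<Rightarrow> nat \<Rightarrow> bool" where
  "coded lk cd l \<omega> t \<longleftrightarrow> (\<forall>i<t. lk i = l \<longrightarrow> \<omega> i \<in> cd l i (seq_hist lk l \<omega> i))"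

definition completes :: "(nat \<Rightarrow> link) \<Rightarrow> (link \<Rightarrow> nat \<Rightarrow> hist \<Rightarrow> msg set) \<Rightarrow> link \<Rightarrow> (nat \<Rightarrow> msg) \<Rightarrow> msg \<Rightarrow> bool" where
  "completes lk cd l \<omega> m \<longleftrightarrow> (\<forall>t. coded lk cd l \<omega> t) \<and>
     (\<exists>T. \<forall>t\<ge>T. seq_hist lk l \<omega> t = seq_hist lk l \<omega> T \<and> concat (seq_hist lk l \<omega> t) = m \<and>
        (lk t = l \<longrightarrow> cd l t (seq_hist lk l \<omega> t) = {[]}))"

text \<open>Possible bit strings of one link, judged by its codes alone. Validity of a triple is
  then a condition on each link separately and does not disturb the factorization into pairwise
  weights.\<close>

definition transcripts :: "(nat \<Rightarrow> link) \<Rightarrow> (link \<Rightarrow> nat \<Rightarrow> hist \<Rightarrow> msg set) \<Rightarrow> link \<Rightarrow> msg set" where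
  "transcripts lk cd l = {m. \<exists>\<omega>. completes lk cd l \<omega> m}"

definition parse :: "(nat \<Rightarrow> link) \<Rightarrow> (link \<Rightarrow> nat \<Rightarrow> hist \<Rightarrow> msg set) \<Rightarrow> link \<Rightarrow> msg \<Rightarrow> nat \<Rightarrow> msg" where
  "parse lk cd l m = (SOME \<omega>. completes lk cd l \<omega> m)"

definition comb :: "(nat \<Rightarrow> link) \<Rightarrow> (link \<Rightarrow> nat \<Rightarrow> hist \<Rightarrow> msg set) \<Rightarrow> msg \<Rightarrow> msg \<Rightarrow> msg \<Rightarrow> nat \<Rightarrow> msg" where
  "comb lk cd a b c i = (case lk i of L12 \<Rightarrow> parse lk cd L12 a i | L23 \<Rightarrow> parse lk cd L23 b i
     | L31 \<Rightarrow> parse lk cd L31 c i)"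

definition bits_of :: "state \<Rightarrow> msg \<times> msg \<times> msg" where
  "bits_of s = (concat (hist_of L12 s), concat (hist_of L23 s), concat (hist_of L31 s))"

lemma seq_state_Suc: "seq_state lk \<omega> (Suc t) = app_msg (lk t) (\<omega> t) (seq_state lk \<omega> t)"
  by (cases "lk t") (auto simp: seq_state_def)

lemma hist_of_seq_state [simp]: "hist_of l (seq_state lk \<omega> t) = seq_hist lk l \<omega> t"
  by (cases l) (auto simp: seq_state_def)

lemma hist_of_app_msg: "hist_of l (app_msg l' m s) = (if l = l' \<and> m \<noteq> [] then hist_of l s @ [m] else hist_of l s)"
  by (cases s; cases l; cases l') auto

lemma state_eqI: "(\<And>l. hist_of l s = hist_of l s') \<Longrightarrow> s = s'"
  by (cases s; cases s') (metis hist_of.simps)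

lemma inj_app_msg: "inj (\<lambda>m. app_msg l m s)"
  by (cases s; cases l) (auto simp: inj_on_def split: if_splits)

lemma seq_hist_cong: "(\<And>i. i < t \<Longrightarrow> lk i = l \<Longrightarrow> \<omega> i = \<omega>' i) \<Longrightarrow> seq_hist lk l \<omega> t = seq_hist lk l \<omega>' t"
  by (induction t) auto

lemma coded_cong:
  assumes "\<And>i. i < t \<Longrightarrow> lk i = l \<Longrightarrow> \<omega> i = \<omega>' i" "coded lk cd l \<omega> t"
  shows "coded lk cd l \<omega>' t"
  unfolding coded_def
proof (intro allI impI)
  fix i assume i: "i < t" "lk i = l"
  have "seq_hist lk l \<omega>' i = seq_hist lk l \<omega> i" using assms(1) i by (intro seq_hist_cong) auto
  then show "\<omega>' i \<in> cd l i (seq_hist lk l \<omega>' i)" using assms i by (auto simp: coded_def)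
qed

lemma coded_mono: "coded lk cd l \<omega> t \<Longrightarrow> t' \<le> t \<Longrightarrow> coded lk cd l \<omega> t'"
  by (auto simp: coded_def)

lemma concat_seq_hist_Suc:
  "concat (seq_hist lk l \<omega> (Suc t)) = concat (seq_hist lk l \<omega> t) @ (if lk t = l then \<omega> t else [])"
  by auto

lemma prefix_comparable_appendD:
  assumes "prefix (u @ v) (u' @ v') \<or> prefix (u' @ v') (u @ v)"
  shows "prefix u u' \<or> prefix u' u"
  using assms
proof
  assume "prefix (u @ v) (u' @ v')"
  from append_prefixD[OF this] show ?thesis by (rule prefix_same_cases) simp
next
  assume "prefix (u' @ v') (u @ v)"
  from append_prefixD[OF this] have "prefix u' u \<or> prefix u u'" by (rule prefix_same_cases) simp
  then show ?thesis by blast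
qed

text \<open>Prefix-freeness makes the parsing of the bits on a link unique, empty messages included.\<close>

lemma parsing_unique:
  assumes pf: "\<And>l t h. prefix_free (cd l t h)"
    and "coded lk cd l \<omega> t" "coded lk cd l \<omega>' t"
    and "prefix (concat (seq_hist lk l \<omega> t)) (concat (seq_hist lk l \<omega>' t)) \<or>
         prefix (concat (seq_hist lk l \<omega>' t)) (concat (seq_hist lk l \<omega> t))"
  shows "\<forall>i<t. lk i = l \<longrightarrow> \<omega> i = \<omega>' i"
  using assms(2-)
proof (induction t)
  case (Suc t)
  have c: "coded lk cd l \<omega> t" "coded lk cd l \<omega>' t" using Suc.prems(1,2) by (auto intro: coded_mono)
  \<comment> \<open>Comparability in place of equality carries the induction: even if the complete
    strings agree, their parts before round \<open>t\<close> are at first only known to be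
    comparable.\<close>
  have IH: "\<forall>i<t. lk i = l \<longrightarrow> \<omega> i = \<omega>' i"
    using Suc.IH[OF c] prefix_comparable_appendD Suc.prems(3) unfolding concat_seq_hist_Suc by blast
  have h: "seq_hist lk l \<omega> t = seq_hist lk l \<omega>' t" using IH by (intro seq_hist_cong) auto
  show ?case
  proof (cases "lk t = l")
    case True
    have "\<omega> t \<in> cd l t (seq_hist lk l \<omega> t)" "\<omega>' t \<in> cd l t (seq_hist lk l \<omega> t)"
      using Suc.prems(1,2) True h by (auto simp: coded_def)
    moreover have "prefix (\<omega> t) (\<omega>' t) \<or> prefix (\<omega>' t) (\<omega> t)"
      using Suc.prems(3) unfolding concat_seq_hist_Suc h using True by simp
    ultimately have "\<omega> t = \<omega>' t" using pf unfolding prefix_free_def by metis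
    then show ?thesis using IH by (auto simp: less_Suc_eq)
  qed (use IH in \<open>auto simp: less_Suc_eq\<close>)
qed simp

lemma parsing_unique_hist:
  assumes "\<And>l t h. prefix_free (cd l t h)" "coded lk cd l \<omega> t" "coded lk cd l \<omega>' t"
    "concat (seq_hist lk l \<omega> t) = concat (seq_hist lk l \<omega>' t)"
  shows "seq_hist lk l \<omega> t = seq_hist lk l \<omega>' t"
  using parsing_unique[OF assms(1-3)] assms(4) by (intro seq_hist_cong) auto

lemma complete_parse: "m \<in> transcripts lk cd l \<Longrightarrow> completes lk cd l (parse lk cd l m) m"
  unfolding transcripts_def parse_def using someI_ex[of "\<lambda>\<omega>. completes lk cd l \<omega> m"] by simp

lemma coded_parse: "m \<in> transcripts lk cd l \<Longrightarrow> coded lk cd l (parse lk cd l m) t"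
  using complete_parse unfolding completes_def by blast

lemma seq_hist_comb:
  "seq_hist lk L12 (comb lk cd a b c) t = seq_hist lk L12 (parse lk cd L12 a) t"
  "seq_hist lk L23 (comb lk cd a b c) t = seq_hist lk L23 (parse lk cd L23 b) t"
  "seq_hist lk L31 (comb lk cd a b c) t = seq_hist lk L31 (parse lk cd L31 c) t"
  by (auto intro!: seq_hist_cong simp: comb_def)

lemma coded_comb:
  assumes "a \<in> transcripts lk cd L12" "b \<in> transcripts lk cd L23" "c \<in> transcripts lk cd L31"
  shows "coded lk cd l (comb lk cd a b c) t"
proof -
  have "coded lk cd L12 (comb lk cd a b c) t"
    by (rule coded_cong[of t lk _ "parse lk cd L12 a"])
       (simp_all add: comb_def coded_parse assms)
  moreover have "coded lk cd L23 (comb lk cd a b c) t"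
    by (rule coded_cong[of t lk _ "parse lk cd L23 b"])
       (simp_all add: comb_def coded_parse assms)
  moreover have "coded lk cd L31 (comb lk cd a b c) t"
    by (rule coded_cong[of t lk _ "parse lk cd L31 c"])
       (simp_all add: comb_def coded_parse assms)
  ultimately show ?thesis by (cases l) auto
qed

lemma eventually_parse:
  assumes "m \<in> transcripts lk cd l"
  shows "\<forall>\<^sub>F t in sequentially. concat (seq_hist lk l (parse lk cd l m) t) = m \<and>
    (\<forall>t'\<ge>t. lk t' = l \<longrightarrow> cd l t' (seq_hist lk l (parse lk cd l m) t) = {[]})"
proof -
  obtain T where T: "\<forall>t\<ge>T. seq_hist lk l (parse lk cd l m) t = seq_hist lk l (parse lk cd l m) T \<and>
      concat (seq_hist lk l (parse lk cd l m) t) = m \<and>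
        (lk t = l \<longrightarrow> cd l t (seq_hist lk l (parse lk cd l m) t) = {[]})"
    using complete_parse[OF assms] unfolding completes_def by blast
  show ?thesis
    unfolding eventually_sequentially
  proof (intro exI[of _ T] allI impI conjI)
    fix t t' assume "T \<le> t" "t \<le> t'" "lk t' = l"
    then have "T \<le> t'" by simp
    then show "cd l t' (seq_hist lk l (parse lk cd l m) t) = {[]}"
      using T \<open>T \<le> t\<close> \<open>lk t' = l\<close> by metis
  qed (use T in blast)
qed

section \<open>Law of the run after finitely many rounds\<close>

lemma wf_prefix_free: "wf_protocol P \<Longrightarrow> prefix_free (code P l t h)"
  by (simp add: wf_protocol_def)

lemma wf_sender_kernel:
  "wf_protocol P \<Longrightarrow> m \<in> set_pmf (sender_kernel P t x y s) \<Longrightarrow> m \<in> code P (cur_link P t) t (hist_of (cur_link P t) s)"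
  unfolding wf_protocol_def by blast

lemma run_support:
  assumes wf: "wf_protocol P" and "s \<in> set_pmf (run P t x y)"
  shows "\<exists>\<omega>. seq_state (cur_link P) \<omega> t = s \<and> (\<forall>l. coded (cur_link P) (code P) l \<omega> t)"
  using assms(2)
proof (induction t arbitrary: s)
  case 0
  then show ?case by (auto simp: seq_state_def coded_def)
next
  case (Suc t)
  let ?lk = "cur_link P"
  obtain s0 m where s0: "s0 \<in> set_pmf (run P t x y)" "m \<in> set_pmf (sender_kernel P t x y s0)"
    "s = app_msg (?lk t) m s0"
    using Suc.prems by (auto simp: step_def)
  obtain \<omega> where \<omega>: "seq_state ?lk \<omega> t = s0" "\<forall>l. coded ?lk (code P) l \<omega> t" using Suc.IH s0(1) by blast
  let ?w = "fun_upd \<omega> t m"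
  have h: "seq_hist ?lk l ?w i = seq_hist ?lk l \<omega> i" if "i \<le> t" for l i
    using that by (intro seq_hist_cong) auto
  have "seq_state ?lk ?w t = s0" using \<omega>(1) h by (simp add: seq_state_def)
  then have "seq_state ?lk ?w (Suc t) = s" by (simp add: seq_state_Suc s0(3))
  moreover have "coded ?lk (code P) l ?w (Suc t)" for l
    unfolding coded_def
  proof (intro allI impI)
    fix i assume i: "i < Suc t" "?lk i = l"
    show "?w i \<in> code P l i (seq_hist ?lk l ?w i)"
    proof (cases "i = t")
      case True
      have "m \<in> code P (?lk t) t (hist_of (?lk t) s0)" using wf_sender_kernel[OF wf s0(2)] .
      then show ?thesis using True i h[of t l] \<omega>(1) hist_of_seq_state[of l ?lk \<omega> t] by auto
    next
      case False
      then show ?thesis using \<omega>(2) i h[of i l] by (auto simp: coded_def)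
    qed
  qed
  ultimately show ?case by blast
qed

text \<open>Transcripts are bit strings while states are lists of messages. Unique parsing shows
  that passing to bits loses nothing at a fixed round.\<close>

lemma run_state_unique:
  assumes wf: "wf_protocol P" and s: "s \<in> set_pmf (run P t x y)"
    and \<omega>: "\<And>l. coded (cur_link P) (code P) l \<omega> t"
    and eq: "bits_of s = bits_of (seq_state (cur_link P) \<omega> t)"
  shows "s = seq_state (cur_link P) \<omega> t"
proof -
  obtain \<omega>' where \<omega>': "seq_state (cur_link P) \<omega>' t = s" "\<forall>l. coded (cur_link P) (code P) l \<omega>' t"
    using run_support[OF wf s] by blast
  show ?thesis
  proof (rule state_eqI)
    fix l
    have "concat (hist_of l s) = concat (hist_of l (seq_state (cur_link P) \<omega> t))"
      using eq by (cases l) (auto simp: bits_of_def)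
    then show "hist_of l s = hist_of l (seq_state (cur_link P) \<omega> t)"
      unfolding \<omega>'(1)[symmetric] hist_of_seq_state
      using \<omega>'(2) by (intro parsing_unique_hist[OF wf_prefix_free[OF wf] _ \<omega>]) auto
  qed
qed

text \<open>By unique parsing a state has only one predecessor of positive probability, so the sum
  over predecessors in \<open>bind_pmf\<close> has a single term.\<close>

lemma pmf_run:
  assumes wf: "wf_protocol P" and "\<And>l. coded (cur_link P) (code P) l \<omega> t"
  shows "pmf (run P t x y) (seq_state (cur_link P) \<omega> t) =
    (\<Prod>i<t. pmf (sender_kernel P i x y (seq_state (cur_link P) \<omega> i)) (\<omega> i))"
  using assms(2)
proof (induction t)
  case 0
  then show ?case by (simp add: seq_state_def)
next
  case (Suc t)
  let ?lk = "cur_link P" and ?s = "seq_state (cur_link P) \<omega> t" and ?s' = "seq_state (cur_link P) \<omega> (Suc t)"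
  have c: "coded ?lk (code P) l \<omega> t" for l using coded_mono[OF Suc.prems[of l]] by simp
  have pre: "s = ?s" if s: "s \<in> set_pmf (run P t x y)" and nz: "pmf (step P t x y s) ?s' \<noteq> 0" for s
  proof -
    have "?s' \<in> set_pmf (step P t x y s)" using nz by (simp add: set_pmf_iff)
    then obtain m where m: "m \<in> set_pmf (sender_kernel P t x y s)" "?s' = app_msg (?lk t) m s"
      by (auto simp: step_def)
    obtain \<omega>' where \<omega>': "seq_state ?lk \<omega>' t = s" "\<forall>l. coded ?lk (code P) l \<omega>' t"
      using run_support[OF wf s] by blast
    show ?thesis
    proof (rule state_eqI)
      fix l
      have "hist_of l (app_msg (?lk t) m s) = hist_of l (app_msg (?lk t) (\<omega> t) ?s)"
        using m(2) by (simp add: seq_state_Suc)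
      then have "concat (hist_of l (app_msg (?lk t) m s)) = concat (hist_of l (app_msg (?lk t) (\<omega> t) ?s))"
        by simp
      then have "concat (seq_hist ?lk l \<omega>' t) @ (if ?lk t = l then m else [])
         = concat (seq_hist ?lk l \<omega> t) @ (if ?lk t = l then \<omega> t else [])"
        unfolding \<omega>'(1)[symmetric] hist_of_app_msg by (auto split: if_splits)
      then have "prefix (concat (seq_hist ?lk l \<omega>' t)) (concat (seq_hist ?lk l \<omega> t)) \<or>
         prefix (concat (seq_hist ?lk l \<omega> t)) (concat (seq_hist ?lk l \<omega>' t))"
        by (rule prefix_comparable_appendD[OF disjI1[OF prefix_order.eq_refl]])
      then have "\<forall>i<t. ?lk i = l \<longrightarrow> \<omega>' i = \<omega> i"
        using \<omega>'(2) by (intro parsing_unique[OF wf_prefix_free[OF wf] _ c]) auto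
      then show "hist_of l s = hist_of l ?s"
        unfolding \<omega>'(1)[symmetric] hist_of_seq_state by (intro seq_hist_cong) auto
    qed
  qed
  have "pmf (run P (Suc t) x y) ?s' = (\<integral>s. pmf (step P t x y s) ?s' \<partial>run P t x y)"
    by (simp add: pmf_bind)
  also have "\<dots> = (\<Sum>s\<in>{?s}. pmf (step P t x y s) ?s' * pmf (run P t x y) s)"
    using pre by (intro integral_measure_pmf_real) auto
  also have "\<dots> = pmf (step P t x y ?s) ?s' * pmf (run P t x y) ?s" by simp
  also have "pmf (step P t x y ?s) ?s' = pmf (sender_kernel P t x y ?s) (\<omega> t)"
    unfolding step_def seq_state_Suc by (rule pmf_map_inj'[OF inj_app_msg])
  finally show ?case using Suc.IH[OF c] by (simp add: mult.commute)
qed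

section \<open>Law of the final state as a monotone limit\<close>

lemma terminated_Suc: "terminated P t s \<Longrightarrow> terminated P (Suc t) s"
  by (auto simp: terminated_def)

lemma step_terminated:
  assumes "wf_protocol P" "terminated P t s"
  shows "step P t x y s = return_pmf s"
proof -
  have "set_pmf (sender_kernel P t x y s) \<subseteq> {[]}"
    using wf_sender_kernel[OF assms(1), of _ t x y s] assms(2) by (auto simp: terminated_def)
  then have "sender_kernel P t x y s = return_pmf []" by (simp add: set_pmf_subset_singleton)
  moreover have "app_msg l [] s = s" for l by (cases s; cases l) auto
  ultimately show ?thesis by (simp add: step_def)
qed

definition stopped_prob :: "('x, 'y, 'z) protocol \<Rightarrow> 'x \<Rightarrow> 'y \<Rightarrow> nat \<Rightarrow> state \<Rightarrow> real" where
  "stopped_prob P x y t s = pmf (run P t x y) s * of_bool (terminated P t s)"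

text \<open>Terminated states are absorbing: every later code admits the empty message only.\<close>

lemma incseq_stopped_prob:
  assumes wf: "wf_protocol P" shows "incseq (\<lambda>t. stopped_prob P x y t s)"
proof (rule incseq_SucI)
  fix t
  show "stopped_prob P x y t s \<le> stopped_prob P x y (Suc t) s"
  proof (cases "terminated P t s")
    case True
    have "ennreal (pmf (run P t x y) s) = (\<integral>\<^sup>+s'. indicator {s} s' \<partial>run P t x y)"
      by (simp add: emeasure_pmf_single)
    also have "\<dots> \<le> (\<integral>\<^sup>+s'. ennreal (pmf (step P t x y s') s) \<partial>run P t x y)"
      by (rule nn_integral_mono) (simp add: indicator_def step_terminated[OF wf True])
    also have "\<dots> = ennreal (pmf (run P (Suc t) x y) s)" by (simp add: ennreal_pmf_bind)
    finally show ?thesis using True terminated_Suc[OF True] by (simp add: stopped_prob_def)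
  qed (simp add: stopped_prob_def)
qed

lemma final_prob_lim:
  assumes wf: "wf_protocol P"
  shows "(\<lambda>t. stopped_prob P x y t s) \<longlonglongrightarrow> final_prob P x y s"
proof -
  have eq: "stopped_prob P x y t s = measure_pmf.prob (run P t x y) {s'. s' = s \<and> terminated P t s'}" for t
  proof (cases "terminated P t s")
    case True
    then have e: "{s'. s' = s \<and> terminated P t s'} = {s}" by auto
    show ?thesis using True unfolding e by (simp add: stopped_prob_def measure_pmf_single)
  next
    case False
    then have e: "{s'. s' = s \<and> terminated P t s'} = {}" by auto
    show ?thesis using False unfolding e by (simp add: stopped_prob_def)
  qed
  have "bdd_above (range (\<lambda>t. stopped_prob P x y t s))"
    by (rule bdd_aboveI[of _ 1]) (auto simp: stopped_prob_def pmf_le_1)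
  from LIMSEQ_incseq_SUP[OF this incseq_stopped_prob[OF wf]]
  show ?thesis unfolding final_prob_def eq .
qed

lemma final_prob_nonneg: "wf_protocol P \<Longrightarrow> 0 \<le> final_prob P x y s"
  by (rule LIMSEQ_le_const[OF final_prob_lim]) (auto simp: stopped_prob_def)

lemma nsum_final_prob_lim:
  assumes wf: "wf_protocol P"
  shows "(\<lambda>t. ennreal (measure_pmf.prob (run P t x y) {s\<in>A. terminated P t s}))
     \<longlonglongrightarrow> nsum (\<lambda>s. ennreal (final_prob P x y s) * indicator A s)"
proof -
  have "ennreal (measure_pmf.prob (run P t x y) {s\<in>A. terminated P t s})
     = nsum (\<lambda>s. ennreal (stopped_prob P x y t s) * indicator A s)" for t
  proof -
    have "ennreal (measure_pmf.prob (run P t x y) {s\<in>A. terminated P t s})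
       = (\<integral>\<^sup>+s. indicator {s\<in>A. terminated P t s} s \<partial>run P t x y)"
      by (simp add: measure_pmf.emeasure_eq_measure)
    also have "\<dots> = nsum (\<lambda>s. ennreal (stopped_prob P x y t s) * indicator A s)"
      unfolding nn_integral_measure_pmf stopped_prob_def
      by (intro nn_integral_cong) (auto simp: indicator_def)
    finally show ?thesis .
  qed
  moreover have "(\<lambda>t. nsum (\<lambda>s. ennreal (stopped_prob P x y t s) * indicator A s))
     \<longlonglongrightarrow> nsum (\<lambda>s. ennreal (final_prob P x y s) * indicator A s)"
  proof (rule nn_integral_LIMSEQ)
    show "incseq (\<lambda>t s. ennreal (stopped_prob P x y t s) * indicator A s)"
      using incseq_stopped_prob[OF wf] by (auto simp: incseq_def le_fun_def intro!: mult_right_mono ennreal_leI)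
    show "(\<lambda>t. ennreal (stopped_prob P x y t s) * indicator A s) \<longlonglongrightarrow> ennreal (final_prob P x y s) * indicator A s" for s
      by (cases "s \<in> A") (simp_all add: tendsto_ennrealI[OF final_prob_lim[OF wf]])
  qed simp
  ultimately show ?thesis by simp
qed

definition final_pmf :: "('x, 'y, 'z) protocol \<Rightarrow> 'x \<Rightarrow> 'y \<Rightarrow> state pmf" where
  "final_pmf P x y = embed_pmf (final_prob P x y)"

text \<open>Almost sure termination is what keeps the total mass of the limits equal to 1.\<close>

lemma pmf_final_pmf:
  assumes wf: "wf_protocol P" and "terminates_as P x y"
  shows "pmf (final_pmf P x y) s = final_prob P x y s"
  unfolding final_pmf_def
proof (rule pmf_embed_pmf)
  have "(\<lambda>t. ennreal (measure_pmf.prob (run P t x y) {s\<in>UNIV. terminated P t s})) \<longlonglongrightarrow> ennreal 1"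
    using assms(2) unfolding terminates_as_def by (intro tendsto_ennrealI) simp
  from LIMSEQ_unique[OF this nsum_final_prob_lim[OF wf]]
  show "nsum (\<lambda>s. ennreal (final_prob P x y s)) = 1" by simp
qed (rule final_prob_nonneg[OF wf])

lemma prob_final_pmf_lim:
  assumes wf: "wf_protocol P" and "terminates_as P x y"
  shows "(\<lambda>t. measure_pmf.prob (run P t x y) {s\<in>A. terminated P t s}) \<longlonglongrightarrow> measure_pmf.prob (final_pmf P x y) A"
proof -
  have "nsum (\<lambda>s. ennreal (final_prob P x y s) * indicator A s) = ennreal (measure_pmf.prob (final_pmf P x y) A)"
    using assms by (simp add: pmf_final_pmf[symmetric] nn_integral_count_space_indicator[symmetric]
        nn_integral_pmf measure_pmf.emeasure_eq_measure)
  then show ?thesis using nsum_final_prob_lim[OF wf, of x y A] by simp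
qed

section \<open>Factorization of the transcript law\<close>

abbreviation link_transcripts :: "('x, 'y, 'z) protocol \<Rightarrow> link \<Rightarrow> msg set" where
  "link_transcripts P \<equiv> transcripts (cur_link P) (code P)"

abbreviation joint :: "('x, 'y, 'z) protocol \<Rightarrow> msg \<Rightarrow> msg \<Rightarrow> msg \<Rightarrow> nat \<Rightarrow> msg" where
  "joint P \<equiv> comb (cur_link P) (code P)"

definition valid :: "('x, 'y, 'z) protocol \<Rightarrow> msg \<Rightarrow> msg \<Rightarrow> msg \<Rightarrow> bool" where
  "valid P a b c \<longleftrightarrow> a \<in> link_transcripts P L12 \<and> b \<in> link_transcripts P L23 \<and> c \<in> link_transcripts P L31"

definition likelihood :: "('x, 'y, 'z) protocol \<Rightarrow> 'x \<Rightarrow> 'y \<Rightarrow> (nat \<Rightarrow> msg) \<Rightarrow> nat \<Rightarrow> real" where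
  "likelihood P x y \<omega> i = pmf (sender_kernel P i x y (seq_state (cur_link P) \<omega> i)) (\<omega> i)"

definition transcript_pmf :: "('x, 'y, 'z) protocol \<Rightarrow> 'x \<Rightarrow> 'y \<Rightarrow> (msg \<times> msg \<times> msg) pmf" where
  "transcript_pmf P x y = map_pmf bits_of (final_pmf P x y)"

lemma eventually_bits_of:
  assumes "valid P a b c"
  shows "\<forall>\<^sub>F t in sequentially. bits_of (seq_state (cur_link P) (joint P a b c) t) = (a, b, c) \<and>
    terminated P t (seq_state (cur_link P) (joint P a b c) t)"
proof -
  have "a \<in> link_transcripts P L12" "b \<in> link_transcripts P L23" "c \<in> link_transcripts P L31"
    using assms by (auto simp: valid_def)
  note ev = this[THEN eventually_parse]
  show ?thesis
    using ev
  proof eventually_elim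
    case (elim t)
    have "code P (cur_link P t') t' (hist_of (cur_link P t') (seq_state (cur_link P) (joint P a b c) t)) = {[]}"
      if "t \<le> t'" for t'
      using elim that by (cases "cur_link P t'") (simp_all add: seq_hist_comb)
    then show ?case using elim by (simp add: bits_of_def seq_hist_comb terminated_def)
  qed
qed

lemma coded_path: "valid P a b c \<Longrightarrow> coded (cur_link P) (code P) l (joint P a b c) t"
  unfolding valid_def by (intro coded_comb) auto

lemma prob_bits_of:
  assumes wf: "wf_protocol P" and v: "valid P a b c"
    and b: "bits_of (seq_state (cur_link P) (joint P a b c) t) = (a, b, c)"
  shows "pmf (map_pmf bits_of (run P t x y)) (a, b, c) = (\<Prod>i<t. likelihood P x y (joint P a b c) i)"
proof -
  let ?s = "seq_state (cur_link P) (joint P a b c) t"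
  have "measure_pmf.prob (run P t x y) (bits_of -` {(a, b, c)}) = measure_pmf.prob (run P t x y) {?s}"
  proof (rule measure_pmf.finite_measure_eq_AE)
    show "AE s in run P t x y. (s \<in> bits_of -` {(a, b, c)}) = (s \<in> {?s})"
      unfolding AE_measure_pmf_iff
    proof
      fix s assume s: "s \<in> set_pmf (run P t x y)"
      show "(s \<in> bits_of -` {(a, b, c)}) = (s \<in> {?s})"
        using run_state_unique[OF wf s coded_path[OF v]] b by (cases "bits_of s = (a, b, c)") auto
    qed
  qed simp_all
  then show ?thesis
    using pmf_run[OF wf coded_path[OF v], of t x y]
    by (simp add: pmf_map measure_pmf_single likelihood_def)
qed

text \<open>Along the path parsed from \<open>a\<close>, \<open>b\<close>, \<open>c\<close> the bits
  are eventually these strings and the state is terminated. From then on, having stopped with these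
  bits means being in the state of the path, whose probability is the product.\<close>

lemma likelihood_tendsto:
  assumes wf: "wf_protocol P" and trm: "terminates_as P x y" and v: "valid P a b c"
  shows "(\<lambda>t. \<Prod>i<t. likelihood P x y (joint P a b c) i) \<longlonglongrightarrow> pmf (transcript_pmf P x y) (a, b, c)"
proof -
  let ?s = "\<lambda>t. seq_state (cur_link P) (joint P a b c) t"
  have "(\<lambda>t. measure_pmf.prob (run P t x y) {s\<in>bits_of -` {(a, b, c)}. terminated P t s})
     \<longlonglongrightarrow> measure_pmf.prob (final_pmf P x y) (bits_of -` {(a, b, c)})"
    by (rule prob_final_pmf_lim[OF wf trm])
  moreover have "\<forall>\<^sub>F t in sequentially.
      measure_pmf.prob (run P t x y) {s\<in>bits_of -` {(a, b, c)}. terminated P t s}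
      = (\<Prod>i<t. likelihood P x y (joint P a b c) i)"
    using eventually_bits_of[OF v]
  proof eventually_elim
    case (elim t)
    have "measure_pmf.prob (run P t x y) {s\<in>bits_of -` {(a, b, c)}. terminated P t s}
      = measure_pmf.prob (run P t x y) (bits_of -` {(a, b, c)})"
    proof (rule measure_pmf.finite_measure_eq_AE)
      show "AE s in run P t x y. (s \<in> {s\<in>bits_of -` {(a, b, c)}. terminated P t s}) = (s \<in> bits_of -` {(a, b, c)})"
        unfolding AE_measure_pmf_iff
      proof
        fix s assume s: "s \<in> set_pmf (run P t x y)"
        show "(s \<in> {s\<in>bits_of -` {(a, b, c)}. terminated P t s}) = (s \<in> bits_of -` {(a, b, c)})"
          using run_state_unique[OF wf s coded_path[OF v]] elim by (cases "bits_of s = (a, b, c)") simp_all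
      qed
    qed simp_all
    then show ?case using prob_bits_of[OF wf v conjunct1[OF elim], of x y] by (simp add: pmf_map)
  qed
  ultimately show ?thesis
    unfolding transcript_pmf_def pmf_map by (rule Lim_transform_eventually)
qed

lemma terminated_transcript:
  assumes wf: "wf_protocol P" and s: "s \<in> set_pmf (run P t x y)" and trm: "terminated P t s"
  shows "concat (hist_of l s) \<in> link_transcripts P l"
proof -
  let ?lk = "cur_link P"
  obtain \<omega> where \<omega>: "seq_state ?lk \<omega> t = s" "\<forall>l. coded ?lk (code P) l \<omega> t"
    using run_support[OF wf s] by blast
  \<comment> \<open>A terminated run is continued by empty messages, the only ones that its codes
    still allow.\<close>
  define \<omega>' where "\<omega>' = (\<lambda>i. if i < t then \<omega> i else [])"
  have h: "seq_hist ?lk l \<omega>' i = seq_hist ?lk l \<omega> i" if "i \<le> t" for i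
    using that by (intro seq_hist_cong) (auto simp: \<omega>'_def)
  have h2: "seq_hist ?lk l \<omega>' i = hist_of l s" if "t \<le> i" for i
    using that
  proof (induction i rule: dec_induct)
    case base
    then show ?case using h[of t] \<omega>(1) by auto
  qed (auto simp: \<omega>'_def)
  have c: "code P l i (hist_of l s) = {[]}" if "t \<le> i" "?lk i = l" for i
    using trm that by (auto simp: terminated_def)
  have "completes ?lk (code P) l \<omega>' (concat (hist_of l s))"
    unfolding completes_def
  proof (intro conjI allI exI[of _ t] impI)
    fix i
    have "\<omega>' j \<in> code P l j (seq_hist ?lk l \<omega>' j)" if "?lk j = l" for j
    proof (cases "j < t")
      case True
      then show ?thesis using \<omega>(2) that h[of j] by (auto simp: coded_def \<omega>'_def)
    next
      case False
      then show ?thesis using c[of j] h2[of j] that by (simp add: \<omega>'_def)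
    qed
    then show "coded ?lk (code P) l \<omega>' i" by (auto simp: coded_def)
  qed (use h2 c in auto)
  then show ?thesis by (auto simp: transcripts_def)
qed

lemma transcript_pmf_eq_0:
  assumes wf: "wf_protocol P" and trm: "terminates_as P x y" and v: "\<not> valid P a b c"
  shows "pmf (transcript_pmf P x y) (a, b, c) = 0"
proof -
  have "measure_pmf.prob (run P t x y) {s\<in>bits_of -` {(a, b, c)}. terminated P t s} = measure_pmf.prob (run P t x y) {}" for t
  proof (rule measure_pmf.finite_measure_eq_AE)
    show "AE s in run P t x y. (s \<in> {s\<in>bits_of -` {(a, b, c)}. terminated P t s}) = (s \<in> {})"
      unfolding AE_measure_pmf_iff
    proof
      fix s assume s: "s \<in> set_pmf (run P t x y)"
      show "(s \<in> {s\<in>bits_of -` {(a, b, c)}. terminated P t s}) = (s \<in> {})"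
        using terminated_transcript[OF wf s] v by (auto simp: valid_def bits_of_def)
    qed
  qed simp_all
  then have "(\<lambda>t. 0) \<longlonglongrightarrow> measure_pmf.prob (final_pmf P x y) (bits_of -` {(a, b, c)})"
    using prob_final_pmf_lim[OF wf trm, of "bits_of -` {(a, b, c)}"] by simp
  then have "measure_pmf.prob (final_pmf P x y) (bits_of -` {(a, b, c)}) = 0"
    by (simp add: LIMSEQ_const_iff)
  then show ?thesis by (simp add: transcript_pmf_def pmf_map)
qed

text \<open>Fatou's lemma. Termination is not assumed because this serves the hybrid protocols,
  which may run forever and lose mass in the limit.\<close>

lemma nsum_likelihood_le_1:
  assumes wf: "wf_protocol P"
    and r: "\<And>a b c. r (a, b, c) \<noteq> 0 \<Longrightarrow> valid P a b c \<and>
      (\<lambda>t. \<Prod>i<t. likelihood P x y (joint P a b c) i) \<longlonglongrightarrow> r (a, b, c)"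
  shows "nsum (\<lambda>m. ennreal (r m)) \<le> 1"
proof -
  let ?g = "\<lambda>t m. ennreal (pmf (map_pmf bits_of (run P t x y)) m)"
  have "ennreal (r m) \<le> liminf (\<lambda>t. ?g t m)" for m
  proof (cases "r m = 0")
    case False
    obtain a b c where m: "m = (a, b, c)" by (metis prod_cases3)
    have v: "valid P a b c" and lim: "(\<lambda>t. \<Prod>i<t. likelihood P x y (joint P a b c) i) \<longlonglongrightarrow> r m"
      using r False m by auto
    have "\<forall>\<^sub>F t in sequentially. (\<Prod>i<t. likelihood P x y (joint P a b c) i) = pmf (map_pmf bits_of (run P t x y)) m"
      using eventually_bits_of[OF v] unfolding m
      by eventually_elim (simp add: prob_bits_of[OF wf v])
    from Lim_transform_eventually[OF lim this]
    have "(\<lambda>t. ?g t m) \<longlonglongrightarrow> ennreal (r m)" by (rule tendsto_ennrealI)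
    then show ?thesis by (simp add: lim_imp_Liminf)
  qed simp
  then have "nsum (\<lambda>m. ennreal (r m)) \<le> nsum (\<lambda>m. liminf (\<lambda>t. ?g t m))" by (rule nsum_mono)
  also have "\<dots> \<le> liminf (\<lambda>t. nsum (?g t))" by (rule nn_integral_liminf) simp
  also have "\<dots> = 1" by (simp add: nsum_pmf Liminf_const)
  finally show ?thesis .
qed

section \<open>Weights of the parties as infinite products\<close>

definition limprod :: "(nat \<Rightarrow> real) \<Rightarrow> real" where
  "limprod u = lim (\<lambda>t. \<Prod>i<t. u i)"

lemma limprod_tendsto:
  assumes "\<And>i. 0 \<le> u i" "\<And>i. u i \<le> 1"
  shows "(\<lambda>t. \<Prod>i<t. u i) \<longlonglongrightarrow> limprod u"
proof -
  have "decseq (\<lambda>t. \<Prod>i<t. u i)"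
    using assms by (intro decseq_SucI) (simp add: mult_left_le prod_nonneg)
  moreover have "0 \<le> (\<Prod>i<t. u i)" for t using assms by (intro prod_nonneg) auto
  ultimately obtain L where "(\<lambda>t. \<Prod>i<t. u i) \<longlonglongrightarrow> L"
    using decseq_convergent[of "\<lambda>t. \<Prod>i<t. u i" 0] by blast
  then show ?thesis unfolding limprod_def by (simp add: limI)
qed

lemma limprod_nonneg:
  assumes "\<And>i. 0 \<le> u i" "\<And>i. u i \<le> 1"
  shows "0 \<le> limprod u"
  by (rule LIMSEQ_le_const[OF limprod_tendsto[OF assms]]) (auto intro: prod_nonneg assms)

definition likA :: "('x, 'y, 'z) protocol \<Rightarrow> 'x \<Rightarrow> (nat \<Rightarrow> msg) \<Rightarrow> nat \<Rightarrow> real" where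
  "likA P x \<omega> i = (if fst (sched P i) = Alice
     then pmf (kA P i x (seq_hist (cur_link P) L12 \<omega> i) (seq_hist (cur_link P) L31 \<omega> i)) (\<omega> i) else 1)"

definition likB :: "('x, 'y, 'z) protocol \<Rightarrow> 'y \<Rightarrow> (nat \<Rightarrow> msg) \<Rightarrow> nat \<Rightarrow> real" where
  "likB P y \<omega> i = (if fst (sched P i) = Bob
     then pmf (kB P i y (seq_hist (cur_link P) L12 \<omega> i) (seq_hist (cur_link P) L23 \<omega> i)) (\<omega> i) else 1)"

definition likC :: "('x, 'y, 'z) protocol \<Rightarrow> (nat \<Rightarrow> msg) \<Rightarrow> nat \<Rightarrow> real" where
  "likC P \<omega> i = (if fst (sched P i) = Charlie
     then pmf (kC P i (seq_hist (cur_link P) L23 \<omega> i) (seq_hist (cur_link P) L31 \<omega> i)) (\<omega> i) else 1)"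

lemma likelihood_split: "likelihood P x y \<omega> i = likA P x \<omega> i * likB P y \<omega> i * likC P \<omega> i"
  by (cases "fst (sched P i)") (simp_all add: likelihood_def sender_kernel_def likA_def likB_def likC_def)

lemma lik_bounds:
  "0 \<le> likA P x \<omega> i" "likA P x \<omega> i \<le> 1" "0 \<le> likB P y \<omega> i" "likB P y \<omega> i \<le> 1"
  "0 \<le> likC P \<omega> i" "likC P \<omega> i \<le> 1"
  by (auto simp: likA_def likB_def likC_def pmf_le_1)

text \<open>The dummy \<open>[]\<close> for link 23 is harmless, since Alice's factors never look at
  that link (\<open>lik_path\<close>). The indicator makes the weight vanish on strings that have no
  parse, where \<open>parse\<close> is an arbitrary choice.\<close>

definition weightA :: "('x, 'y, 'z) protocol \<Rightarrow> 'x \<Rightarrow> msg \<Rightarrow> msg \<Rightarrow> real" where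
  "weightA P x a c = of_bool (a \<in> link_transcripts P L12 \<and> c \<in> link_transcripts P L31) * limprod (likA P x (joint P a [] c))"

definition weightB :: "('x, 'y, 'z) protocol \<Rightarrow> 'y \<Rightarrow> msg \<Rightarrow> msg \<Rightarrow> real" where
  "weightB P y a b = of_bool (a \<in> link_transcripts P L12 \<and> b \<in> link_transcripts P L23) * limprod (likB P y (joint P a b []))"

definition weightC :: "('x, 'y, 'z) protocol \<Rightarrow> msg \<Rightarrow> msg \<Rightarrow> real" where
  "weightC P b c = of_bool (b \<in> link_transcripts P L23 \<and> c \<in> link_transcripts P L31) * limprod (likC P (joint P [] b c))"

lemma weight_nonneg: "0 \<le> weightA P x a c" "0 \<le> weightB P y a b" "0 \<le> weightC P b c"
  by (simp_all add: weightA_def weightB_def weightC_def limprod_nonneg lik_bounds)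

lemma sender_links:
  assumes "wf_protocol P"
  shows "fst (sched P i) = Alice \<Longrightarrow> cur_link P i = L12 \<or> cur_link P i = L31"
    "fst (sched P i) = Bob \<Longrightarrow> cur_link P i = L12 \<or> cur_link P i = L23"
    "fst (sched P i) = Charlie \<Longrightarrow> cur_link P i = L23 \<or> cur_link P i = L31"
proof -
  have "fst (sched P i) \<noteq> snd (sched P i)" using assms by (simp add: wf_protocol_def)
  then show "fst (sched P i) = Alice \<Longrightarrow> cur_link P i = L12 \<or> cur_link P i = L31"
    "fst (sched P i) = Bob \<Longrightarrow> cur_link P i = L12 \<or> cur_link P i = L23"
    "fst (sched P i) = Charlie \<Longrightarrow> cur_link P i = L23 \<or> cur_link P i = L31"
    by (cases "snd (sched P i)"; simp add: cur_link_def)+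
qed

lemma lik_path:
  assumes "wf_protocol P"
  shows "likA P x (joint P a b c) = likA P x (joint P a [] c)"
    "likB P y (joint P a b c) = likB P y (joint P a b [])"
    "likC P (joint P a b c) = likC P (joint P [] b c)"
  by (auto dest!: sender_links[OF assms] simp: fun_eq_iff likA_def likB_def likC_def seq_hist_comb comb_def split: link.splits)

lemma lik_tendsto:
  assumes "wf_protocol P" "valid P a b c"
  shows "(\<lambda>t. \<Prod>i<t. likA P x (joint P a b c) i) \<longlonglongrightarrow> weightA P x a c"
    "(\<lambda>t. \<Prod>i<t. likB P y (joint P a b c) i) \<longlonglongrightarrow> weightB P y a b"
    "(\<lambda>t. \<Prod>i<t. likC P (joint P a b c) i) \<longlonglongrightarrow> weightC P b c"
  using assms(2) limprod_tendsto[where u = "likA P x (joint P a [] c)", OF lik_bounds(1,2)]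
    limprod_tendsto[where u = "likB P y (joint P a b [])", OF lik_bounds(3,4)]
    limprod_tendsto[where u = "likC P (joint P [] b c)", OF lik_bounds(5,6)]
  unfolding lik_path(1)[OF assms(1), of x a b c] lik_path(2)[OF assms(1), of y a b c]
    lik_path(3)[OF assms(1), of a b c] weightA_def weightB_def weightC_def valid_def by simp_all

lemma transcript_factor:
  assumes wf: "wf_protocol P" and trm: "terminates_as P x y"
  shows "pmf (transcript_pmf P x y) (a, b, c) = weightA P x a c * weightB P y a b * weightC P b c"
proof (cases "valid P a b c")
  case True
  have "(\<lambda>t. \<Prod>i<t. likelihood P x y (joint P a b c) i) \<longlonglongrightarrow> weightA P x a c * weightB P y a b * weightC P b c"
    unfolding likelihood_split prod.distrib by (intro tendsto_mult lik_tendsto[OF wf True])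
  with likelihood_tendsto[OF wf trm True] show ?thesis by (rule LIMSEQ_unique)
next
  case False
  then show ?thesis using transcript_pmf_eq_0[OF wf trm False]
    by (auto simp: valid_def weightA_def weightB_def weightC_def)
qed

text \<open>The value on histories that do not occur is arbitrary, but has to respect the code.\<close>

definition link_kernel :: "('x, 'y, 'z) protocol \<Rightarrow> 'x \<Rightarrow> 'y \<Rightarrow> link \<Rightarrow> nat \<Rightarrow> hist \<Rightarrow> msg pmf" where
  "link_kernel P x0 y0 l t h = (if set_pmf (run P t x0 y0) \<inter> {s. hist_of l s = h} \<noteq> {}
     then bind_pmf (cond_pmf (run P t x0 y0) {s. hist_of l s = h}) (sender_kernel P t x0 y0)
     else sender_kernel P t x0 y0 (h, h, h))"

lemma link_kernel_code:
  assumes "wf_protocol P"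
  shows "set_pmf (link_kernel P x0 y0 (cur_link P t) t h) \<subseteq> code P (cur_link P t) t h"
proof -
  \<comment> \<open>The default state \<open>(h, h, h)\<close> of \<open>link_kernel\<close> has
    past \<open>h\<close> on every link, so well-formedness puts its messages into the right
    code.\<close>
  have h: "hist_of l (h, h, h) = h" for l by (cases l) auto
  show ?thesis
  proof
    fix m assume m: "m \<in> set_pmf (link_kernel P x0 y0 (cur_link P t) t h)"
    have "\<exists>s. hist_of (cur_link P t) s = h \<and> m \<in> set_pmf (sender_kernel P t x0 y0 s)"
    proof (cases "set_pmf (run P t x0 y0) \<inter> {s. hist_of (cur_link P t) s = h} \<noteq> {}")
      case True
      then show ?thesis using m by (auto simp: link_kernel_def set_cond_pmf)
    next
      case False
      then show ?thesis using m h by (auto simp: link_kernel_def simp del: split_paired_Ex)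
    qed
    then show "m \<in> code P (cur_link P t) t h" using wf_sender_kernel[OF assms] by blast
  qed
qed

text \<open>Conditional probability of the message of round \<open>i\<close> given only the past of
  link \<open>l\<close>, in the run on the reference inputs \<open>x0\<close>,
  \<open>y0\<close>.\<close>

definition link_lik :: "('x, 'y, 'z) protocol \<Rightarrow> 'x \<Rightarrow> 'y \<Rightarrow> link \<Rightarrow> (nat \<Rightarrow> msg) \<Rightarrow> nat \<Rightarrow> real" where
  "link_lik P x0 y0 l \<omega> i = (if cur_link P i = l
     then pmf (link_kernel P x0 y0 l i (seq_hist (cur_link P) l \<omega> i)) (\<omega> i) else 1)"

text \<open>Chain rule for a single link: given the link's own past, its next message has the law
  \<open>link_kernel\<close>, the average of the sender's kernel over everything that the link does
  not show.\<close>

lemma prob_hist_le: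
  assumes wf: "wf_protocol P" and "coded (cur_link P) (code P) l \<omega> t"
  shows "pmf (map_pmf (hist_of l) (run P t x0 y0)) (seq_hist (cur_link P) l \<omega> t) \<le> (\<Prod>i<t. link_lik P x0 y0 l \<omega> i)"
  using assms(2)
proof (induction t)
  case 0
  then show ?case by (simp add: pmf_le_1)
next
  case (Suc t)
  let ?lk = "cur_link P" and ?R = "run P t x0 y0"
  let ?h = "seq_hist (cur_link P) l \<omega> t" and ?h' = "seq_hist (cur_link P) l \<omega> (Suc t)"
  let ?E = "{s. hist_of l s = ?h}"
  have c: "coded ?lk (code P) l \<omega> t" using coded_mono[OF Suc.prems] by simp
  have R: "map_pmf (hist_of l) (run P (Suc t) x0 y0) = bind_pmf ?R (\<lambda>s. map_pmf (\<lambda>m. hist_of l (app_msg (?lk t) m s)) (sender_kernel P t x0 y0 s))"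
    by (simp add: map_bind_pmf step_def pmf.map_comp o_def)
  have "pmf (map_pmf (hist_of l) (run P (Suc t) x0 y0)) ?h' \<le> pmf (map_pmf (hist_of l) ?R) ?h * link_lik P x0 y0 l \<omega> t"
  proof (cases "?lk t = l")
    case False
    then have "map_pmf (hist_of l) (run P (Suc t) x0 y0) = map_pmf (hist_of l) ?R"
      unfolding R hist_of_app_msg by (simp add: map_pmf_const map_pmf_def[symmetric] o_def)
    then show ?thesis using False by (simp add: link_lik_def)
  next
    case True
    have pt: "ennreal (pmf (map_pmf (\<lambda>m. hist_of l (app_msg (?lk t) m s)) (sender_kernel P t x0 y0 s)) ?h')
       \<le> indicator ?E s * ennreal (pmf (sender_kernel P t x0 y0 s) (\<omega> t))"
      if s: "s \<in> set_pmf ?R" for s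
    proof (cases "?h' \<in> (\<lambda>m. hist_of l (app_msg (?lk t) m s)) ` set_pmf (sender_kernel P t x0 y0 s)")
      case False
      then have "pmf (map_pmf (\<lambda>m. hist_of l (app_msg (?lk t) m s)) (sender_kernel P t x0 y0 s)) ?h' = 0"
        by (rule pmf_map_outside)
      then show ?thesis by simp
    next
      case img: True
      then obtain m where m: "m \<in> set_pmf (sender_kernel P t x0 y0 s)" "?h' = hist_of l (app_msg (?lk t) m s)" by auto
      obtain \<omega>' where \<omega>': "seq_state ?lk \<omega>' t = s" "\<forall>l. coded ?lk (code P) l \<omega>' t"
        using run_support[OF wf s] by blast
      \<comment> \<open>An empty \<open>\<omega> t\<close> leaves the history unchanged, so
        \<open>?h'\<close> alone does not reveal whether a message was appended in this round.
        Unique parsing of the bits does, and forces \<open>s\<close> to have past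
        \<open>?h\<close>.\<close>
      have "concat ?h' = concat (hist_of l (app_msg (?lk t) m s))" using m(2) by simp
      then have "concat (seq_hist ?lk l \<omega>' t) @ m = concat ?h @ \<omega> t"
        unfolding \<omega>'(1)[symmetric] hist_of_app_msg concat_seq_hist_Suc using True by (auto split: if_splits)
      then have "prefix (concat (seq_hist ?lk l \<omega>' t)) (concat ?h) \<or> prefix (concat ?h) (concat (seq_hist ?lk l \<omega>' t))"
        by (rule prefix_comparable_appendD[OF disjI1[OF prefix_order.eq_refl]])
      then have "\<forall>i<t. ?lk i = l \<longrightarrow> \<omega>' i = \<omega> i"
        using \<omega>'(2) by (intro parsing_unique[OF wf_prefix_free[OF wf] _ c]) auto
      then have "seq_hist ?lk l \<omega>' t = ?h" by (intro seq_hist_cong) auto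
      then have E: "hist_of l s = ?h" unfolding \<omega>'(1)[symmetric] hist_of_seq_state .
      have inj: "inj (\<lambda>m. hist_of l (app_msg (?lk t) m s))"
        unfolding hist_of_app_msg using True by (auto simp: inj_on_def split: if_splits)
      have "?h' = hist_of l (app_msg (?lk t) (\<omega> t) s)" using True E by (simp add: hist_of_app_msg)
      then have "pmf (map_pmf (\<lambda>m. hist_of l (app_msg (?lk t) m s)) (sender_kernel P t x0 y0 s)) ?h'
        = pmf (sender_kernel P t x0 y0 s) (\<omega> t)"
        using pmf_map_inj'[OF inj] by simp
      then show ?thesis using E by simp
    qed
    have "ennreal (pmf (map_pmf (hist_of l) (run P (Suc t) x0 y0)) ?h')
       \<le> (\<integral>\<^sup>+s. indicator ?E s * ennreal (pmf (sender_kernel P t x0 y0 s) (\<omega> t)) \<partial>?R)"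
      unfolding R ennreal_pmf_bind using pt by (intro nn_integral_mono_AE) (auto simp: AE_measure_pmf_iff)
    also have "\<dots> = ennreal (pmf (map_pmf (hist_of l) ?R) ?h * link_lik P x0 y0 l \<omega> t)"
    proof (cases "set_pmf ?R \<inter> ?E = {}")
      case empty: True
      then have "AE s in ?R. indicator ?E s * ennreal (pmf (sender_kernel P t x0 y0 s) (\<omega> t)) = 0"
        by (auto simp: AE_measure_pmf_iff indicator_def)
      then have "(\<integral>\<^sup>+s. indicator ?E s * ennreal (pmf (sender_kernel P t x0 y0 s) (\<omega> t)) \<partial>?R) = 0"
        by (simp add: nn_integral_0_iff_AE)
      moreover have "pmf (map_pmf (hist_of l) ?R) ?h = 0"
        using empty by (intro pmf_map_outside) auto
      ultimately show ?thesis by simp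
    next
      case ne: False
      have pE: "pmf (map_pmf (hist_of l) ?R) ?h = measure_pmf.prob ?R ?E"
        by (simp add: pmf_map vimage_def)
      obtain s where s: "s \<in> set_pmf ?R" "hist_of l s = ?h" using ne by blast
      have "?h \<in> hist_of l ` set_pmf ?R" unfolding s(2)[symmetric] using s(1) by (rule imageI)
      then have "?h \<in> set_pmf (map_pmf (hist_of l) ?R)" by simp
      then have "pmf (map_pmf (hist_of l) ?R) ?h \<noteq> 0" unfolding set_pmf_iff .
      then have pos: "0 < measure_pmf.prob ?R ?E" using pE by (simp add: zero_less_measure_iff)
      have "ennreal (link_lik P x0 y0 l \<omega> t) = (\<integral>\<^sup>+s. ennreal (pmf (sender_kernel P t x0 y0 s) (\<omega> t)) \<partial>cond_pmf ?R ?E)"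
        using True ne by (simp add: link_lik_def link_kernel_def ennreal_pmf_bind)
      also have "\<dots> = nsum (\<lambda>s. ennreal (pmf (cond_pmf ?R ?E) s) * ennreal (pmf (sender_kernel P t x0 y0 s) (\<omega> t)))"
        by (rule nn_integral_measure_pmf)
      finally have "ennreal (measure_pmf.prob ?R ?E) * ennreal (link_lik P x0 y0 l \<omega> t)
        = nsum (\<lambda>s. ennreal (measure_pmf.prob ?R ?E) * (ennreal (pmf (cond_pmf ?R ?E) s) * ennreal (pmf (sender_kernel P t x0 y0 s) (\<omega> t))))"
        by (simp add: nsum_cmult)
      also have "\<dots> = nsum (\<lambda>s. ennreal (pmf ?R s) * (indicator ?E s * ennreal (pmf (sender_kernel P t x0 y0 s) (\<omega> t))))"
        using pos by (intro nn_integral_cong) (auto simp: pmf_cond[OF ne] indicator_def ennreal_mult'[symmetric])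
      also have "\<dots> = (\<integral>\<^sup>+s. indicator ?E s * ennreal (pmf (sender_kernel P t x0 y0 s) (\<omega> t)) \<partial>?R)"
        by (rule nn_integral_measure_pmf[symmetric])
      finally show ?thesis unfolding pE by (simp add: ennreal_mult' link_lik_def)
    qed
    finally show ?thesis by (simp add: link_lik_def ennreal_le_iff split: if_splits)
  qed
  also have "\<dots> \<le> (\<Prod>i<t. link_lik P x0 y0 l \<omega> i) * link_lik P x0 y0 l \<omega> t"
    using Suc.IH[OF c] by (intro mult_right_mono) (auto simp: link_lik_def)
  finally show ?case by simp
qed

section \<open>Protocols with oblivious senders\<close>

lemma link_lik_bounds: "0 \<le> link_lik P x0 y0 l \<omega> i" "link_lik P x0 y0 l \<omega> i \<le> 1"
  by (auto simp: link_lik_def pmf_le_1)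

definition link_marginal :: "('x, 'y, 'z) protocol \<Rightarrow> 'x \<Rightarrow> 'y \<Rightarrow> link \<Rightarrow> msg pmf" where
  "link_marginal P x0 y0 l = map_pmf (\<lambda>s. concat (hist_of l s)) (final_pmf P x0 y0)"

lemma link_marginal_lim:
  assumes wf: "wf_protocol P" and trm: "terminates_as P x0 y0"
  shows "(\<lambda>t. measure_pmf.prob (run P t x0 y0) {s. concat (hist_of l s) = m \<and> terminated P t s})
    \<longlonglongrightarrow> pmf (link_marginal P x0 y0 l) m"
  using prob_final_pmf_lim[OF wf trm, of "(\<lambda>s. concat (hist_of l s)) -` {m}"]
  unfolding link_marginal_def pmf_map vimage_def by simp

lemma link_marginal_eq_0:
  assumes wf: "wf_protocol P" and trm: "terminates_as P x0 y0" and m: "m \<notin> link_transcripts P l"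
  shows "pmf (link_marginal P x0 y0 l) m = 0"
proof -
  have "measure_pmf.prob (run P t x0 y0) {s. concat (hist_of l s) = m \<and> terminated P t s}
      = measure_pmf.prob (run P t x0 y0) {}" for t
  proof (rule measure_pmf.finite_measure_eq_AE)
    show "AE s in run P t x0 y0. (s \<in> {s. concat (hist_of l s) = m \<and> terminated P t s}) = (s \<in> {})"
      unfolding AE_measure_pmf_iff
    proof
      fix s assume s: "s \<in> set_pmf (run P t x0 y0)"
      show "(s \<in> {s. concat (hist_of l s) = m \<and> terminated P t s}) = (s \<in> {})"
        using terminated_transcript[OF wf s, of l] m by auto
    qed
  qed simp_all
  then show ?thesis
    using link_marginal_lim[OF wf trm, of l m] by (simp add: LIMSEQ_const_iff)
qed

lemma link_marginal_le:
  assumes wf: "wf_protocol P" and trm: "terminates_as P x0 y0" and m: "m \<in> link_transcripts P l"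
  shows "pmf (link_marginal P x0 y0 l) m \<le> limprod (link_lik P x0 y0 l (parse (cur_link P) (code P) l m))"
proof (rule LIMSEQ_le)
  let ?w = "parse (cur_link P) (code P) l m"
  show "(\<lambda>t. measure_pmf.prob (run P t x0 y0) {s. concat (hist_of l s) = m \<and> terminated P t s})
    \<longlonglongrightarrow> pmf (link_marginal P x0 y0 l) m"
    by (rule link_marginal_lim[OF wf trm])
  show "(\<lambda>t. \<Prod>i<t. link_lik P x0 y0 l ?w i) \<longlonglongrightarrow> limprod (link_lik P x0 y0 l ?w)"
    by (rule limprod_tendsto) (rule link_lik_bounds)+
  have "\<forall>\<^sub>F t in sequentially. measure_pmf.prob (run P t x0 y0) {s. concat (hist_of l s) = m \<and> terminated P t s}
     \<le> (\<Prod>i<t. link_lik P x0 y0 l ?w i)"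
    using eventually_parse[OF m]
  proof eventually_elim
    case (elim t)
    have "measure_pmf.prob (run P t x0 y0) {s. concat (hist_of l s) = m \<and> terminated P t s}
      \<le> measure_pmf.prob (run P t x0 y0) (hist_of l -` {seq_hist (cur_link P) l ?w t})"
    proof (rule measure_pmf.finite_measure_mono_AE)
      show "AE s in run P t x0 y0. s \<in> {s. concat (hist_of l s) = m \<and> terminated P t s} \<longrightarrow>
         s \<in> hist_of l -` {seq_hist (cur_link P) l ?w t}"
        unfolding AE_measure_pmf_iff
      proof (intro ballI impI)
        fix s assume s: "s \<in> set_pmf (run P t x0 y0)" "s \<in> {s. concat (hist_of l s) = m \<and> terminated P t s}"
        obtain \<omega> where \<omega>: "seq_state (cur_link P) \<omega> t = s" "\<forall>l. coded (cur_link P) (code P) l \<omega> t"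
          using run_support[OF wf s(1)] by blast
        have "seq_hist (cur_link P) l \<omega> t = seq_hist (cur_link P) l ?w t"
          using \<omega> s(2) elim coded_parse[OF m]
          by (intro parsing_unique_hist[OF wf_prefix_free[OF wf]]) auto
        then show "s \<in> hist_of l -` {seq_hist (cur_link P) l ?w t}" using \<omega>(1) by auto
      qed
    qed simp
    also have "\<dots> \<le> (\<Prod>i<t. link_lik P x0 y0 l ?w i)"
      using prob_hist_le[OF wf coded_parse[OF m], of t x0 y0] by (simp add: pmf_map)
    finally show ?case .
  qed
  then show "\<exists>N. \<forall>t\<ge>N. measure_pmf.prob (run P t x0 y0) {s. concat (hist_of l s) = m \<and> terminated P t s}
     \<le> (\<Prod>i<t. link_lik P x0 y0 l ?w i)"
    by (simp add: eventually_sequentially)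
qed

definition party_lik :: "('x, 'y, 'z) protocol \<Rightarrow> 'x \<Rightarrow> 'y \<Rightarrow> party \<Rightarrow> link \<Rightarrow> (nat \<Rightarrow> msg) \<Rightarrow> nat \<Rightarrow> real" where
  "party_lik P x0 y0 q l \<omega> i = (if fst (sched P i) = q then link_lik P x0 y0 l \<omega> i else 1)"

text \<open>The share of party \<open>q\<close> in the chain rule of link \<open>l\<close>. The
  shares of Bob on links 12 and 23 are the future \<open>f1\<close> and \<open>g1\<close>.\<close>

definition party_weight :: "('x, 'y, 'z) protocol \<Rightarrow> 'x \<Rightarrow> 'y \<Rightarrow> party \<Rightarrow> link \<Rightarrow> msg \<Rightarrow> real" where
  "party_weight P x0 y0 q l m = of_bool (m \<in> link_transcripts P l) *
     limprod (party_lik P x0 y0 q l (parse (cur_link P) (code P) l m))"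

lemma party_lik_bounds: "0 \<le> party_lik P x0 y0 q l \<omega> i" "party_lik P x0 y0 q l \<omega> i \<le> 1"
  by (auto simp: party_lik_def link_lik_bounds)

lemma party_weight_nonneg: "0 \<le> party_weight P x0 y0 q l m"
  by (simp add: party_weight_def limprod_nonneg party_lik_bounds)

lemma link_marginal_le_party_weights:
  assumes wf: "wf_protocol P" and trm: "terminates_as P x0 y0"
    and ends: "\<And>i. cur_link P i = l \<Longrightarrow> fst (sched P i) \<in> {q, q'}" "q \<noteq> q'"
  shows "pmf (link_marginal P x0 y0 l) m \<le> party_weight P x0 y0 q l m * party_weight P x0 y0 q' l m"
proof (cases "m \<in> link_transcripts P l")
  case True
  let ?w = "parse (cur_link P) (code P) l m"
  have split: "link_lik P x0 y0 l ?w i = party_lik P x0 y0 q l ?w i * party_lik P x0 y0 q' l ?w i" for i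
    using ends(1)[of i] ends(2) by (auto simp: party_lik_def link_lik_def)
  have "(\<lambda>t. \<Prod>i<t. link_lik P x0 y0 l ?w i)
     \<longlonglongrightarrow> limprod (party_lik P x0 y0 q l ?w) * limprod (party_lik P x0 y0 q' l ?w)"
    unfolding split prod.distrib by (intro tendsto_mult limprod_tendsto party_lik_bounds)
  moreover have "(\<lambda>t. \<Prod>i<t. link_lik P x0 y0 l ?w i) \<longlonglongrightarrow> limprod (link_lik P x0 y0 l ?w)"
    by (rule limprod_tendsto) (rule link_lik_bounds)+
  ultimately have "limprod (link_lik P x0 y0 l ?w) = limprod (party_lik P x0 y0 q l ?w) * limprod (party_lik P x0 y0 q' l ?w)"
    by (metis LIMSEQ_unique)
  then show ?thesis using link_marginal_le[OF wf trm True] True by (simp add: party_weight_def)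
next
  case False
  then show ?thesis using link_marginal_eq_0[OF wf trm False] by (simp add: party_weight_def)
qed

lemma party_lik_joint:
  "party_lik P x0 y0 q L12 (joint P a b c) = party_lik P x0 y0 q L12 (parse (cur_link P) (code P) L12 a)"
  "party_lik P x0 y0 q L23 (joint P a b c) = party_lik P x0 y0 q L23 (parse (cur_link P) (code P) L23 b)"
  "party_lik P x0 y0 q L31 (joint P a b c) = party_lik P x0 y0 q L31 (parse (cur_link P) (code P) L31 c)"
  by (auto simp: fun_eq_iff party_lik_def link_lik_def seq_hist_comb comb_def)

lemma party_lik_tendsto:
  assumes "valid P a b c"
  shows "(\<lambda>t. \<Prod>i<t. party_lik P x0 y0 q L12 (joint P a b c) i) \<longlonglongrightarrow> party_weight P x0 y0 q L12 a"
    "(\<lambda>t. \<Prod>i<t. party_lik P x0 y0 q L23 (joint P a b c) i) \<longlonglongrightarrow> party_weight P x0 y0 q L23 b"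
    "(\<lambda>t. \<Prod>i<t. party_lik P x0 y0 q L31 (joint P a b c) i) \<longlonglongrightarrow> party_weight P x0 y0 q L31 c"
  using assms unfolding party_lik_joint party_weight_def valid_def
  by (auto intro!: limprod_tendsto party_lik_bounds)

text \<open>This hybrid supplies the mass bound behind \<open>R2\<close> and \<open>R3\<close>,
  while \<open>keep_Bob\<close> supplies the one behind \<open>R1\<close>. A replaced party sees
  only the past of the link on which it speaks, so its likelihood is a product of single-link
  weights.\<close>

definition replace_Bob :: "('x, 'y, 'z) protocol \<Rightarrow> 'x \<Rightarrow> 'y \<Rightarrow> ('x, 'y, 'z) protocol" where
  "replace_Bob P x0 y0 = P\<lparr>kB := \<lambda>t y h12 h23.
     if cur_link P t = L12 then link_kernel P x0 y0 L12 t h12 else link_kernel P x0 y0 L23 t h23\<rparr>"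

definition keep_Bob :: "('x, 'y, 'z) protocol \<Rightarrow> 'x \<Rightarrow> 'y \<Rightarrow> ('x, 'y, 'z) protocol" where
  "keep_Bob P x0 y0 = P\<lparr>
     kA := \<lambda>t x h12 h31.
       if cur_link P t = L12 then link_kernel P x0 y0 L12 t h12 else link_kernel P x0 y0 L31 t h31,
     kC := \<lambda>t h23 h31.
       if cur_link P t = L23 then link_kernel P x0 y0 L23 t h23 else link_kernel P x0 y0 L31 t h31\<rparr>"

lemma replaced_sel [simp]:
  "cur_link (replace_Bob P x0 y0) = cur_link P" "code (replace_Bob P x0 y0) = code P"
  "sched (replace_Bob P x0 y0) = sched P"
  "cur_link (keep_Bob P x0 y0) = cur_link P" "code (keep_Bob P x0 y0) = code P"
  "sched (keep_Bob P x0 y0) = sched P"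
  by (simp_all add: replace_Bob_def keep_Bob_def cur_link_def fun_eq_iff)

lemma wf_replace_Bob:
  assumes "wf_protocol P" shows "wf_protocol (replace_Bob P x0 y0)"
proof -
  have "set_pmf (sender_kernel (replace_Bob P x0 y0) t x y s) \<subseteq> code P (cur_link P t) t (hist_of (cur_link P t) s)" for t x y s
  proof (cases "fst (sched P t) = Bob")
    case True
    then show ?thesis
      using sender_links(2)[OF assms True] link_kernel_code[OF assms, of x0 y0 t, THEN subsetD]
      by (auto simp: sender_kernel_def replace_Bob_def)
  next
    case False
    then have "sender_kernel (replace_Bob P x0 y0) t x y s = sender_kernel P t x y s"
      by (cases "fst (sched P t)") (auto simp: sender_kernel_def replace_Bob_def)
    then show ?thesis using wf_sender_kernel[OF assms, of _ t x y s] by auto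
  qed
  then show ?thesis using assms by (simp add: wf_protocol_def)
qed

lemma wf_keep_Bob:
  assumes "wf_protocol P" shows "wf_protocol (keep_Bob P x0 y0)"
proof -
  have "set_pmf (sender_kernel (keep_Bob P x0 y0) t x y s) \<subseteq> code P (cur_link P t) t (hist_of (cur_link P t) s)" for t x y s
  proof (cases "fst (sched P t) = Bob")
    case True
    then have "sender_kernel (keep_Bob P x0 y0) t x y s = sender_kernel P t x y s"
      by (auto simp: sender_kernel_def keep_Bob_def)
    then show ?thesis using wf_sender_kernel[OF assms, of _ t x y s] by auto
  next
    case False
    then show ?thesis
      using sender_links(1,3)[OF assms, of t] link_kernel_code[OF assms, of x0 y0 t, THEN subsetD]
      by (cases "fst (sched P t)") (auto simp: sender_kernel_def keep_Bob_def)
  qed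
  then show ?thesis using assms by (simp add: wf_protocol_def)
qed

lemma lik_replace_Bob:
  assumes "wf_protocol P"
  shows "likA (replace_Bob P x0 y0) x \<omega> i = likA P x \<omega> i"
    "likC (replace_Bob P x0 y0) \<omega> i = likC P \<omega> i"
    "likB (replace_Bob P x0 y0) y \<omega> i = party_lik P x0 y0 Bob L12 \<omega> i * party_lik P x0 y0 Bob L23 \<omega> i"
  using sender_links(2)[OF assms, of i]
  by (auto simp: likA_def likB_def likC_def party_lik_def link_lik_def) (auto simp: replace_Bob_def)

lemma lik_keep_Bob:
  assumes "wf_protocol P"
  shows "likB (keep_Bob P x0 y0) y \<omega> i = likB P y \<omega> i"
    "likA (keep_Bob P x0 y0) x \<omega> i = party_lik P x0 y0 Alice L12 \<omega> i * party_lik P x0 y0 Alice L31 \<omega> i"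
    "likC (keep_Bob P x0 y0) \<omega> i = party_lik P x0 y0 Charlie L23 \<omega> i * party_lik P x0 y0 Charlie L31 \<omega> i"
  using sender_links(1,3)[OF assms, of i]
  by (auto simp: likA_def likB_def likC_def party_lik_def link_lik_def) (auto simp: keep_Bob_def)

lemma nsum_replace_Bob:
  assumes wf: "wf_protocol P"
  shows "nsum (\<lambda>(a, b, c). ennreal (weightA P x a c * party_weight P x0 y0 Bob L12 a) *
      ennreal (weightC P b c * party_weight P x0 y0 Bob L23 b)) \<le> 1"
proof -
  let ?r = "\<lambda>(a, b, c). weightA P x a c * (party_weight P x0 y0 Bob L12 a * party_weight P x0 y0 Bob L23 b) * weightC P b c"
  have "nsum (\<lambda>m. ennreal (?r m)) \<le> 1"
  proof (rule nsum_likelihood_le_1[OF wf_replace_Bob[OF wf], where x = x and y = y0], intro conjI)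
    fix a b c assume "?r (a, b, c) \<noteq> 0"
    then have v: "valid P a b c" by (auto simp: weightA_def weightC_def valid_def)
    then show "valid (replace_Bob P x0 y0) a b c" by (simp add: valid_def)
    show "(\<lambda>t. \<Prod>i<t. likelihood (replace_Bob P x0 y0) x y0 (joint (replace_Bob P x0 y0) a b c) i) \<longlonglongrightarrow> ?r (a, b, c)"
      unfolding likelihood_split lik_replace_Bob[OF wf] replaced_sel prod.distrib prod.case
      by (intro tendsto_mult lik_tendsto[OF wf v] party_lik_tendsto[OF v])
  qed
  moreover have "ennreal (?r (a, b, c)) = ennreal (weightA P x a c * party_weight P x0 y0 Bob L12 a) *
      ennreal (weightC P b c * party_weight P x0 y0 Bob L23 b)" for a b c
    by (simp add: ennreal_mult[symmetric] weight_nonneg party_weight_nonneg mult_ac)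
  ultimately show ?thesis by (simp add: case_prod_unfold)
qed

lemma nsum_keep_Bob:
  assumes wf: "wf_protocol P"
  shows "nsum (\<lambda>(a, b, c). ennreal (weightB P y a b * party_weight P x0 y0 Alice L12 a * party_weight P x0 y0 Charlie L23 b *
      (party_weight P x0 y0 Alice L31 c * party_weight P x0 y0 Charlie L31 c))) \<le> 1"
proof -
  let ?r = "\<lambda>(a, b, c). (party_weight P x0 y0 Alice L12 a * party_weight P x0 y0 Alice L31 c) * weightB P y a b *
      (party_weight P x0 y0 Charlie L23 b * party_weight P x0 y0 Charlie L31 c)"
  have "nsum (\<lambda>m. ennreal (?r m)) \<le> 1"
  proof (rule nsum_likelihood_le_1[OF wf_keep_Bob[OF wf], where x = x0 and y = y], intro conjI)
    fix a b c assume "?r (a, b, c) \<noteq> 0"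
    then have v: "valid P a b c" by (auto simp: weightB_def party_weight_def valid_def)
    then show "valid (keep_Bob P x0 y0) a b c" by (simp add: valid_def)
    show "(\<lambda>t. \<Prod>i<t. likelihood (keep_Bob P x0 y0) x0 y (joint (keep_Bob P x0 y0) a b c) i) \<longlonglongrightarrow> ?r (a, b, c)"
      unfolding likelihood_split lik_keep_Bob[OF wf] replaced_sel prod.distrib prod.case
      by (intro tendsto_mult lik_tendsto[OF wf v] party_lik_tendsto[OF v])
  qed
  then show ?thesis by (simp add: case_prod_unfold mult_ac)
qed

lemma sender_ends:
  assumes "wf_protocol P"
  shows "cur_link P i = L12 \<Longrightarrow> fst (sched P i) \<in> {Alice, Bob}"
    "cur_link P i = L23 \<Longrightarrow> fst (sched P i) \<in> {Charlie, Bob}"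
    "cur_link P i = L31 \<Longrightarrow> fst (sched P i) \<in> {Alice, Charlie}"
  using sender_links[OF assms, of i] by (cases "fst (sched P i)"; auto)+

text \<open>Dividing the law of a link by Bob's share leaves at most the share of the other end.
  This reduces the claim to the mass bound of the hybrid in which Bob is kept.\<close>

lemma nsum_keep_Bob_marginals:
  assumes wf: "wf_protocol P" and trm: "terminates_as P x0 y0"
  shows "nsum (\<lambda>(a, b). ennreal (weightB P y a b *
      (pmf (link_marginal P x0 y0 L12) a / party_weight P x0 y0 Bob L12 a) *
      (pmf (link_marginal P x0 y0 L23) b / party_weight P x0 y0 Bob L23 b))) \<le> 1"
proof -
  let ?l = "pmf (link_marginal P x0 y0 L12)" and ?n = "pmf (link_marginal P x0 y0 L23)"
    and ?m = "pmf (link_marginal P x0 y0 L31)" and ?W = "party_weight P x0 y0"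
  \<comment> \<open>Division by 0 gives 0, so strings of zero Bob weight satisfy the bound as
    well.\<close>
  have div: "u / v \<le> w" if "u \<le> w * v" "0 \<le> w" "0 \<le> v" for u v w :: real
    using that by (cases "v = 0") (auto simp: divide_le_eq)
  have l: "?l a / ?W Bob L12 a \<le> ?W Alice L12 a" for a
    by (intro div party_weight_nonneg link_marginal_le_party_weights[OF wf trm sender_ends(1)[OF wf]]) auto
  have n: "?n b / ?W Bob L23 b \<le> ?W Charlie L23 b" for b
    by (intro div party_weight_nonneg link_marginal_le_party_weights[OF wf trm sender_ends(2)[OF wf]]) auto
  have m: "?m c \<le> ?W Alice L31 c * ?W Charlie L31 c" for c
    by (intro link_marginal_le_party_weights[OF wf trm sender_ends(3)[OF wf]]) auto
  \<comment> \<open>The hybrid is about triples. Link 31 is brought in through its law of total mass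
    1, which is at most the product of the shares of Alice and Charlie.\<close>
  have "nsum (\<lambda>(a, b). ennreal (weightB P y a b * (?l a / ?W Bob L12 a) * (?n b / ?W Bob L23 b)))
    = nsum (\<lambda>(a, b). ennreal (weightB P y a b * (?l a / ?W Bob L12 a) * (?n b / ?W Bob L23 b)) * nsum (\<lambda>c. ennreal (?m c)))"
    by (simp add: nsum_pmf)
  also have "\<dots> = nsum (\<lambda>(a, b, c). ennreal (weightB P y a b * (?l a / ?W Bob L12 a) * (?n b / ?W Bob L23 b)) * ennreal (?m c))"
    by (subst (1 2) nsum_prod, subst nsum_prod, simp add: nsum_cmult)
  also have "\<dots> \<le> nsum (\<lambda>(a, b, c). ennreal (weightB P y a b * ?W Alice L12 a * ?W Charlie L23 b *
      (?W Alice L31 c * ?W Charlie L31 c)))"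
  proof (rule nsum_mono, clarify)
    fix a b c
    have "weightB P y a b * (?l a / ?W Bob L12 a) * (?n b / ?W Bob L23 b) * ?m c
      \<le> weightB P y a b * ?W Alice L12 a * ?W Charlie L23 b * (?W Alice L31 c * ?W Charlie L31 c)"
      using l[of a] n[of b] m[of c]
      by (intro mult_mono) (auto simp: weight_nonneg party_weight_nonneg)
    then show "ennreal (weightB P y a b * (?l a / ?W Bob L12 a) * (?n b / ?W Bob L23 b)) * ennreal (?m c)
      \<le> ennreal (weightB P y a b * ?W Alice L12 a * ?W Charlie L23 b * (?W Alice L31 c * ?W Charlie L31 c))"
      by (simp add: ennreal_mult'[symmetric] ennreal_leI weight_nonneg party_weight_nonneg)
  qed
  also note nsum_keep_Bob[OF wf]
  finally show ?thesis .
qed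

lemma party_weight_Bob_pos:
  assumes wf: "wf_protocol P" and trm: "terminates_as P x0 y0"
  shows "a \<in> set_pmf (link_marginal P x0 y0 L12) \<Longrightarrow> 0 < party_weight P x0 y0 Bob L12 a"
    "b \<in> set_pmf (link_marginal P x0 y0 L23) \<Longrightarrow> 0 < party_weight P x0 y0 Bob L23 b"
proof -
  have pos: "0 < v" if "0 < u" "u \<le> w * v" "0 \<le> v" for u v w :: real
    using that by (cases "v = 0") auto
  show "a \<in> set_pmf (link_marginal P x0 y0 L12) \<Longrightarrow> 0 < party_weight P x0 y0 Bob L12 a"
    by (rule pos[OF pmf_positive link_marginal_le_party_weights[OF wf trm sender_ends(1)[OF wf]]])
       (auto simp: party_weight_nonneg)
  show "b \<in> set_pmf (link_marginal P x0 y0 L23) \<Longrightarrow> 0 < party_weight P x0 y0 Bob L23 b"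
    by (rule pos[OF pmf_positive link_marginal_le_party_weights[OF wf trm sender_ends(2)[OF wf]]])
       (auto simp: party_weight_nonneg)
qed

section \<open>Entropy bounds\<close>

text \<open>\<open>ent\<close> uses an unordered infinite sum. Enumerating the countable type turns
  the integral into a series, whose partial sums are finite sums of the same terms.\<close>

lemma infsum_eq_nsum:
  fixes g :: "'a::countable \<Rightarrow> ennreal"
  shows "(\<Sum>\<^sub>\<infinity>v. g v) = nsum g"
proof (rule antisym)
  have S: "(\<Sum>\<^sub>\<infinity>v. g v) = (SUP F\<in>{F. finite F \<and> F \<subseteq> UNIV}. sum g F)"
    by (rule nonneg_infsum_complete) simp
  show "(\<Sum>\<^sub>\<infinity>v. g v) \<le> nsum g"
    unfolding S
  proof (rule SUP_least)
    fix F :: "'a set" assume "F \<in> {F. finite F \<and> F \<subseteq> UNIV}"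
    then have "sum g F = (\<integral>\<^sup>+v. g v \<partial>count_space F)" by (simp add: nn_integral_count_space_finite)
    also have "\<dots> = nsum (\<lambda>v. g v * indicator F v)" by (simp add: nn_integral_count_space_indicator)
    also have "\<dots> \<le> nsum g" by (rule nsum_mono) (simp add: indicator_def)
    finally show "sum g F \<le> nsum g" .
  qed
  let ?N = "range (to_nat :: 'a \<Rightarrow> nat)"
  have bij: "bij_betw (from_nat :: nat \<Rightarrow> 'a) ?N UNIV"
    by (auto simp: bij_betw_def inj_on_def image_image)
  have "nsum g = (\<integral>\<^sup>+k. g (from_nat k) \<partial>count_space ?N)"
    by (rule nn_integral_bij_count_space[OF bij, symmetric])
  also have "\<dots> = nsum (\<lambda>k. g (from_nat k) * indicator ?N k)"
    by (simp add: nn_integral_count_space_indicator)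
  also have "\<dots> = (\<Sum>k. g (from_nat k) * indicator ?N k)"
    by (rule nn_integral_count_space_nat)
  also have "\<dots> = (SUP n. \<Sum>k<n. g (from_nat k) * indicator ?N k)"
    by (rule suminf_eq_SUP)
  also have "\<dots> \<le> (\<Sum>\<^sub>\<infinity>v. g v)"
  proof (rule SUP_least)
    fix n
    have "(\<Sum>k<n. g (from_nat k) * indicator ?N k) = (\<Sum>k\<in>{..<n} \<inter> ?N. g (from_nat k))"
      by (intro sum.mono_neutral_cong_right) (auto simp: indicator_def)
    also have "\<dots> = sum g (from_nat ` ({..<n} \<inter> ?N))"
      using bij by (intro sum.reindex[symmetric, unfolded o_def]) (auto simp: bij_betw_def inj_on_def)
    also have "\<dots> \<le> (\<Sum>\<^sub>\<infinity>v. g v)" unfolding S by (intro SUP_upper) auto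
    finally show "(\<Sum>k<n. g (from_nat k) * indicator ?N k) \<le> (\<Sum>\<^sub>\<infinity>v. g v)" .
  qed
  finally show "nsum g \<le> (\<Sum>\<^sub>\<infinity>v. g v)" .
qed

lemma ent_pmf:
  fixes q :: "'a::countable pmf"
  shows "ent (pmf q) = (\<integral>\<^sup>+v. ennreal (- log 2 (pmf q v)) \<partial>q)"
proof -
  have "ennreal (- pmf q v * log 2 (pmf q v)) = ennreal (pmf q v) * ennreal (- log 2 (pmf q v))" for v
    by (simp add: ennreal_mult'[symmetric])
  then show ?thesis unfolding ent_def by (simp add: infsum_eq_nsum nn_integral_measure_pmf)
qed

lemma log2_pmf_nonneg: "v \<in> set_pmf q \<Longrightarrow> 0 \<le> - log 2 (pmf q v)"
  using pmf_positive[of v q] pmf_le_1[of q v] by simp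

text \<open>If \<open>- ln (pmf q v)\<close> is not integrable the entropy is infinite and nothing
  is to be shown, so the main estimates may assume integrability. The factor \<open>ln 2\<close>
  converts nats to bits.\<close>

lemma ent_pmf_ge:
  fixes q :: "'a::countable pmf"
  assumes "integrable q (\<lambda>v. - ln (pmf q v)) \<Longrightarrow> B * ln 2 \<le> measure_pmf.expectation q (\<lambda>v. - ln (pmf q v))"
  shows "ennreal B \<le> ent (pmf q)"
proof (cases "integrable q (\<lambda>v. - ln (pmf q v))")
  case True
  have i: "integrable q (\<lambda>v. - log 2 (pmf q v))"
    using Bochner_Integration.integrable_divide[OF True, of "ln 2"] by (simp add: log_def)
  have "B \<le> measure_pmf.expectation q (\<lambda>v. - ln (pmf q v)) / ln 2"
    using assms[OF True] by (subst pos_le_divide_eq) auto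
  also have "\<dots> = measure_pmf.expectation q (\<lambda>v. - log 2 (pmf q v))" by (simp add: log_def)
  also have "ennreal \<dots> = ent (pmf q)"
    unfolding ent_pmf by (rule nn_integral_eq_integral[symmetric, OF i])
      (auto simp: AE_measure_pmf_iff log2_pmf_nonneg simp del: neg_0_le_iff_le)
  finally show ?thesis by (simp add: ennreal_leI)
next
  case False
  have "(\<integral>\<^sup>+v. ennreal (- log 2 (pmf q v)) \<partial>q) = \<infinity>"
  proof (rule ccontr)
    assume fin: "(\<integral>\<^sup>+v. ennreal (- log 2 (pmf q v)) \<partial>q) \<noteq> \<infinity>"
    have "integrable q (\<lambda>v. - log 2 (pmf q v))"
      by (rule integrableI_nonneg)
         (use fin in \<open>auto simp: AE_measure_pmf_iff log2_pmf_nonneg less_top[symmetric] simp del: neg_0_le_iff_le\<close>)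
    from Bochner_Integration.integrable_mult_left[OF this, of "ln 2"] False show False by (simp add: log_def)
  qed
  then show ?thesis unfolding ent_pmf by simp
qed

lemma ent_map_pmf_le:
  fixes q :: "'a::countable pmf" and g :: "'a \<Rightarrow> 'b::countable"
  shows "ent (pmf (map_pmf g q)) \<le> ent (pmf q)"
proof -
  have "- log 2 (pmf (map_pmf g q) (g v)) \<le> - log 2 (pmf q v)" if "v \<in> set_pmf q" for v
  proof -
    have "pmf q v = measure q {v}" by (simp add: measure_pmf_single)
    also have "\<dots> \<le> pmf (map_pmf g q) (g v)" unfolding pmf_map by (rule measure_pmf.finite_measure_mono) auto
    finally show ?thesis using pmf_positive[OF that] by simp
  qed
  then show ?thesis
    unfolding ent_pmf by (auto intro!: nn_integral_mono_AE ennreal_leI simp: AE_measure_pmf_iff)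
qed

lemma ent_pair_pmf:
  fixes q :: "'a::countable pmf" and r :: "'b::countable pmf"
  shows "ent (pmf (pair_pmf q r)) = ent (pmf q) + ent (pmf r)"
proof -
  have "ent (pmf (pair_pmf q r)) = (\<integral>\<^sup>+v. \<integral>\<^sup>+w. ennreal (- log 2 (pmf q v * pmf r w)) \<partial>r \<partial>q)"
    unfolding ent_pmf by (simp add: nn_integral_pair_pmf' pmf_pair)
  also have "\<dots> = (\<integral>\<^sup>+v. \<integral>\<^sup>+w. ennreal (- log 2 (pmf q v)) + ennreal (- log 2 (pmf r w)) \<partial>r \<partial>q)"
  proof (intro nn_integral_cong_AE, unfold AE_measure_pmf_iff, intro ballI)
    fix v assume v: "v \<in> set_pmf q"
    show "(\<integral>\<^sup>+w. ennreal (- log 2 (pmf q v * pmf r w)) \<partial>r)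
       = (\<integral>\<^sup>+w. ennreal (- log 2 (pmf q v)) + ennreal (- log 2 (pmf r w)) \<partial>r)"
    proof (intro nn_integral_cong_AE, unfold AE_measure_pmf_iff, intro ballI)
      fix w assume w: "w \<in> set_pmf r"
      have "- log 2 (pmf q v * pmf r w) = - log 2 (pmf q v) + - log 2 (pmf r w)"
        using pmf_positive[OF v] pmf_positive[OF w] by (simp add: log_mult)
      then show "ennreal (- log 2 (pmf q v * pmf r w)) = ennreal (- log 2 (pmf q v)) + ennreal (- log 2 (pmf r w))"
        using log2_pmf_nonneg[OF v] log2_pmf_nonneg[OF w] by (simp only: ennreal_plus)
    qed
  qed
  also have "\<dots> = ent (pmf q) + ent (pmf r)"
    unfolding ent_pmf by (simp add: nn_integral_add)
  finally show ?thesis .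
qed

lemma ent_finite:
  fixes q :: "'a::countable pmf"
  assumes "finite (set_pmf q)" shows "ent (pmf q) < \<infinity>"
  unfolding ent_pmf using assms by (simp add: nn_integral_measure_pmf_finite ennreal_mult_less_top)

locale terminating_protocol =
  fixes p :: "'x \<times> 'y \<Rightarrow> real" and P :: "('x, 'y, 'z) protocol"
  assumes distr: "is_distr p" and wf: "wf_protocol P"
    and trm: "\<And>x y. 0 < p (x, y) \<Longrightarrow> terminates_as P x y"
begin

definition input_pmf :: "('x \<times> 'y) pmf" where "input_pmf = embed_pmf p"

definition run_pmf :: "('x \<times> 'y \<times> state) pmf" where
  "run_pmf = bind_pmf input_pmf (\<lambda>(x, y). map_pmf (\<lambda>s. (x, y, s)) (final_pmf P x y))"

lemma pmf_input: "pmf input_pmf xy = p xy"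
  unfolding input_pmf_def
proof (rule pmf_embed_pmf)
  have "nsum (\<lambda>xy. ennreal (p xy)) = (\<Sum>xy\<in>{xy. p xy \<noteq> 0}. ennreal (p xy))"
    using distr by (intro nn_integral_count_space') (auto simp: is_distr_def)
  also have "\<dots> = 1" using distr by (subst sum_ennreal) (auto simp: is_distr_def)
  finally show "nsum (\<lambda>xy. ennreal (p xy)) = 1" .
qed (use distr in \<open>auto simp: is_distr_def\<close>)

lemma set_input: "set_pmf input_pmf = {xy. 0 < p xy}"
  by (auto simp: set_pmf_eq pmf_input less_le) (use distr in \<open>auto simp: is_distr_def\<close>)

lemma pmf_bind_input:
  "pmf (bind_pmf input_pmf (\<lambda>(x, y). map_pmf (\<lambda>w. (x, y, w)) (N x y))) (x, y, w) = p (x, y) * pmf (N x y) w"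
proof -
  have "pmf (bind_pmf input_pmf (\<lambda>(x, y). map_pmf (\<lambda>w. (x, y, w)) (N x y))) (x, y, w)
    = (\<integral>i. pmf (case i of (x', y') \<Rightarrow> map_pmf (\<lambda>w. (x', y', w)) (N x' y')) (x, y, w) \<partial>input_pmf)"
    by (rule pmf_bind)
  also have "\<dots> = (\<Sum>i\<in>{(x, y)}. pmf (case i of (x', y') \<Rightarrow> map_pmf (\<lambda>w. (x', y', w)) (N x' y')) (x, y, w) * pmf input_pmf i)"
    by (rule integral_measure_pmf_real) (auto simp: set_pmf_iff[symmetric])
  also have "\<dots> = pmf (map_pmf (\<lambda>w. (x, y, w)) (N x y)) (x, y, w) * p (x, y)" by (simp add: pmf_input)
  also have "pmf (map_pmf (\<lambda>w. (x, y, w)) (N x y)) (x, y, w) = pmf (N x y) w"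
    by (rule pmf_map_inj') (simp add: inj_on_def)
  finally show ?thesis by simp
qed

lemma pmf_run_pmf: "pmf run_pmf (x, y, s) = p (x, y) * final_prob P x y s"
proof (cases "0 < p (x, y)")
  case True
  then show ?thesis unfolding run_pmf_def pmf_bind_input by (simp add: pmf_final_pmf[OF wf trm])
next
  case False
  then have "p (x, y) = 0" using distr by (simp add: is_distr_def not_less antisym)
  then show ?thesis unfolding run_pmf_def pmf_bind_input by simp
qed

lemma dist_eq: "dist p P g = pmf (map_pmf (\<lambda>(x, y, s). g x y s) run_pmf)"
proof
  fix v
  let ?A = "{(x, y, s). g x y s = v}"
  have "dist p P g v = infsum (pmf run_pmf) ?A"
    unfolding dist_def by (intro infsum_cong) (auto simp: pmf_run_pmf)
  also have "\<dots> = infsetsum (pmf run_pmf) ?A"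
    by (rule infsetsum_infsum[symmetric]) (rule pmf_abs_summable)
  also have "\<dots> = measure run_pmf ?A" by (rule measure_pmf_conv_infsetsum[symmetric])
  also have "?A = (\<lambda>(x, y, s). g x y s) -` {v}" by auto
  finally show "dist p P g v = pmf (map_pmf (\<lambda>(x, y, s). g x y s) run_pmf) v" by (simp add: pmf_map)
qed

lemma map_run_pmf_inputs: "map_pmf (\<lambda>(x, y, s). g x y) run_pmf = map_pmf (\<lambda>(x, y). g x y) input_pmf"
  unfolding run_pmf_def map_bind_pmf
  by (simp add: pmf.map_comp o_def case_prod_unfold map_pmf_const) (simp add: map_pmf_def)

lemma map_run_pmf_const:
  assumes "\<And>x y. 0 < p (x, y) \<Longrightarrow> map_pmf g (final_pmf P x y) = q"
  shows "map_pmf (\<lambda>(x, y, s). ((x, y), g s)) run_pmf = pair_pmf input_pmf q"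
proof -
  have "map_pmf (\<lambda>(x, y, s). ((x, y), g s)) run_pmf
    = bind_pmf input_pmf (\<lambda>xy. map_pmf (Pair xy) (map_pmf g (final_pmf P (fst xy) (snd xy))))"
    unfolding run_pmf_def map_bind_pmf by (simp add: pmf.map_comp o_def case_prod_unfold)
  also have "\<dots> = bind_pmf input_pmf (\<lambda>xy. map_pmf (Pair xy) q)"
    using assms by (intro bind_pmf_cong) (auto simp: set_input)
  also have "\<dots> = pair_pmf input_pmf q" by (simp add: pair_pmf_def map_pmf_def)
  finally show ?thesis .
qed

text \<open>As \<open>(b, c)\<close> determines the inputs, the joint law of transcript,
  \<open>b\<close> and \<open>c\<close> is \<open>p (x, y)\<close> times the transcript law on
  \<open>x, y\<close>. The Markov identity cancels \<open>p (x, y)\<close> and expresses the latter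
  law through \<open>b x y\<close> alone.\<close>

lemma markov_view:
  assumes mk: "markov p P (\<lambda>x y s. g s) (\<lambda>x y s. b x y) (\<lambda>x y s. c x y)"
    and inj: "inj (\<lambda>(x, y). (b x y, c x y))"
    and pos: "0 < p (x, y)" "0 < p (x', y')" and b: "b x y = b x' y'"
  shows "map_pmf g (final_pmf P x y) = map_pmf g (final_pmf P x' y')"
proof -
  have key: "pmf (map_pmf g (final_pmf P x y)) a * dist p P (\<lambda>x y s. b x y) (b x y)
     = dist p P (\<lambda>x y s. (g s, b x y)) (a, b x y)"
    and Bpos: "0 < dist p P (\<lambda>x y s. b x y) (b x y)"
    if xy: "0 < p (x, y)" for x y a
  proof -
    have "dist p P (\<lambda>x y s. (g s, b x y, c x y)) (a, b x y, c x y)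
      = pmf (map_pmf (\<lambda>(x, y, a). (a, b x y, c x y)) (map_pmf (\<lambda>(x, y, s). (x, y, g s)) run_pmf)) ((\<lambda>(x, y, a). (a, b x y, c x y)) (x, y, a))"
      by (simp add: dist_eq pmf.map_comp o_def case_prod_unfold)
    also have "\<dots> = pmf (map_pmf (\<lambda>(x, y, s). (x, y, g s)) run_pmf) (x, y, a)"
      using inj by (intro pmf_map_inj') (auto simp: inj_on_def)
    also have "map_pmf (\<lambda>(x, y, s). (x, y, g s)) run_pmf
       = bind_pmf input_pmf (\<lambda>(x, y). map_pmf (\<lambda>w. (x, y, w)) (map_pmf g (final_pmf P x y)))"
      unfolding run_pmf_def map_bind_pmf by (simp add: pmf.map_comp o_def case_prod_unfold)
    finally have 3: "dist p P (\<lambda>x y s. (g s, b x y, c x y)) (a, b x y, c x y) = p (x, y) * pmf (map_pmf g (final_pmf P x y)) a"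
      unfolding pmf_bind_input .
    have 2: "dist p P (\<lambda>x y s. (b x y, c x y)) (b x y, c x y) = p (x, y)"
      using pmf_map_inj'[OF inj, of input_pmf "(x, y)"]
      by (simp add: dist_eq map_run_pmf_inputs pmf_input)
    have "dist p P (\<lambda>x y s. (g s, b x y, c x y)) (a, b x y, c x y) * dist p P (\<lambda>x y s. b x y) (b x y)
      = dist p P (\<lambda>x y s. (g s, b x y)) (a, b x y) * dist p P (\<lambda>x y s. (b x y, c x y)) (b x y, c x y)"
      using mk unfolding markov_def by blast
    then show "pmf (map_pmf g (final_pmf P x y)) a * dist p P (\<lambda>x y s. b x y) (b x y)
       = dist p P (\<lambda>x y s. (g s, b x y)) (a, b x y)"
      unfolding 3 2 using xy by simp
    have "b x y \<in> set_pmf (map_pmf (\<lambda>(x, y). b x y) input_pmf)" using xy by (force simp: set_input)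
    then show "0 < dist p P (\<lambda>x y s. b x y) (b x y)"
      by (simp add: dist_eq map_run_pmf_inputs pmf_positive)
  qed
  show ?thesis
  proof (rule pmf_eqI)
    fix a
    show "pmf (map_pmf g (final_pmf P x y)) a = pmf (map_pmf g (final_pmf P x' y')) a"
      using key[OF pos(1), of a] key[OF pos(2), of a] Bpos[OF pos(1)] unfolding b by (metis mult_right_cancel less_irrefl)
  qed
qed

end

section \<open>Bitwise conjunction and its secure protocols\<close>

lemma bitAND_neutral: "bitAND x (replicate (length x) True) = x" "bitAND (replicate (length x) True) x = x"
  by (induction x) (auto simp: bitAND_def)

lemma bitAND_absorb:
  "length x = n \<Longrightarrow> bitAND x (replicate n False) = replicate n False"
  "length x = n \<Longrightarrow> bitAND (replicate n False) x = replicate n False"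
  by (induction x arbitrary: n) (auto simp: bitAND_def)

lemma bitAND_idem: "bitAND x x = x"
  by (induction x) (auto simp: bitAND_def)

lemma bitAND_comm: "bitAND x y = bitAND y x"
  by (simp add: bitAND_def map2_map_map zip_commute[of x y] conj_commute case_prod_unfold o_def)

lemma length_bitAND: "length x = n \<Longrightarrow> length y = n \<Longrightarrow> length (bitAND x y) = n"
  by (simp add: bitAND_def)

lemma secure_imp_terminating:
  "full_support_n n p \<Longrightarrow> secure p f P \<Longrightarrow> terminating_protocol p P"
  by unfold_locales (auto simp: full_support_n_def secure_def)

lemma secure_views:
  assumes fs: "full_support_n n p" and sec: "secure p bitAND P"
    and len: "length x = n" "length y = n" "length x' = n" "length y' = n"
  shows "x = x' \<Longrightarrow> map_pmf (\<lambda>(a, b, c). (a, c)) (transcript_pmf P x y) = map_pmf (\<lambda>(a, b, c). (a, c)) (transcript_pmf P x' y')"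
    "y = y' \<Longrightarrow> map_pmf (\<lambda>(a, b, c). (a, b)) (transcript_pmf P x y) = map_pmf (\<lambda>(a, b, c). (a, b)) (transcript_pmf P x' y')"
    "bitAND x y = bitAND x' y' \<Longrightarrow> map_pmf (\<lambda>(a, b, c). (b, c)) (transcript_pmf P x y) = map_pmf (\<lambda>(a, b, c). (b, c)) (transcript_pmf P x' y')"
proof -
  interpret terminating_protocol p P by (rule secure_imp_terminating[OF fs sec])
  have pos: "0 < p (x, y)" "0 < p (x', y')" using fs len by (auto simp: full_support_n_def)
  have m1: "markov p P (\<lambda>x y s. (concat (hist_of L12 s), concat (hist_of L31 s))) (\<lambda>x y s. x) (\<lambda>x y s. (y, bitAND x y))"
    and m2: "markov p P (\<lambda>x y s. (concat (hist_of L12 s), concat (hist_of L23 s))) (\<lambda>x y s. y) (\<lambda>x y s. (x, bitAND x y))"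
    and m3: "markov p P (\<lambda>x y s. (concat (hist_of L23 s), concat (hist_of L31 s))) (\<lambda>x y s. bitAND x y) (\<lambda>x y s. (x, y))"
    using sec unfolding secure_def M12_def M23_def M31_def by blast+
  note sim = transcript_pmf_def pmf.map_comp o_def bits_of_def prod.case
  show "x = x' \<Longrightarrow> map_pmf (\<lambda>(a, b, c). (a, c)) (transcript_pmf P x y) = map_pmf (\<lambda>(a, b, c). (a, c)) (transcript_pmf P x' y')"
    unfolding sim by (rule markov_view[OF m1 _ pos]) (auto simp: inj_on_def)
  show "y = y' \<Longrightarrow> map_pmf (\<lambda>(a, b, c). (a, b)) (transcript_pmf P x y) = map_pmf (\<lambda>(a, b, c). (a, b)) (transcript_pmf P x' y')"
    unfolding sim by (rule markov_view[OF m2 _ pos]) (auto simp: inj_on_def)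
  show "bitAND x y = bitAND x' y' \<Longrightarrow> map_pmf (\<lambda>(a, b, c). (b, c)) (transcript_pmf P x y) = map_pmf (\<lambda>(a, b, c). (b, c)) (transcript_pmf P x' y')"
    unfolding sim by (rule markov_view[OF m3 _ pos]) (auto simp: inj_on_def)
qed

lemma map_pmf_transcript:
  "map_pmf (\<lambda>(a, b, c). a) (transcript_pmf P x y) = link_marginal P x y L12"
  "map_pmf (\<lambda>(a, b, c). b) (transcript_pmf P x y) = link_marginal P x y L23"
  "map_pmf (\<lambda>(a, b, c). c) (transcript_pmf P x y) = link_marginal P x y L31"
  by (simp_all add: transcript_pmf_def link_marginal_def pmf.map_comp o_def bits_of_def)

text \<open>M12 lies in the views of Alice and Bob, so changing \<open>y\<close> and then
  \<open>x\<close> does not affect its law. For M23, Bob's privacy allows changing \<open>x\<close>,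
  and at the zero \<open>x\<close> the output ignores \<open>y\<close>, so Charlie's privacy allows
  changing \<open>y\<close>. M31 is symmetric.\<close>

lemma secure_link_marginals:
  assumes fs: "full_support_n n p" and sec: "secure p bitAND P"
    and len: "length x = n" "length y = n"
  shows "link_marginal P x y l = link_marginal P (replicate n True) (replicate n True) l"
proof -
  let ?T = "replicate n True" and ?F = "replicate n False"
  note V = secure_views[OF fs sec]
  have c1: "link_marginal P x y L12 = link_marginal P x y' L12" "link_marginal P x y L31 = link_marginal P x y' L31"
    if "length x = n" "length y = n" "length y' = n" for x y y'
    using arg_cong[OF V(1)[OF that(1,2,1,3) refl], of "map_pmf fst"]
      arg_cong[OF V(1)[OF that(1,2,1,3) refl], of "map_pmf snd"]
    unfolding map_pmf_transcript[symmetric] by (simp_all add: pmf.map_comp o_def case_prod_unfold)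
  have c2: "link_marginal P x y L12 = link_marginal P x' y L12" "link_marginal P x y L23 = link_marginal P x' y L23"
    if "length x = n" "length x' = n" "length y = n" for x x' y
    using arg_cong[OF V(2)[OF that(1,3,2,3) refl], of "map_pmf fst"]
      arg_cong[OF V(2)[OF that(1,3,2,3) refl], of "map_pmf snd"]
    unfolding map_pmf_transcript[symmetric] by (simp_all add: pmf.map_comp o_def case_prod_unfold)
  have c3: "link_marginal P x y L23 = link_marginal P x' y' L23" "link_marginal P x y L31 = link_marginal P x' y' L31"
    if "length x = n" "length y = n" "length x' = n" "length y' = n" "bitAND x y = bitAND x' y'" for x x' y y'
    using arg_cong[OF V(3)[OF that], of "map_pmf fst"] arg_cong[OF V(3)[OF that], of "map_pmf snd"]
    unfolding map_pmf_transcript[symmetric] by (simp_all add: pmf.map_comp o_def case_prod_unfold)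
  have TF: "length ?T = n" "length ?F = n" by simp_all
  show ?thesis
  proof (cases l)
    case L12
    then show ?thesis using c1(1)[OF len(1,2) TF(1)] c2(1)[OF len(1) TF(1,1)] by simp
  next
    case L23
    have "link_marginal P x y L23 = link_marginal P ?F y L23" by (rule c2(2)[OF len(1) TF(2) len(2)])
    also have "\<dots> = link_marginal P ?F ?T L23"
      by (rule c3(1)[OF TF(2) len(2) TF(2,1)]) (simp add: bitAND_absorb len)
    also have "\<dots> = link_marginal P ?T ?T L23" by (rule c2(2)[OF TF(2,1,1)])
    finally show ?thesis using L23 by simp
  next
    case L31
    have "link_marginal P x y L31 = link_marginal P x ?F L31" by (rule c1(2)[OF len(1,2) TF(2)])
    also have "\<dots> = link_marginal P ?T ?F L31"
      by (rule c3(2)[OF len(1) TF(2,1,2)]) (simp add: bitAND_absorb len)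
    also have "\<dots> = link_marginal P ?T ?T L31" by (rule c1(2)[OF TF(1,2,1)])
    finally show ?thesis using L31 by simp
  qed
qed

text \<open>The all-ones string \<open>T\<close> is neutral for the conjunction, so it separates any
  two inputs of the other party; it also serves as reference input of the one-link laws. The
  diagonal inputs \<open>(z, z)\<close> represent every output \<open>z\<close>.\<close>

lemma secure_sequential_transcripts:
  assumes fs: "full_support_n n p" and sec: "secure p bitAND P"
  defines "T \<equiv> replicate n True"
  shows "sequential_transcripts {x. length x = n} {y. length y = n} bitAND (transcript_pmf P)
    (\<lambda>x. map_pmf (\<lambda>(a, b, c). (a, c)) (transcript_pmf P x T))
    (\<lambda>y. map_pmf (\<lambda>(a, b, c). (a, b)) (transcript_pmf P T y))
    (\<lambda>z. map_pmf (\<lambda>(a, b, c). (b, c)) (transcript_pmf P z z))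
    (link_marginal P T T L12) (link_marginal P T T L23) (link_marginal P T T L31)
    (weightA P) (weightB P) (weightC P) (party_weight P T T Bob L12) (party_weight P T T Bob L23)"
proof -
  interpret terminating_protocol p P by (rule secure_imp_terminating[OF fs sec])
  have T: "length T = n" by (simp add: T_def)
  have pos: "0 < p (x, y)" if "length x = n" "length y = n" for x y
    using fs that by (auto simp: full_support_n_def)
  have term_at: "terminates_as P x y" if "length x = n" "length y = n" for x y
    using trm pos that by blast
  note V = secure_views[OF fs sec]
  have outC: "outC P b c = bitAND x y"
    if xy: "length x = n" "length y = n" and m: "(a, b, c) \<in> set_pmf (transcript_pmf P x y)" for x y a b c
  proof -
    obtain s where s: "s \<in> set_pmf (final_pmf P x y)" "bits_of s = (a, b, c)"
      using m by (auto simp: transcript_pmf_def)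
    have "0 < final_prob P x y s"
      using pmf_positive[OF s(1)] unfolding pmf_final_pmf[OF wf term_at[OF xy]] .
    then have "outC P (M23 x y s) (M31 x y s) = bitAND x y"
      using sec pos[OF xy] unfolding secure_def by blast
    then show ?thesis using s(2) by (simp add: bits_of_def M23_def M31_def)
  qed
  have fin: "finite {x :: bool list. length x = n}"
    using finite_lists_length_eq[of "UNIV :: bool set" n] by simp
  have bT: "bitAND x T = x" "bitAND T x = x" if "length x = n" for x
    using bitAND_neutral[of x] that by (simp_all add: T_def)
  show ?thesis
  proof unfold_locales
    fix x y :: "bool list" assume xy: "x \<in> {x. length x = n}" "y \<in> {y. length y = n}"
    then have l: "length x = n" "length y = n" by auto
    show "map_pmf (\<lambda>(a, b, c). (a, c)) (transcript_pmf P x y) = map_pmf (\<lambda>(a, b, c). (a, c)) (transcript_pmf P x T)"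
      by (rule V(1)[OF l l(1) T refl])
    show "map_pmf (\<lambda>(a, b, c). (a, b)) (transcript_pmf P x y) = map_pmf (\<lambda>(a, b, c). (a, b)) (transcript_pmf P T y)"
      by (rule V(2)[OF l T l(2) refl])
    show "map_pmf (\<lambda>(a, b, c). (b, c)) (transcript_pmf P x y) = map_pmf (\<lambda>(a, b, c). (b, c)) (transcript_pmf P (bitAND x y) (bitAND x y))"
      by (rule V(3)[OF l]) (simp_all add: bitAND_idem length_bitAND l)
    show "map_pmf (\<lambda>(a, b, c). a) (transcript_pmf P x y) = link_marginal P T T L12"
      "map_pmf (\<lambda>(a, b, c). b) (transcript_pmf P x y) = link_marginal P T T L23"
      "map_pmf (\<lambda>(a, b, c). c) (transcript_pmf P x y) = link_marginal P T T L31"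
      unfolding map_pmf_transcript T_def by (rule secure_link_marginals[OF fs sec l])+
    show "pmf (transcript_pmf P x y) (a, b, c) = weightA P x a c * weightB P y a b * weightC P b c" for a b c
      by (rule transcript_factor[OF wf term_at[OF l]])
  next
    fix x y x' y' :: "bool list" and a a' b c
    assume "x \<in> {x. length x = n}" "y \<in> {y. length y = n}" "x' \<in> {x. length x = n}" "y' \<in> {y. length y = n}"
      "(a, b, c) \<in> set_pmf (transcript_pmf P x y)" "(a', b, c) \<in> set_pmf (transcript_pmf P x' y')"
    then show "bitAND x y = bitAND x' y'" using outC[of x y a b c] outC[of x' y' a' b c] by simp
  next
    fix x x' :: "bool list" assume "x \<in> {x. length x = n}" "x' \<in> {x. length x = n}" "x \<noteq> x'"
    then show "\<exists>y\<in>{y. length y = n}. bitAND x y \<noteq> bitAND x' y" using T bT by (intro bexI[of _ T]) auto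
  next
    fix y y' :: "bool list" assume "y \<in> {x. length x = n}" "y' \<in> {x. length x = n}" "y \<noteq> y'"
    then show "\<exists>x\<in>{x. length x = n}. bitAND x y \<noteq> bitAND x y'" using T bT by (intro bexI[of _ T]) auto
  next
    fix y
    show "nsum (\<lambda>(a, b). ennreal (weightB P y a b * (pmf (link_marginal P T T L12) a / party_weight P T T Bob L12 a) *
        (pmf (link_marginal P T T L23) b / party_weight P T T Bob L23 b))) \<le> 1"
      by (rule nsum_keep_Bob_marginals[OF wf term_at[OF T T]])
  next
    fix x
    show "nsum (\<lambda>(a, b, c). ennreal (weightA P x a c * party_weight P T T Bob L12 a) *
        ennreal (weightC P b c * party_weight P T T Bob L23 b)) \<le> 1"
      by (rule nsum_replace_Bob[OF wf])
  qed (use fin T in \<open>auto simp: weight_nonneg party_weight_nonneg party_weight_Bob_pos[OF wf term_at[OF T T]]\<close>)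
qed

text \<open>Shannon entropy is at least collision entropy: average \<open>- ln t \<ge> 1 - t\<close>
  at \<open>t = N * pmf q v\<close>, whose mean is at most 1.\<close>

lemma ent_ge_collision:
  fixes q :: "'a::countable pmf"
  assumes "0 < N" "(\<integral>\<^sup>+v. ennreal (N * pmf q v) \<partial>q) \<le> 1"
  shows "ennreal (log 2 N) \<le> ent (pmf q)"
proof (rule ent_pmf_ge)
  assume i: "integrable q (\<lambda>v. - ln (pmf q v))"
  have R: "integrable q (\<lambda>v. N * pmf q v)" "measure_pmf.expectation q (\<lambda>v. N * pmf q v) \<le> 1"
    using integrable_expectation_le[of q "\<lambda>v. N * pmf q v" 1] assms by auto
  have "ln N \<le> ln N + (1 - measure_pmf.expectation q (\<lambda>v. N * pmf q v))" using R(2) by linarith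
  also have "\<dots> = measure_pmf.expectation q (\<lambda>v. ln N + (1 - N * pmf q v))" using R(1) by simp
  also have "\<dots> \<le> measure_pmf.expectation q (\<lambda>v. - ln (pmf q v))"
  proof (rule expectation_mono_pmf)
    fix v assume "v \<in> set_pmf q"
    then have "0 < pmf q v" by (rule pmf_positive)
    then show "ln N + (1 - N * pmf q v) \<le> - ln (pmf q v)"
      using ln_ge_one_minus_inverse[of "N * pmf q v"] assms(1) by (simp add: ln_mult)
  qed (use R(1) i in auto)
  finally show "log 2 N * ln 2 \<le> measure_pmf.expectation q (\<lambda>v. - ln (pmf q v))" by (simp add: log_def)
qed

text \<open>In each position three of the four bit pairs are allowed, all but
  \<open>(False, True)\<close>.\<close>

lemma card_below_pairs:
  "card {(x, y). length x = n \<and> length y = n \<and> bitAND x y = y} = 3 ^ n"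
proof -
  let ?A = "{(True, True), (True, False), (False, False)}"
  let ?S = "{w. set w \<subseteq> ?A \<and> length w = n}"
  let ?u = "\<lambda>w :: (bool \<times> bool) list. (map fst w, map snd w)"
  have "{(x, y). length x = n \<and> length y = n \<and> bitAND x y = y} = ?u ` ?S"
  proof (intro equalityI subsetI)
    fix i assume "i \<in> {(x, y). length x = n \<and> length y = n \<and> bitAND x y = y}"
    then obtain x y where i: "i = (x, y)" "length x = n" "length y = n" "bitAND x y = y" by auto
    let ?w = "zip x y"
    have w: "map fst ?w = x" "map snd ?w = y" using i by simp_all
    have "map (\<lambda>(a, b). a \<and> b) ?w = map snd ?w" using i(4) w bitAND_map[of ?w] by simp
    then have "\<forall>v\<in>set ?w. (case v of (a, b) \<Rightarrow> a \<and> b) = snd v" unfolding map_eq_conv .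
    then have "set ?w \<subseteq> ?A" by fastforce
    then have "?w \<in> ?S" using i by simp
    moreover have "i = ?u ?w" using w i by simp
    ultimately show "i \<in> ?u ` ?S" by blast
  next
    fix i assume "i \<in> ?u ` ?S"
    then obtain w where w: "i = ?u w" "set w \<subseteq> ?A" "length w = n" by auto
    have "map (\<lambda>(a, b). a \<and> b) w = map snd w" using w(2) by (intro map_cong) auto
    then show "i \<in> {(x, y). length x = n \<and> length y = n \<and> bitAND x y = y}"
      using w by (simp add: bitAND_map)
  qed
  moreover have "inj_on ?u ?S" by (auto simp: inj_on_def intro: pair_list_eqI)
  moreover have "card ?S = 3 ^ n" by (subst card_lists_length_eq) (auto simp: numeral_3_eq_3)
  ultimately show ?thesis by (simp add: card_image)
qed

text \<open>The convergent 19/12 rests on 2^19 = 524288 < 531441 = 3^12. It yields 2 log 3 - 4/3 at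
  least 11/6, which exceeds 1.826.\<close>

lemma log2_3_bound: "19 / 12 \<le> log 2 (3::real)"
proof -
  have "ln (2 ^ 19) \<le> ln (3 ^ 12 :: real)" by simp
  then have "19 * ln 2 \<le> 12 * ln (3::real)"
    by (subst (asm) (1 2) ln_realpow) simp_all
  then show ?thesis by (simp add: log_def field_simps)
qed

lemma secure_entropy_bounds:
  assumes fs: "full_support_n n p" and sec: "secure p bitAND P"
  defines "T \<equiv> replicate n True"
  shows "ennreal (real n * log 2 3) \<le> ent (pmf (link_marginal P T T L31))"
    "ennreal (real n * log 2 3) \<le> ent (pmf (link_marginal P T T L23))"
    "ennreal (1.826 * real n) \<le> ent (pmf (link_marginal P T T L12))"
proof -
  note seq = secure_sequential_transcripts[OF fs sec, folded T_def]
  interpret S: sequential_transcripts "{x. length x = n}" "{y. length y = n}" bitAND "transcript_pmf P"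
    "\<lambda>x. map_pmf (\<lambda>(a, b, c). (a, c)) (transcript_pmf P x T)"
    "\<lambda>y. map_pmf (\<lambda>(a, b, c). (a, b)) (transcript_pmf P T y)"
    "\<lambda>z. map_pmf (\<lambda>(a, b, c). (b, c)) (transcript_pmf P z z)"
    "link_marginal P T T L12" "link_marginal P T T L23" "link_marginal P T T L31"
    "weightA P" "weightB P" "weightC P" "party_weight P T T Bob L12" "party_weight P T T Bob L23"
    by (rule seq)
  have l3: "log 2 (3 ^ n) = real n * log 2 3" by (simp add: log_nat_power)
  \<comment> \<open>On these pairs the output is \<open>y\<close> itself, so equal outputs force
    equal \<open>y\<close>, as \<open>collision_bound\<close> demands.\<close>
  let ?S = "{(x, y). length x = n \<and> length y = n \<and> bitAND x y = y}"
  have "(\<integral>\<^sup>+c. ennreal (real (card ?S) * pmf (link_marginal P T T L31) c) \<partial>link_marginal P T T L31) \<le> 1"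
    by (rule S.collision_bound) auto
  then show "ennreal (real n * log 2 3) \<le> ent (pmf (link_marginal P T T L31))"
    using ent_ge_collision[of "3 ^ n" "link_marginal P T T L31"] by (simp add: card_below_pairs l3)
  have "(\<integral>\<^sup>+c. ennreal (real (card ?S) * pmf (link_marginal P T T L23) c) \<partial>link_marginal P T T L23) \<le> 1"
    \<comment> \<open>With Alice and Bob exchanged, the same set is read with Bob's input first;
      commutativity of the conjunction shows that the output now determines Alice's input.\<close>
    by (rule private_transcripts.collision_bound[OF S.swapped]) (auto simp: bitAND_comm)
  then show "ennreal (real n * log 2 3) \<le> ent (pmf (link_marginal P T T L23))"
    using ent_ge_collision[of "3 ^ n" "link_marginal P T T L23"] by (simp add: card_below_pairs l3)
  show "ennreal (1.826 * real n) \<le> ent (pmf (link_marginal P T T L12))"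
  proof (rule ent_pmf_ge)
    assume i: "integrable (link_marginal P T T L12) (\<lambda>v. - ln (pmf (link_marginal P T T L12) v))"
    have "1.826 \<le> 2 * log 2 3 - (4/3 :: real)" using log2_3_bound by simp
    then have "1.826 * ln 2 \<le> (2 * log 2 3 - 4/3) * ln (2::real)" by (intro mult_right_mono) auto
    also have "\<dots> = 2 * ln 3 - 4/3 * ln 2" by (simp add: log_def left_diff_distrib)
    finally have "real n * (1.826 * ln 2) \<le> real n * (2 * ln 3 - 4/3 * ln 2)" by (intro mult_left_mono) auto
    also note entropy_and_ge[OF seq i]
    finally show "1.826 * real n * ln 2 \<le> measure_pmf.expectation (link_marginal P T T L12) (\<lambda>v. - ln (pmf (link_marginal P T T L12) v))"
      by (simp add: mult_ac)
  qed
qed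

theorem theorem8:
  fixes n :: nat and p :: "bool list \<times> bool list \<Rightarrow> real"
  assumes "n \<ge> 1" and "full_support_n n p"
  shows "(\<forall>P. secure p bitAND P \<longrightarrow>
            H p P M31 \<ge> ennreal (real n * log 2 3) \<and>
            H p P M23 \<ge> ennreal (real n * log 2 3) \<and>
            H p P M12 \<ge> ennreal (1.826 * real n))
         \<and> rho p bitAND \<ge> ennreal (1.826 * real n)"
proof -
  note fs = assms(2)
  let ?T = "replicate n True"
  have main: "H p P M31 \<ge> ennreal (real n * log 2 3)" "H p P M23 \<ge> ennreal (real n * log 2 3)"
    "H p P M12 \<ge> ennreal (1.826 * real n)" "cond_view_ent p bitAND P \<ge> ennreal (1.826 * real n)"
    if sec: "secure p bitAND P" for P :: "(bool list, bool list, bool list) protocol"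
  proof -
    interpret terminating_protocol p P by (rule secure_imp_terminating[OF fs sec])
    have marg: "map_pmf (\<lambda>s. concat (hist_of l s)) (final_pmf P x y) = link_marginal P ?T ?T l"
      if "0 < p (x, y)" for x y l
      using secure_link_marginals[OF fs sec, of x y l] fs that
      by (auto simp: full_support_n_def link_marginal_def)
    \<comment> \<open>A transcript law that is the same for all inputs makes the transcript
      independent of the inputs. This gives both the marginals of the links and H(X,Y,M12) = H(X,Y)
      + H(M12).\<close>
    have pair: "map_pmf (\<lambda>(x, y, s). ((x, y), concat (hist_of l s))) run_pmf = pair_pmf input_pmf (link_marginal P ?T ?T l)" for l
      by (rule map_run_pmf_const) (rule marg)
    have link: "map_pmf (\<lambda>(x, y, s). concat (hist_of l s)) run_pmf = link_marginal P ?T ?T l" for l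
      using arg_cong[OF pair[of l], of "map_pmf snd"] by (simp add: pmf.map_comp o_def case_prod_unfold map_snd_pair_pmf)
    note bounds = secure_entropy_bounds[OF fs sec]
    show "H p P M31 \<ge> ennreal (real n * log 2 3)" "H p P M23 \<ge> ennreal (real n * log 2 3)"
      "H p P M12 \<ge> ennreal (1.826 * real n)"
      using bounds unfolding H_def dist_eq M12_def M23_def M31_def link by simp_all
    let ?view = "\<lambda>(x, y, s). (x, y, M12 x y s, M23 x y s, M31 x y s, bitAND x y)"
    have in_ent: "H p P (\<lambda>x y s. (x, y)) = ent (pmf input_pmf)"
      unfolding H_def dist_eq map_run_pmf_inputs by (simp add: case_prod_unfold)
    have "set_pmf input_pmf \<subseteq> {xy. p xy \<noteq> 0}" by (auto simp: set_input)
    moreover have "finite {xy. p xy \<noteq> 0}" using distr unfolding is_distr_def by blast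
    ultimately have "finite (set_pmf input_pmf)" by (rule finite_subset)
    \<comment> \<open>Finite input entropy is what permits moving it across the
      \<open>ennreal\<close> subtraction in \<open>cond_view_ent\<close>.\<close>
    then have fin: "ent (pmf input_pmf) < \<infinity>" by (rule ent_finite)
    have "ent (pmf input_pmf) + ennreal (1.826 * real n) \<le> ent (pmf input_pmf) + ent (pmf (link_marginal P ?T ?T L12))"
      using bounds(3) by (rule add_left_mono)
    also have "\<dots> = ent (pmf (map_pmf (\<lambda>(x, y, s). ((x, y), concat (hist_of L12 s))) run_pmf))"
      by (simp add: pair ent_pair_pmf)
    also have "map_pmf (\<lambda>(x, y, s). ((x, y), concat (hist_of L12 s))) run_pmf
      = map_pmf (\<lambda>(x, y, a, _). ((x, y), a)) (map_pmf ?view run_pmf)"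
      by (simp add: pmf.map_comp o_def case_prod_unfold M12_def)
    also have "ent (pmf \<dots>) \<le> ent (pmf (map_pmf ?view run_pmf))"
      by (rule ent_map_pmf_le)
    also have "\<dots> = H p P (\<lambda>x y s. (x, y, M12 x y s, M23 x y s, M31 x y s, bitAND x y))"
      by (simp add: H_def dist_eq)
    finally have "ennreal (1.826 * real n) + ent (pmf input_pmf) \<le> H p P (\<lambda>x y s. (x, y, M12 x y s, M23 x y s, M31 x y s, bitAND x y))"
      by (simp add: add.commute)
    then show "cond_view_ent p bitAND P \<ge> ennreal (1.826 * real n)"
      unfolding cond_view_ent_def in_ent using fin by (simp add: ennreal_le_minus_iff)
  qed
  have "rho p bitAND \<ge> ennreal (1.826 * real n)"
    unfolding rho_def using main(4) by (intro INF_greatest) simp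
  then show ?thesis using main by blast
qed

end
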